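(* For every composition $\alpha=(\alpha_1,\dots,\alpha_r)$ of $|I|$, every $0\le p\le r$ and every ordered decomposition $I=S\sqcup T$ of a finite set with $|S|=c_p$, the map $\Delta^p_{S,T}$ is natural under relabeling, preserves the two weight degrees, and is a degree-zero chain map $$\Delta^p_{S,T}:C_k^{t,q}(\alpha)[I]\longrightarrow\bigoplus_{a+b=k}C_a^{t,q}(\alpha_{\le p})[S]\otimes C_b^{t,q}(\alpha_{>p})[T],$$ where the target has the usual tensor-product differential. The natural transformation $\Delta:\mathcal C_\bullet\to\mathcal C_\bullet\cdot\mathcal C_\bullet$ is coassociative and counital. Explicitly, for every ordered decomposition $I=R\sqcup S\sqcup T$, $$(\Delta_{R,S}\otimes\operatorname{id})\Delta_{R\sqcup S,T}=(\operatorname{id}\otimes\Delta_{S,T})\Delta_{R,S\sqcup T},$$ and the endpoint components satisfy $$(\epsilon\otimes\operatorname{id})\Delta_{\varnothing,I}=\operatorname{id}_{\mathcal C_\bullet[I]},\qquad(\operatorname{id}\otimes\epsilon)\Delta_{I,\varnothing}=\operatorname{id}_{\mathcal C_\bullet[I]}.$$ Thus $(\mathcal C_\bullet,\Delta,\epsilon)$ is a counital differential graded comonoid in the Cauchy monoidal category of species.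
   Context: Conventions. $[m]=\{1,\dots,m\}$, $[0]=\varnothing$; $\mathbb K$ is a field of characteristic zero and all vector spaces are over $\mathbb K$. For $m\ge0$, $m^+=\lceil m/2\rceil$ and $m^-=\lfloor m/2\rfloor$. A composition $\alpha=(\alpha_1,\dots,\alpha_r)\models n$ is a sequence of positive integers with sum $n$ (the empty composition $\varnothing$ is the composition of $0$); $\ell(\alpha)=r$; its cut set is $D(\alpha)=\{\alpha_1,\alpha_1+\alpha_2,\dots,\alpha_1+\cdots+\alpha_{r-1}\}\subseteq[n-1]$. For nonempty $\beta,\alpha\models n$, $\beta\succeq\alpha$ means $D(\beta)\subseteq D(\alpha)$. Decorations. $c(\cdot)$ is the number of cycles of a permutation, fixed points included. For $\sigma\in\mathfrak S_a$, $\sigma'\in\mathfrak S_b$, $\sigma\oplus\sigma'\in\mathfrak S_{a+b}$ acts as $\sigma$ on $[a]$ and by $a+j\mapsto a+\sigma'(j)$ on the rest. $\mathfrak R_s$ is the set of permutations of $\{\ast,1,\dots,s\}$; the cycle containing $\ast$ is the root cycle, written starting at $\ast$. For $\tau\in\mathfrak R_a$, $\upsilon\in\mathfrak R_b$ with root cycles $(\ast,a_1,\dots,a_u)$ and $(\ast,b_1,\dots,b_v)$, $\tau\star\upsilon\in\mathfrak R_{a+b}$ has root cycle $(\ast,a_1,\dots,a_u,a+b_1,\dots,a+b_v)$, and its nonroot cycles are those of $\tau$ together with those of $\upsilon$ with every letter shifted by $a$. For $m\ge1$, $\mathcal D_m=\mathfrak S_{m^+}\times\mathfrak R_{m^-}$;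 for $\xi=(\sigma,\tau)\in\mathcal D_m$, $\deg_q\xi=m^+-c(\sigma)$ and $\deg_t\xi=c(\sigma)+c(\tau)-1$ (the two weight degrees). If $a,b$ are not both odd, $(\sigma,\tau)\diamond(\sigma',\tau')=(\sigma\oplus\sigma',\tau\star\tau')$ defines $\diamond:\mathcal D_a\times\mathcal D_b\to\mathcal D_{a+b}$. Decorated complex. Let $I$ be a finite set, $|I|=n\ge1$, $\alpha\models n$. For $\beta=(\beta_1,\dots,\beta_k)\models n$, $\operatorname{OSP}_\beta[I]$ is the set of ordered set partitions $(B_1,\dots,B_k)$ of $I$ with $|B_i|=\beta_i$. $C_k^{t,q}(\alpha)[I]$ has basis the elements $(B_1,\dots,B_k;\xi_1,\dots,\xi_k)$ with $\beta\succeq\alpha$, $\ell(\beta)=k$, $(B_1,\dots,B_k)\in\operatorname{OSP}_\beta[I]$, $\xi_i\in\mathcal D_{\beta_i}$, bigraded by the sums of the $\deg_t\xi_i$ and of the $\deg_q\xi_i$. The differential is $\sum_{i=1}^{k-1}(-1)^{i-1}d_i^{t,q}$, where $d_i^{t,q}$ merges $B_i,B_{i+1}$ into $B_i\sqcup B_{i+1}$ and replaces $\xi_i,\xi_{i+1}$ by $\xi_i\diamond\xi_{i+1}$ if $\beta_i,\beta_{i+1}$ are not both odd, and is $0$ if both are odd. Also $C_0^{t,q}(\varnothing)[\varnothing]=\mathbb K$ (spanned by the empty bar), all other terms for $\varnothing$ being zero. Species. $\mathcal C_\bullet[I]=\bigoplus_{\alpha\models|I|}C_\bullet^{t,q}(\alpha)[I]$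 for $I\ne\varnothing$ and $\mathcal C_\bullet[\varnothing]=C_\bullet^{t,q}(\varnothing)[\varnothing]$; relabeling blocks along bijections makes $\mathcal C_\bullet$ a species in bigraded chain complexes. The Cauchy product is $(\mathcal F\cdot\mathcal G)[I]=\bigoplus_{I=S\sqcup T}\mathcal F[S]\otimes\mathcal G[T]$ over ordered decompositions ($S,T$ possibly empty). The unit species $\mathbf 1$ is $\mathbb K$ on the empty set and $0$ otherwise; $\epsilon:\mathcal C_\bullet\to\mathbf 1$ is the identity on $\mathcal C_\bullet[\varnothing]=\mathbb K$ and zero on nonempty sets. Cut coproduct. For $\alpha=(\alpha_1,\dots,\alpha_r)$ and $0\le p\le r$, $c_p=\alpha_1+\cdots+\alpha_p$ ($c_0=0$), $\alpha_{\le p}=(\alpha_1,\dots,\alpha_p)$, $\alpha_{>p}=(\alpha_{p+1},\dots,\alpha_r)$. For $I=S\sqcup T$ with $|S|=c_p$ and a basis element $w=(B_1,\dots,B_k;\xi_1,\dots,\xi_k)$ of $C_k^{t,q}(\alpha)[I]$, $$\Delta^p_{S,T}(w)=(B_1,\dots,B_j;\xi_1,\dots,\xi_j)\otimes(B_{j+1},\dots,B_k;\xi_{j+1},\dots,\xi_k)$$ if $S=B_1\sqcup\cdots\sqcup B_j$ for some $0\le j\le k$, and $\Delta^p_{S,T}(w)=0$ otherwise (empty prefix/suffix is the empty bar). For every ordered decomposition $I=S\sqcup T$, $\Delta_{S,T}:\mathcal C_\bullet[I]\to\mathcal C_\bullet[S]\otimes\mathcal C_\bullet[T]$ restricts on the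 summand $C_\bullet^{t,q}(\alpha)[I]$ to $\Delta^p_{S,T}$ if $|S|=c_p$ for some (necessarily unique) $p$, and to $0$ otherwise; $\Delta_I=\bigoplus_{I=S\sqcup T}\Delta_{S,T}$. *)

theory Defs
  imports Complex_Main "HOL-Library.Poly_Mapping" "HOL-Combinatorics.Combinatorics"
begin

section \<open>Free vector spaces\<close>

text \<open>The vector space with basis \<open>X\<close> is the space of finitely supported functions
  \<open>'x \<Rightarrow>\<^sub>0 'k\<close> with support in \<open>X\<close>.  The tensor product of the spaces with bases \<open>X\<close> and \<open>Y\<close>
  is the space with basis \<open>X \<times> Y\<close>.\<close>

definition scl :: "'k::field \<Rightarrow> ('x \<Rightarrow>\<^sub>0 'k) \<Rightarrow> ('x \<Rightarrow>\<^sub>0 'k)" where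
  "scl c v = Poly_Mapping.map ((*) c) v"

abbreviation single1 :: "'x \<Rightarrow> ('x \<Rightarrow>\<^sub>0 'k::field)" where
  "single1 x \<equiv> Poly_Mapping.single x 1"

text \<open>Linear extension of a function given on basis elements.\<close>

definition lin :: "('x \<Rightarrow> ('y \<Rightarrow>\<^sub>0 'k::field)) \<Rightarrow> ('x \<Rightarrow>\<^sub>0 'k) \<Rightarrow> ('y \<Rightarrow>\<^sub>0 'k)" where
  "lin f v = (\<Sum>x \<in> Poly_Mapping.keys v. scl (Poly_Mapping.lookup v x) (f x))"

definition tens :: "('x \<Rightarrow>\<^sub>0 'k::field) \<Rightarrow> ('y \<Rightarrow>\<^sub>0 'k) \<Rightarrow> ('x \<times> 'y \<Rightarrow>\<^sub>0 'k)" where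
  "tens u v = lin (\<lambda>x. lin (\<lambda>y. single1 (x, y)) v) u"

definition tmap ::
  "(('x \<Rightarrow>\<^sub>0 'k::field) \<Rightarrow> ('x' \<Rightarrow>\<^sub>0 'k)) \<Rightarrow> (('y \<Rightarrow>\<^sub>0 'k) \<Rightarrow> ('y' \<Rightarrow>\<^sub>0 'k))
    \<Rightarrow> ('x \<times> 'y \<Rightarrow>\<^sub>0 'k) \<Rightarrow> ('x' \<times> 'y' \<Rightarrow>\<^sub>0 'k)" where
  "tmap f g = lin (\<lambda>(x, y). tens (f (single1 x)) (g (single1 y)))"

text \<open>The canonical isomorphisms \<open>(U \<otimes> V) \<otimes> W \<cong> U \<otimes> (V \<otimes> W)\<close>, \<open>K \<otimes> V \<cong> V\<close> and \<open>V \<otimes> K \<cong> V\<close>;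
  the ground field is the space with basis \<open>{()}\<close>.\<close>

definition reassoc :: "(('x \<times> 'y) \<times> 'z \<Rightarrow>\<^sub>0 'k::field) \<Rightarrow> ('x \<times> 'y \<times> 'z \<Rightarrow>\<^sub>0 'k)" where
  "reassoc = lin (\<lambda>((x, y), z). single1 (x, y, z))"

definition left_unit :: "(unit \<times> 'x \<Rightarrow>\<^sub>0 'k::field) \<Rightarrow> ('x \<Rightarrow>\<^sub>0 'k)" where
  "left_unit = lin (\<lambda>(u, x). single1 x)"

definition right_unit :: "('x \<times> unit \<Rightarrow>\<^sub>0 'k::field) \<Rightarrow> ('x \<Rightarrow>\<^sub>0 'k)" where
  "right_unit = lin (\<lambda>(x, u). single1 x)"


section \<open>Bigraded chain complexes with a homogeneous basis\<close>

record (overloaded) ('x, 'k) bicomplex =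
  basis_of :: "'x set"
  hdeg :: "'x \<Rightarrow> int"  \<comment> \<open>homological degree\<close>
  tdeg :: "'x \<Rightarrow> int"  \<comment> \<open>the two weight degrees\<close>
  qdeg :: "'x \<Rightarrow> int"
  bd :: "('x \<Rightarrow>\<^sub>0 'k) \<Rightarrow> ('x \<Rightarrow>\<^sub>0 'k)"

definition chain_space :: "('x, 'k::field) bicomplex \<Rightarrow> ('x \<Rightarrow>\<^sub>0 'k) set" where
  "chain_space C = {v. Poly_Mapping.keys v \<subseteq> basis_of C}"

definition homog :: "('x, 'k::field) bicomplex \<Rightarrow> int \<Rightarrow> int \<Rightarrow> int \<Rightarrow> ('x \<Rightarrow>\<^sub>0 'k) set" where
  "homog C k t q =
    {v. Poly_Mapping.keys v \<subseteq> {x \<in> basis_of C. hdeg C x = k \<and> tdeg C x = t \<and> qdeg C x = q}}"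

text \<open>A linear map out of \<open>chain_space C\<close> is represented by a linear map on all of \<open>'x \<Rightarrow>\<^sub>0 'k\<close>; only its
  values on \<open>chain_space C\<close> are relevant.\<close>

definition chain_complex :: "('x, 'k::field) bicomplex \<Rightarrow> bool" where
  "chain_complex C \<longleftrightarrow>
    Vector_Spaces.linear scl scl (bd C) \<and>
    (\<forall>k t q. bd C ` homog C k t q \<subseteq> homog C (k - 1) t q) \<and>
    (\<forall>v \<in> chain_space C. bd C (bd C v) = 0)"

text \<open>Chain maps of homological degree zero that preserve both weights.\<close>

definition chain_map ::
  "('x, 'k::field) bicomplex \<Rightarrow> ('y, 'k) bicomplex \<Rightarrow> (('x \<Rightarrow>\<^sub>0 'k) \<Rightarrow> ('y \<Rightarrow>\<^sub>0 'k)) \<Rightarrow> bool" where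
  "chain_map C D f \<longleftrightarrow>
    Vector_Spaces.linear scl scl f \<and>
    (\<forall>k t q. f ` homog C k t q \<subseteq> homog D k t q) \<and>
    (\<forall>v \<in> chain_space C. f (bd C v) = bd D (f v))"

definition tensor ::
  "('x, 'k::field) bicomplex \<Rightarrow> ('y, 'k) bicomplex \<Rightarrow> ('x \<times> 'y, 'k) bicomplex" where
  "tensor C D =
    \<lparr> basis_of = basis_of C \<times> basis_of D,
      hdeg = (\<lambda>(x, y). hdeg C x + hdeg D y),
      tdeg = (\<lambda>(x, y). tdeg C x + tdeg D y),
      qdeg = (\<lambda>(x, y). qdeg C x + qdeg D y),
      bd = lin (\<lambda>(x, y). tens (bd C (single1 x)) (single1 y)
                 + scl ((-1) powi hdeg C x) (tens (single1 x) (bd D (single1 y)))) \<rparr>"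


section \<open>Species in bigraded chain complexes\<close>

text \<open>Finite sets are the finite subsets of an arbitrary type \<open>'a\<close>.  \<open>relab F I f\<close> is the map
  \<open>F[I] \<rightarrow> F[f ` I]\<close> induced by the bijection \<open>I \<rightarrow> f ` I\<close> that an \<open>f\<close> injective on \<open>I\<close> restricts to.\<close>

record (overloaded) ('a, 'x, 'k) species =
  obj :: "'a set \<Rightarrow> ('x, 'k) bicomplex"
  relab :: "'a set \<Rightarrow> ('a \<Rightarrow> 'a) \<Rightarrow> ('x \<Rightarrow>\<^sub>0 'k) \<Rightarrow> ('x \<Rightarrow>\<^sub>0 'k)"

definition dg_species :: "('a, 'x, 'k::field) species \<Rightarrow> bool" where
  "dg_species F \<longleftrightarrow> (\<forall>I. finite I \<longrightarrow>
    chain_complex (obj F I) \<and>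
    (\<forall>f. inj_on f I \<longrightarrow> chain_map (obj F I) (obj F (f ` I)) (relab F I f)) \<and>
    (\<forall>f g. inj_on f I \<and> (\<forall>i \<in> I. f i = g i) \<longrightarrow>
      (\<forall>v \<in> chain_space (obj F I). relab F I f v = relab F I g v)) \<and>
    (\<forall>v \<in> chain_space (obj F I). relab F I id v = v) \<and>
    (\<forall>f g. inj_on f I \<and> inj_on g (f ` I) \<longrightarrow>
      (\<forall>v \<in> chain_space (obj F I). relab F I (g \<circ> f) v = relab F (f ` I) g (relab F I f v))))"

definition species_map ::
  "('a, 'x, 'k::field) species \<Rightarrow> ('a, 'y, 'k) species
    \<Rightarrow> ('a set \<Rightarrow> ('x \<Rightarrow>\<^sub>0 'k) \<Rightarrow> ('y \<Rightarrow>\<^sub>0 'k)) \<Rightarrow> bool" where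
  "species_map F G \<phi> \<longleftrightarrow> (\<forall>I. finite I \<longrightarrow>
    chain_map (obj F I) (obj G I) (\<phi> I) \<and>
    (\<forall>f. inj_on f I \<longrightarrow>
      (\<forall>v \<in> chain_space (obj F I). \<phi> (f ` I) (relab F I f v) = relab G I f (\<phi> I v))))"

definition decomp :: "'a set \<Rightarrow> ('a set \<times> 'a set) set" where
  "decomp I = {(S, T). S \<union> T = I \<and> S \<inter> T = {}}"

text \<open>The summand of the Cauchy product at an ordered decomposition \<open>(S, T)\<close> is spanned by the
  basis elements with first component \<open>(S, T)\<close>; \<open>incl (S, T)\<close> is the inclusion of that summand.\<close>

definition incl :: "'s \<Rightarrow> ('x \<Rightarrow>\<^sub>0 'k::field) \<Rightarrow> ('s \<times> 'x \<Rightarrow>\<^sub>0 'k)" where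
  "incl s = lin (\<lambda>x. single1 (s, x))"

definition cauchy ::
  "('a, 'x, 'k::field) species \<Rightarrow> ('a, 'y, 'k) species
    \<Rightarrow> ('a, ('a set \<times> 'a set) \<times> 'x \<times> 'y, 'k) species" where
  "cauchy F G =
    \<lparr> obj = (\<lambda>I. \<lparr>
        basis_of = {((S, T), z) | S T z. (S, T) \<in> decomp I \<and> z \<in> basis_of (tensor (obj F S) (obj G T))},
        hdeg = (\<lambda>((S, T), z). hdeg (tensor (obj F S) (obj G T)) z),
        tdeg = (\<lambda>((S, T), z). tdeg (tensor (obj F S) (obj G T)) z),
        qdeg = (\<lambda>((S, T), z). qdeg (tensor (obj F S) (obj G T)) z),
        bd = lin (\<lambda>((S, T), z). incl (S, T) (bd (tensor (obj F S) (obj G T)) (single1 z))) \<rparr>),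
      relab = (\<lambda>I f. lin (\<lambda>((S, T), z).
        incl (f ` S, f ` T) (tmap (relab F S f) (relab G T f) (single1 z)))) \<rparr>"

definition unit_species :: "('a, unit, 'k::field) species" where
  "unit_species =
    \<lparr> obj = (\<lambda>I. \<lparr> basis_of = (if I = {} then {()} else {}),
        hdeg = (\<lambda>_. 0), tdeg = (\<lambda>_. 0), qdeg = (\<lambda>_. 0), bd = (\<lambda>_. 0) \<rparr>),
      relab = (\<lambda>I f. id) \<rparr>"

definition cauchy_map ::
  "('a set \<Rightarrow> ('x \<Rightarrow>\<^sub>0 'k::field) \<Rightarrow> ('x' \<Rightarrow>\<^sub>0 'k)) \<Rightarrow> ('a set \<Rightarrow> ('y \<Rightarrow>\<^sub>0 'k) \<Rightarrow> ('y' \<Rightarrow>\<^sub>0 'k))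
    \<Rightarrow> 'a set \<Rightarrow> (('a set \<times> 'a set) \<times> 'x \<times> 'y \<Rightarrow>\<^sub>0 'k) \<Rightarrow> (('a set \<times> 'a set) \<times> 'x' \<times> 'y' \<Rightarrow>\<^sub>0 'k)" where
  "cauchy_map \<phi> \<psi> I = lin (\<lambda>((S, T), z). incl (S, T) (tmap (\<phi> S) (\<psi> T) (single1 z)))"

definition cauchy_assoc ::
  "(('a set \<times> 'a set) \<times> (('a set \<times> 'a set) \<times> 'x \<times> 'y) \<times> 'z \<Rightarrow>\<^sub>0 'k::field)
    \<Rightarrow> (('a set \<times> 'a set) \<times> 'x \<times> ('a set \<times> 'a set) \<times> 'y \<times> 'z \<Rightarrow>\<^sub>0 'k)" where
  "cauchy_assoc = lin (\<lambda>((U, T), ((R, S), x, y), z). single1 ((R, S \<union> T), x, (S, T), y, z))"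

definition cauchy_left_unit ::
  "(('a set \<times> 'a set) \<times> unit \<times> 'x \<Rightarrow>\<^sub>0 'k::field) \<Rightarrow> ('x \<Rightarrow>\<^sub>0 'k)" where
  "cauchy_left_unit = lin (\<lambda>(ST, u, x). single1 x)"

definition cauchy_right_unit ::
  "(('a set \<times> 'a set) \<times> 'x \<times> unit \<Rightarrow>\<^sub>0 'k::field) \<Rightarrow> ('x \<Rightarrow>\<^sub>0 'k)" where
  "cauchy_right_unit = lin (\<lambda>(ST, x, u). single1 x)"

definition coassociative ::
  "('a, 'x, 'k::field) species
    \<Rightarrow> ('a set \<Rightarrow> ('x \<Rightarrow>\<^sub>0 'k) \<Rightarrow> (('a set \<times> 'a set) \<times> 'x \<times> 'x \<Rightarrow>\<^sub>0 'k)) \<Rightarrow> bool" where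
  "coassociative F \<Delta> \<longleftrightarrow> (\<forall>I. finite I \<longrightarrow> (\<forall>v \<in> chain_space (obj F I).
    cauchy_assoc (cauchy_map \<Delta> (\<lambda>_. id) I (\<Delta> I v)) = cauchy_map (\<lambda>_. id) \<Delta> I (\<Delta> I v)))"

definition counital ::
  "('a, 'x, 'k::field) species
    \<Rightarrow> ('a set \<Rightarrow> ('x \<Rightarrow>\<^sub>0 'k) \<Rightarrow> (('a set \<times> 'a set) \<times> 'x \<times> 'x \<Rightarrow>\<^sub>0 'k))
    \<Rightarrow> ('a set \<Rightarrow> ('x \<Rightarrow>\<^sub>0 'k) \<Rightarrow> (unit \<Rightarrow>\<^sub>0 'k)) \<Rightarrow> bool" where
  "counital F \<Delta> \<epsilon> \<longleftrightarrow> (\<forall>I. finite I \<longrightarrow> (\<forall>v \<in> chain_space (obj F I).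
    cauchy_left_unit (cauchy_map \<epsilon> (\<lambda>_. id) I (\<Delta> I v)) = v \<and>
    cauchy_right_unit (cauchy_map (\<lambda>_. id) \<epsilon> I (\<Delta> I v)) = v))"

definition counital_dg_comonoid ::
  "('a, 'x, 'k::field) species
    \<Rightarrow> ('a set \<Rightarrow> ('x \<Rightarrow>\<^sub>0 'k) \<Rightarrow> (('a set \<times> 'a set) \<times> 'x \<times> 'x \<Rightarrow>\<^sub>0 'k))
    \<Rightarrow> ('a set \<Rightarrow> ('x \<Rightarrow>\<^sub>0 'k) \<Rightarrow> (unit \<Rightarrow>\<^sub>0 'k)) \<Rightarrow> bool" where
  "counital_dg_comonoid F \<Delta> \<epsilon> \<longleftrightarrow>
    dg_species F \<and>
    species_map F (cauchy F F) \<Delta> \<and>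
    species_map F unit_species \<epsilon> \<and>
    coassociative F \<Delta> \<and>
    counital F \<Delta> \<epsilon>"


section \<open>Compositions\<close>

definition composition :: "nat list \<Rightarrow> nat \<Rightarrow> bool" where
  "composition \<alpha> n \<longleftrightarrow> (\<forall>a \<in> set \<alpha>. 0 < a) \<and> sum_list \<alpha> = n"

definition cut_set :: "nat list \<Rightarrow> nat set" where
  "cut_set \<alpha> = {sum_list (take i \<alpha>) | i. 1 \<le> i \<and> i < length \<alpha>}"

definition coarser :: "nat list \<Rightarrow> nat list \<Rightarrow> bool" where
  "coarser \<beta> \<alpha> \<longleftrightarrow> cut_set \<beta> \<subseteq> cut_set \<alpha>"

definition OSP :: "nat list \<Rightarrow> 'a set \<Rightarrow> 'a set list set" where
  "OSP \<beta> I = {Bs. map card Bs = \<beta> \<and> \<Union> (set Bs) = I \<and>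
    (\<forall>i j. i < j \<and> j < length Bs \<longrightarrow> Bs ! i \<inter> Bs ! j = {})}"


section \<open>Decorations\<close>

text \<open>Permutations of \<open>{1..s}\<close> are functions on \<open>nat\<close> that fix everything outside \<open>{1..s}\<close>.
  Elements of the set \<open>\<RR>\<^sub>s\<close> are permutations of \<open>{0..s}\<close>, with \<open>0\<close> in the role of \<open>\<ast>\<close>.\<close>

type_synonym decoration = "(nat \<Rightarrow> nat) \<times> (nat \<Rightarrow> nat)"

definition up :: "nat \<Rightarrow> nat" where "up m = nat \<lceil>real m / 2\<rceil>"
definition dn :: "nat \<Rightarrow> nat" where "dn m = nat \<lfloor>real m / 2\<rfloor>"

definition dec :: "nat \<Rightarrow> decoration set" where
  "dec m = {(\<sigma>, \<tau>). \<sigma> permutes {1..up m} \<and> \<tau> permutes {0..dn m}}"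

text \<open>Number of cycles, including fixed points, of a permutation of the finite set \<open>A\<close>.\<close>

definition cyc :: "nat set \<Rightarrow> (nat \<Rightarrow> nat) \<Rightarrow> nat" where
  "cyc A \<pi> = card (orbit \<pi> ` A)"

definition qdeg_dec :: "nat \<Rightarrow> decoration \<Rightarrow> int" where
  "qdeg_dec m = (\<lambda>(\<sigma>, \<tau>). int (up m) - int (cyc {1..up m} \<sigma>))"

definition tdeg_dec :: "nat \<Rightarrow> decoration \<Rightarrow> int" where
  "tdeg_dec m = (\<lambda>(\<sigma>, \<tau>). int (cyc {1..up m} \<sigma>) + int (cyc {0..dn m} \<tau>) - 1)"

definition oplus :: "nat \<Rightarrow> (nat \<Rightarrow> nat) \<Rightarrow> (nat \<Rightarrow> nat) \<Rightarrow> (nat \<Rightarrow> nat)" where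
  "oplus a \<sigma> \<sigma>' x = (if x \<le> a then \<sigma> x else a + \<sigma>' (x - a))"

text \<open>The root cycle \<open>[0, a\<^sub>1, \<dots>, a\<^sub>u]\<close> as a list; \<open>support\<close> is the library's list
  \<open>[x, \<pi> x, \<pi> (\<pi> x), \<dots>]\<close> of the cycle through \<open>x\<close>.\<close>

definition root_cycle :: "(nat \<Rightarrow> nat) \<Rightarrow> nat list" where
  "root_cycle \<tau> = support \<tau> 0"

definition star_root :: "nat \<Rightarrow> (nat \<Rightarrow> nat) \<Rightarrow> (nat \<Rightarrow> nat) \<Rightarrow> nat list" where
  "star_root a \<tau> \<upsilon> = root_cycle \<tau> @ map (\<lambda>b. a + b) (tl (root_cycle \<upsilon>))"

definition star :: "nat \<Rightarrow> (nat \<Rightarrow> nat) \<Rightarrow> (nat \<Rightarrow> nat) \<Rightarrow> (nat \<Rightarrow> nat)" where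
  "star a \<tau> \<upsilon> x =
    (if x \<in> set (star_root a \<tau> \<upsilon>) then cycle_of_list (star_root a \<tau> \<upsilon>) x
     else if x \<le> a then \<tau> x
     else a + \<upsilon> (x - a))"

text \<open>\<open>dia a\<close> is the product of an element of \<open>dec a\<close> and one of \<open>dec b\<close>; the index \<open>b\<close> is not
  needed because permutations fix everything beyond their ground sets.\<close>

definition dia :: "nat \<Rightarrow> decoration \<Rightarrow> decoration \<Rightarrow> decoration" where
  "dia a = (\<lambda>(\<sigma>, \<tau>) (\<sigma>', \<tau>'). (oplus (up a) \<sigma> \<sigma>', star (dn a) \<tau> \<tau>'))"


section \<open>The decorated complex\<close>

text \<open>A bar carries the composition \<open>\<alpha>\<close> of the complex it belongs to, so that the direct sum over
  all \<open>\<alpha>\<close> is spanned by the (disjoint) union of the bases.\<close>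

datatype 'a bar = Bar (bcomp: "nat list") (blocks: "'a set list") (decs: "decoration list")

definition bars :: "nat list \<Rightarrow> 'a set \<Rightarrow> 'a bar set" where
  "bars \<alpha> I = {Bar \<alpha> Bs \<xi>s | Bs \<xi>s. \<exists>\<beta>. composition \<beta> (card I) \<and> coarser \<beta> \<alpha> \<and>
    Bs \<in> OSP \<beta> I \<and> list_all2 (\<lambda>b \<xi>. \<xi> \<in> dec b) \<beta> \<xi>s}"

text \<open>\<open>face i\<close> is the face map \<open>d\<^sub>i\<close>, with \<open>i\<close> counted from 1.\<close>

definition face :: "nat \<Rightarrow> 'a bar \<Rightarrow> ('a bar \<Rightarrow>\<^sub>0 'k::field)" where
  "face i w = (case w of Bar \<alpha> Bs \<xi>s \<Rightarrow>
    if odd (card (Bs ! (i - 1))) \<and> odd (card (Bs ! i)) then 0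
    else single1 (Bar \<alpha>
      (take (i - 1) Bs @ [Bs ! (i - 1) \<union> Bs ! i] @ drop (i + 1) Bs)
      (take (i - 1) \<xi>s @ [dia (card (Bs ! (i - 1))) (\<xi>s ! (i - 1)) (\<xi>s ! i)] @ drop (i + 1) \<xi>s)))"

definition bar_diff :: "('a bar \<Rightarrow>\<^sub>0 'k::field) \<Rightarrow> ('a bar \<Rightarrow>\<^sub>0 'k)" where
  "bar_diff = lin (\<lambda>w. \<Sum>i \<in> {1..<length (blocks w)}. scl ((-1) ^ (i - 1)) (face i w))"

definition bar_complex :: "'a bar set \<Rightarrow> ('a bar, 'k::field) bicomplex" where
  "bar_complex X =
    \<lparr> basis_of = X,
      hdeg = (\<lambda>w. int (length (blocks w))),
      tdeg = (\<lambda>w. \<Sum>(B, \<xi>) \<leftarrow> zip (blocks w) (decs w). tdeg_dec (card B) \<xi>),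
      qdeg = (\<lambda>w. \<Sum>(B, \<xi>) \<leftarrow> zip (blocks w) (decs w). qdeg_dec (card B) \<xi>),
      bd = bar_diff \<rparr>"

definition Cpx :: "nat list \<Rightarrow> 'a set \<Rightarrow> ('a bar, 'k::field) bicomplex" where
  "Cpx \<alpha> I = bar_complex (bars \<alpha> I)"

text \<open>For \<open>I = {}\<close> the only basis element is the empty bar \<open>Bar [] [] []\<close>.\<close>

definition Ctot :: "'a set \<Rightarrow> ('a bar, 'k::field) bicomplex" where
  "Ctot I = bar_complex (\<Union>\<alpha> \<in> {\<alpha>. composition \<alpha> (card I)}. bars \<alpha> I)"

definition relabel :: "('a \<Rightarrow> 'b) \<Rightarrow> ('a bar \<Rightarrow>\<^sub>0 'k::field) \<Rightarrow> ('b bar \<Rightarrow>\<^sub>0 'k)" where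
  "relabel f = lin (\<lambda>w. single1 (Bar (bcomp w) (map (image f) (blocks w)) (decs w)))"

definition Cspecies :: "('a, 'a bar, 'k::field) species" where
  "Cspecies = \<lparr> obj = Ctot, relab = (\<lambda>I f. relabel f) \<rparr>"

definition counit :: "'a set \<Rightarrow> ('a bar \<Rightarrow>\<^sub>0 'k::field) \<Rightarrow> (unit \<Rightarrow>\<^sub>0 'k)" where
  "counit I = (if I = {} then lin (\<lambda>w. single1 ()) else (\<lambda>_. 0))"


section \<open>The cut coproduct\<close>

definition cut_bar :: "nat \<Rightarrow> 'a set \<Rightarrow> 'a set \<Rightarrow> 'a bar \<Rightarrow> ('a bar \<times> 'a bar \<Rightarrow>\<^sub>0 'k::field)" where
  "cut_bar p S T w = (case w of Bar \<alpha> Bs \<xi>s \<Rightarrow>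
    if \<exists>j \<le> length Bs. S = \<Union> (set (take j Bs)) then
      (let j = (THE j. j \<le> length Bs \<and> S = \<Union> (set (take j Bs))) in
        tens (single1 (Bar (take p \<alpha>) (take j Bs) (take j \<xi>s)))
             (single1 (Bar (drop p \<alpha>) (drop j Bs) (drop j \<xi>s))))
    else 0)"

definition cut_delta :: "nat \<Rightarrow> 'a set \<Rightarrow> 'a set \<Rightarrow> ('a bar \<Rightarrow>\<^sub>0 'k::field) \<Rightarrow> ('a bar \<times> 'a bar \<Rightarrow>\<^sub>0 'k)" where
  "cut_delta p S T = lin (cut_bar p S T)"

definition Delta :: "'a set \<Rightarrow> 'a set \<Rightarrow> ('a bar \<Rightarrow>\<^sub>0 'k::field) \<Rightarrow> ('a bar \<times> 'a bar \<Rightarrow>\<^sub>0 'k)" where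
  "Delta S T = lin (\<lambda>w.
    if \<exists>p \<le> length (bcomp w). card S = sum_list (take p (bcomp w)) then
      cut_delta (THE p. p \<le> length (bcomp w) \<and> card S = sum_list (take p (bcomp w))) S T (single1 w)
    else 0)"

definition coproduct ::
  "'a set \<Rightarrow> ('a bar \<Rightarrow>\<^sub>0 'k::field) \<Rightarrow> (('a set \<times> 'a set) \<times> 'a bar \<times> 'a bar \<Rightarrow>\<^sub>0 'k)" where
  "coproduct I v = (\<Sum>(S, T) \<in> decomp I. incl (S, T) (Delta S T v))"

end

theory Submission
  imports Defs
begin

text \<open>
  A basis element of the complex is a sequence of decorated disjoint blocks, and the coproduct cuts such a sequence
  between two consecutive blocks.  Everything that is asserted about the coproduct is seen on basis elements.

  The cut at \<open>(S, T)\<close> is nonzero on a bar if and only if \<open>S\<close> is the union of a prefix of its blocks.  A face map merges two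
  neighbouring blocks.  If both lie on the same side of the cut, then cutting commutes with merging; the merge across the
  cut makes the cut impossible, so that term disappears.  The signs of the faces in the suffix acquire the factor
  \<open>(-1)\<close> to the length of the prefix, as the tensor product of complexes demands.  Hence cutting is a chain map
  (\<open>cut_delta_bar_diff_split\<close>, \<open>chain_map_cut_delta\<close>).  A bar that cannot be cut at \<open>S\<close> has no face that can.
  The condition on the composition is harmless: the size of a prefix of blocks is a partial sum of the composition, so
  whenever the blocks can be cut the composition can, and the two parts of a refinement refine the two parts of the
  composition (\<open>wf_bar_append\<close>, \<open>wf_bar_split\<close>).

  Cutting twice, in either order, produces the three parts of the bar if it can be cut at both places, and
  zero otherwise; this is coassociativity (\<open>Delta_coassoc\<close>).  Cutting off the empty prefix or suffix changes nothing;
  this is counitality.  The statements about species follow by summing over all ordered decompositions of the ground set.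

  A comonoid in species of complexes also needs the complex itself: the differential squares to zero and respects the two
  weights.  The first statement is associativity of the product of decorations, once it is noted that for three
  consecutive blocks of which at least two are odd both ways of merging give zero (\<open>bar_diff_bar_diff\<close>).  The second is
  the additivity of cycle counts.  The key to both is that \<open>\<tau> \<star> \<upsilon>\<close> is the composite of \<open>\<tau>\<close> with a shifted copy of \<open>\<upsilon>\<close>
  whose support meets that of \<open>\<tau>\<close> only in the root: composing permutations that meet in one point splices the two cycles
  through that point and keeps all others (\<open>star_eq\<close>, \<open>star_eq_comp\<close>, \<open>cyc_comp_meeting_in_point\<close>).
\<close>

section \<open>Linear maps between free vector spaces\<close>

lemma lookup_scl [simp]: "Poly_Mapping.lookup (scl c v) x = c * Poly_Mapping.lookup v x"
  by (simp add: scl_def Poly_Mapping.map.rep_eq when_def)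

lemma scl_simps [simp]:
  "scl 0 v = 0" "scl c 0 = 0" "scl 1 v = v" "scl c (scl d v) = scl (c * d) v"
  "scl (- c) v = - scl c v" "scl c (- v) = - scl c v"
  by (rule poly_mapping_eqI, simp)+

lemma scl_distribs:
  "scl c (u + v) = scl c u + scl c v" "scl (c + d) v = scl c v + scl d v"
  "scl c (u - v) = scl c u - scl c v"
  by (rule poly_mapping_eqI, simp add: lookup_add lookup_minus algebra_simps)+

lemma scl_sum: "scl c (\<Sum>i\<in>A. f i) = (\<Sum>i\<in>A. scl c (f i))"
  by (induction A rule: infinite_finite_induct) (simp_all add: scl_distribs)

lemma vector_space_scl: "vector_space scl"
  by unfold_locales (simp_all add: scl_distribs)

abbreviation lmap :: "(('x \<Rightarrow>\<^sub>0 'k::field) \<Rightarrow> ('y \<Rightarrow>\<^sub>0 'k)) \<Rightarrow> bool" where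
  "lmap \<equiv> Vector_Spaces.linear scl scl"

lemma lmap_iff: "lmap f \<longleftrightarrow> (\<forall>u v. f (u + v) = f u + f v) \<and> (\<forall>c v. f (scl c v) = scl c (f v))"
  by (simp add: Vector_Spaces.linear_iff vector_space_scl)

lemma lmap_add: "lmap f \<Longrightarrow> f (u + v) = f u + f v"
  and lmap_scl: "lmap f \<Longrightarrow> f (scl c v) = scl c (f v)"
  by (simp_all add: lmap_iff)

lemma lmap_0: "lmap f \<Longrightarrow> f 0 = 0"
  using lmap_scl[of f 0 0] by simp

lemma lmap_minus: "lmap f \<Longrightarrow> f (- v) = - f v"
  using lmap_scl[of f "-1" v] by simp

lemma lmap_diff: "lmap f \<Longrightarrow> f (u - v) = f u - f v"
  using lmap_add[of f u "-v"] by (simp add: lmap_minus)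

lemma lmap_sum: "lmap f \<Longrightarrow> f (\<Sum>i\<in>A. u i) = (\<Sum>i\<in>A. f (u i))"
  by (induction A rule: infinite_finite_induct) (simp_all add: lmap_0 lmap_add)

lemmas lmap_simps = lmap_add lmap_scl lmap_0 lmap_minus lmap_diff lmap_sum

lemma lin_superset:
  assumes "finite A" "Poly_Mapping.keys v \<subseteq> A"
  shows "lin f v = (\<Sum>x\<in>A. scl (Poly_Mapping.lookup v x) (f x))"
  unfolding lin_def using assms by (intro sum.mono_neutral_left) (auto simp: in_keys_iff)

lemma lmap_lin [simp, intro]:
  fixes f :: "'a \<Rightarrow> 'b \<Rightarrow>\<^sub>0 'k::field"
  shows "lmap (lin f)"
  unfolding lmap_iff
proof (intro conjI allI)
  fix u v :: "'a \<Rightarrow>\<^sub>0 'k" and c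
  let ?A = "Poly_Mapping.keys u \<union> Poly_Mapping.keys v"
  have "Poly_Mapping.keys (u + v) \<subseteq> ?A" by (rule keys_add)
  then show "lin f (u + v) = lin f u + lin f v"
    by (simp add: lin_superset[of ?A] lookup_add scl_distribs sum.distrib)
  have "Poly_Mapping.keys (scl c u) \<subseteq> Poly_Mapping.keys u"
    by (auto simp: in_keys_iff)
  then show "lin f (scl c u) = scl c (lin f u)"
    by (simp add: lin_superset[of "Poly_Mapping.keys u"] scl_sum)
qed

lemma lin_single1 [simp]: "lin f (single1 x) = f x"
  by (simp add: lin_def)

lemma lmap_eq_lin: "lmap g \<Longrightarrow> g v = lin (\<lambda>x. g (single1 x)) v"
proof -
  assume g: "lmap g"
  have "v = (\<Sum>x\<in>Poly_Mapping.keys v. scl (Poly_Mapping.lookup v x) (single1 x))"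
    by (rule poly_mapping_eqI)
      (simp add: lookup_sum lookup_single when_def in_keys_iff if_distrib[where f = "(*) _"] cong: if_cong)
  then have "g v = (\<Sum>x\<in>Poly_Mapping.keys v. scl (Poly_Mapping.lookup v x) (g (single1 x)))"
    using lmap_sum[OF g, of "\<lambda>x. scl (Poly_Mapping.lookup v x) (single1 x)" "Poly_Mapping.keys v"]
    by (simp add: lmap_scl[OF g])
  then show ?thesis by (simp add: lin_def)
qed

lemma lmap_eqI:
  assumes "lmap f" "lmap g" "\<And>x. x \<in> Poly_Mapping.keys v \<Longrightarrow> f (single1 x) = g (single1 x)"
  shows "f v = g v"
proof -
  have "lin (\<lambda>x. f (single1 x)) v = lin (\<lambda>x. g (single1 x)) v"
    by (simp add: lin_def assms(3))
  then show ?thesis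
    using lmap_eq_lin[OF assms(1), of v] lmap_eq_lin[OF assms(2), of v] by simp
qed

lemma lmap_eqI_all:
  assumes "lmap f" "lmap g" "\<And>x. f (single1 x) = g (single1 x)"
  shows "f v = g v"
  using assms by (rule lmap_eqI)

text \<open>The maps of the development are linear, so each identity reduces through this lemma to
  one basis element at a time.\<close>

lemma lmap_eqI_space:
  assumes "v \<in> chain_space C" "lmap f" "lmap g"
    "\<And>x. x \<in> basis_of C \<Longrightarrow> f (single1 x) = g (single1 x)"
  shows "f v = g v"
proof (rule lmap_eqI[OF assms(2,3)])
  fix x assume "x \<in> Poly_Mapping.keys v"
  then show "f (single1 x) = g (single1 x)"
    using assms(1,4) by (auto simp: chain_space_def)
qed

lemma lmap_id [simp, intro]: "lmap id" "lmap (\<lambda>v. v)"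
  unfolding lmap_iff id_apply by blast+

lemma lmap_zero [simp, intro]: "lmap (\<lambda>v. 0)"
  unfolding lmap_iff by simp

lemma lmap_comp: "lmap f \<Longrightarrow> lmap g \<Longrightarrow> lmap (\<lambda>v. f (g v))"
  unfolding lmap_iff by metis

lemma lmap_plus: "lmap f \<Longrightarrow> lmap g \<Longrightarrow> lmap (\<lambda>v. f v + g v)"
  unfolding lmap_iff[of "\<lambda>v. f v + g v"] by (simp add: lmap_add lmap_scl scl_distribs)

lemma lmap_scale: "lmap f \<Longrightarrow> lmap (\<lambda>v. scl c (f v))"
  unfolding lmap_iff[of "\<lambda>v. scl c (f v)"]
  by (simp add: lmap_add lmap_scl scl_distribs mult.commute)

lemma lmap_subtract: "lmap f \<Longrightarrow> lmap g \<Longrightarrow> lmap (\<lambda>v. f v - g v)"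
  unfolding lmap_iff[of "\<lambda>v. f v - g v"] by (simp add: lmap_add lmap_scl scl_distribs)

lemma lmap_sums: "(\<And>i. i \<in> A \<Longrightarrow> lmap (f i)) \<Longrightarrow> lmap (\<lambda>v. \<Sum>i\<in>A. f i v)"
  by (induction A rule: infinite_finite_induct) (simp_all add: lmap_plus)

lemma keys_lin: "Poly_Mapping.keys (lin f v) \<subseteq> (\<Union>x\<in>Poly_Mapping.keys v. Poly_Mapping.keys (f x))"
proof
  fix y assume "y \<in> Poly_Mapping.keys (lin f v)"
  then have "(\<Sum>x\<in>Poly_Mapping.keys v. Poly_Mapping.lookup v x * Poly_Mapping.lookup (f x) y) \<noteq> 0"
    by (simp add: in_keys_iff lin_def lookup_sum)
  then obtain x where "x \<in> Poly_Mapping.keys v" "Poly_Mapping.lookup (f x) y \<noteq> 0"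
    using sum.neutral[of "Poly_Mapping.keys v" "\<lambda>x. Poly_Mapping.lookup v x * Poly_Mapping.lookup (f x) y"]
    by auto
  then show "y \<in> (\<Union>x\<in>Poly_Mapping.keys v. Poly_Mapping.keys (f x))"
    by (auto simp: in_keys_iff)
qed

lemma keys_lmap:
  assumes "lmap f" "\<And>x. x \<in> Poly_Mapping.keys v \<Longrightarrow> Poly_Mapping.keys (f (single1 x)) \<subseteq> A"
  shows "Poly_Mapping.keys (f v) \<subseteq> A"
  using keys_lin[of "\<lambda>x. f (single1 x)" v] assms(2) lmap_eq_lin[OF assms(1), of v] by auto

lemma keys_sum: "Poly_Mapping.keys (\<Sum>i\<in>A. f i) \<subseteq> (\<Union>i\<in>A. Poly_Mapping.keys (f i))"
proof (induction A rule: infinite_finite_induct)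
  case (insert i A)
  then show ?case using keys_add[of "f i" "sum f A"] by auto
qed auto

lemma keys_scl: "Poly_Mapping.keys (scl c v) \<subseteq> Poly_Mapping.keys v"
  by (auto simp: in_keys_iff)

lemma lmap_tens_left: "lmap (\<lambda>u. tens u v)"
  by (simp add: tens_def)

lemma lmap_tens_right: "lmap (\<lambda>v. tens u v)"
  unfolding tens_def lin_def by (intro lmap_sums lmap_scale) (fold lin_def, rule lmap_lin)

lemma tens_single1 [simp]: "tens (single1 x) (single1 y) = single1 (x, y)"
  by (simp add: tens_def)

lemma tens_0 [simp]: "tens 0 v = 0" "tens u 0 = 0"
  by (fact lmap_0[OF lmap_tens_left], fact lmap_0[OF lmap_tens_right])

lemma lmap_tmap [simp, intro]: "lmap (tmap f g)"
  by (simp add: tmap_def)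

lemma tmap_single1: "tmap f g (single1 (x, y)) = tens (f (single1 x)) (g (single1 y))"
  by (simp add: tmap_def)

lemma lmap_incl [simp, intro]: "lmap (incl s)"
  by (simp add: incl_def)

lemma incl_single1 [simp]: "incl s (single1 x) = single1 (s, x)"
  by (simp add: incl_def)

lemma lmap_reassoc [simp, intro]: "lmap reassoc"
  and lmap_left_unit [simp, intro]: "lmap left_unit"
  and lmap_right_unit [simp, intro]: "lmap right_unit"
  by (simp_all add: reassoc_def left_unit_def right_unit_def)

text \<open>Grading and compatibility with the boundary need only be verified on basis elements.  The converse
  \<open>chain_mapD\<close> lets chain maps on the summands be assembled into chain maps on direct sums.\<close>

lemma chain_mapI:
  assumes "lmap f" "lmap (bd C)" "lmap (bd D)"
    and "\<And>x y. x \<in> basis_of C \<Longrightarrow> y \<in> Poly_Mapping.keys (f (single1 x)) \<Longrightarrow>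
      y \<in> basis_of D \<and> hdeg D y = hdeg C x \<and> tdeg D y = tdeg C x \<and> qdeg D y = qdeg C x"
    and "\<And>x. x \<in> basis_of C \<Longrightarrow> f (bd C (single1 x)) = bd D (f (single1 x))"
  shows "chain_map C D f"
  unfolding chain_map_def
proof (intro conjI allI ballI)
  fix k t q
  show "f ` homog C k t q \<subseteq> homog D k t q"
    using assms(4) using keys_lin[of "\<lambda>x. f (single1 x)"] by (simp add: homog_def flip: lmap_eq_lin[OF assms(1)]) blast
next
  fix v assume "v \<in> chain_space C"
  then show "f (bd C v) = bd D (f v)"
    using lmap_comp[OF assms(1,2)] lmap_comp[OF assms(3,1)] assms(5) by (rule lmap_eqI_space)
qed (fact assms(1))

lemma chain_mapD:
  assumes "chain_map C D f"
  shows "lmap f"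
    and "x \<in> basis_of C \<Longrightarrow> y \<in> Poly_Mapping.keys (f (single1 x)) \<Longrightarrow>
      y \<in> basis_of D \<and> hdeg D y = hdeg C x \<and> tdeg D y = tdeg C x \<and> qdeg D y = qdeg C x"
    and "v \<in> chain_space C \<Longrightarrow> f (bd C v) = bd D (f v)"
proof -
  show "lmap f" using assms by (simp add: chain_map_def)
  show "f (bd C v) = bd D (f v)" if "v \<in> chain_space C"
    using assms that by (simp add: chain_map_def)
  assume x: "x \<in> basis_of C" and y: "y \<in> Poly_Mapping.keys (f (single1 x))"
  have "single1 x \<in> homog C (hdeg C x) (tdeg C x) (qdeg C x)"
    using x by (simp add: homog_def)
  then have "f (single1 x) \<in> homog D (hdeg C x) (tdeg C x) (qdeg C x)"
    using assms unfolding chain_map_def by blast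
  then show "y \<in> basis_of D \<and> hdeg D y = hdeg C x \<and> tdeg D y = tdeg C x \<and> qdeg D y = qdeg C x"
    using y by (auto simp: homog_def)
qed

lemma single1_chain_space [simp]: "single1 x \<in> chain_space C \<longleftrightarrow> x \<in> basis_of C"
  by (simp add: chain_space_def)

lemma lmap_bd_tensor [simp, intro]: "lmap (bd (tensor C D))"
  by (simp add: tensor_def)

lemma basis_tensor [simp]: "basis_of (tensor C D) = basis_of C \<times> basis_of D"
  by (simp add: tensor_def)

section \<open>Counting cycles of products of permutations\<close>

lemma orbit_subset_invariant:
  assumes "f ` B \<subseteq> B" "x \<in> B"
  shows "orbit f x \<subseteq> B"
proof
  fix y assume "y \<in> orbit f x"
  then show "y \<in> B" by induction (use assms in auto)
qed

lemma permutes_permutation: "finite A \<Longrightarrow> f permutes A \<Longrightarrow> permutation f"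
  unfolding permutation_permutes by (intro exI conjI)

lemma permutes_orbit_eq:
  assumes "finite A" "f permutes A" "y \<in> orbit f x"
  shows "orbit f y = orbit f x"
proof -
  have "permutation f" using assms(1,2) by (auto simp: permutation_permutes)
  then have "x \<in> orbit f x" by (rule permutation_self_in_orbit)
  with assms(3) show ?thesis by (meson orbit_swap orbit_trans subsetI subset_antisym)
qed

text \<open>A map that intertwines \<open>f\<close> and \<open>g\<close> carries orbits onto orbits, and if it is injective it keeps distinct
  orbits distinct.  Applied to shifts of letters, it shows that renaming preserves the cycle count; applied to
  the identity, it compares two permutations that agree on an invariant set.\<close>

lemma cyc_semiconj:
  assumes "finite A" "f permutes A" "f ` B \<subseteq> B" "inj_on h B" "\<And>y. y \<in> B \<Longrightarrow> g (h y) = h (f y)"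
  shows "cyc (h ` B) g = cyc B f"
proof -
  have sub: "orbit f x \<subseteq> B" if "x \<in> B" for x
    using orbit_subset_invariant[OF assms(3) that] .
  have perm: "permutation f" using assms(1,2) by (auto simp: permutation_permutes)
  have "orbit g (h x) = h ` orbit f x" if "x \<in> B" for x
  proof (rule orbit_inverse[symmetric])
    show "x \<in> orbit f x" by (rule permutation_self_in_orbit[OF perm])
  qed (use sub[OF that] assms(5) in auto)
  then have "orbit g ` h ` B = image h ` (orbit f ` B)"
    by (auto simp: image_image)
  moreover have "inj_on (image h) (orbit f ` B)"
    using inj_on_image[of h "orbit f ` B"] sub
    by (metis UN_least assms(4) inj_on_subset)
  ultimately show ?thesis
    by (simp add: cyc_def card_image)
qed

lemma cyc_cong:
  assumes "finite A" "f permutes A" "f ` B \<subseteq> B" "\<And>y. y \<in> B \<Longrightarrow> g y = f y"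
  shows "cyc B g = cyc B f"
  using cyc_semiconj[of A f B id g] assms by simp

lemma cyc_disjoint_Un:
  assumes "finite A" "finite B" "A \<inter> B = {}" "f ` A \<subseteq> A" "f ` B \<subseteq> B"
  shows "cyc (A \<union> B) f = cyc A f + cyc B f"
proof -
  have "orbit f x \<noteq> orbit f y" if "x \<in> A" "y \<in> B" for x y
    using orbit_subset_invariant[OF assms(4) that(1)] orbit_subset_invariant[OF assms(5) that(2)]
      assms(3) orbit_nonempty[of f x] by blast
  then have "orbit f ` A \<inter> orbit f ` B = {}" by auto
  then show ?thesis
    using assms(1,2) by (simp add: cyc_def image_Un card_Un_disjoint)
qed

lemma cyc_orbit:
  assumes "finite A" "f permutes A"
  shows "cyc (orbit f z) f = 1"
proof -
  have "orbit f ` orbit f z = {orbit f z}"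
    using permutes_orbit_eq[OF assms] orbit_nonempty[of f z] by auto
  then show ?thesis by (simp add: cyc_def)
qed

text \<open>An invariant set splits into the cycle through \<open>z\<close> and an invariant remainder, so the number of cycles
  away from \<open>z\<close> is one less than the total.\<close>

lemma cyc_remove_orbit:
  assumes "finite A" "f permutes A" "z \<in> A"
  shows "f ` (A - orbit f z) \<subseteq> A - orbit f z" "cyc A f = 1 + cyc (A - orbit f z) f"
proof -
  have perm: "permutation f" using assms(1,2) by (auto simp: permutation_permutes)
  show inv: "f ` (A - orbit f z) \<subseteq> A - orbit f z"
  proof
    fix y assume "y \<in> f ` (A - orbit f z)"
    then obtain x where x: "y = f x" "x \<in> A" "x \<notin> orbit f z" by auto
    have "f x \<notin> orbit f z"
      using permutes_orbit_eq[OF assms(1,2), of "f x" z] permutation_orbit_step[OF perm, of x]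
        permutation_self_in_orbit[OF perm, of x] x(3) by auto
    then show "y \<in> A - orbit f z"
      using x assms(2) by (simp add: permutes_in_image)
  qed
  have sub: "orbit f z \<subseteq> A"
    using orbit_subset_invariant[of f A z] permutes_image[OF assms(2)] assms(3) by simp
  then have "cyc (orbit f z \<union> (A - orbit f z)) f = cyc (orbit f z) f + cyc (A - orbit f z) f"
    by (intro cyc_disjoint_Un inv) (use assms(1) in \<open>auto intro: finite_subset orbit.step\<close>)
  moreover have "orbit f z \<union> (A - orbit f z) = A" using sub by auto
  ultimately show "cyc A f = 1 + cyc (A - orbit f z) f"
    using cyc_orbit[OF assms(1,2)] by simp
qed

text \<open>The cycles of \<open>f\<close> and of \<open>g\<close> that avoid \<open>z\<close> lie where the other factor is the identity, so they are cycles of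
  the product.  The two cycles through \<open>z\<close> are spliced into one: the product follows the cycle of \<open>f\<close> until
  \<open>f\<close> would return to \<open>z\<close>, and at that moment \<open>g\<close> diverts it to the cycle of \<open>g\<close>.\<close>

lemma cyc_comp_meeting_in_point:
  assumes fin: "finite A" "finite B" and f: "f permutes A" and g: "g permutes B" and z: "A \<inter> B = {z}"
  shows "cyc (A \<union> B) (g \<circ> f) + 1 = cyc A f + cyc B g"
proof -
  define p where "p = g \<circ> f"
  define C where "C = orbit p z"
  define M where "M = A - orbit f z"
  define N where "N = B - orbit g z"
  have finU: "finite (A \<union> B)" and pU: "p permutes (A \<union> B)"
    unfolding p_def using fin
    by (simp, intro permutes_compose permutes_subset[OF f] permutes_subset[OF g]) auto
  have perm: "permutation f" "permutation g" "permutation p"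
    using permutes_permutation fin f g finU pU by blast+
  note self = permutation_self_in_orbit
  have zA: "z \<in> A" and zB: "z \<in> B" using z by auto
  have fM: "f ` M \<subseteq> M" and cA: "cyc A f = 1 + cyc M f"
    using cyc_remove_orbit[OF fin(1) f zA] by (simp_all add: M_def)
  have gN: "g ` N \<subseteq> N" and cB: "cyc B g = 1 + cyc N g"
    using cyc_remove_orbit[OF fin(2) g zB] by (simp_all add: N_def)
  have zM: "z \<notin> M" and zN: "z \<notin> N"
    using self[OF perm(1), of z] self[OF perm(2), of z] by (auto simp: M_def N_def)
  have g_id: "g x = x" if "x \<in> A" "x \<noteq> z" for x
    using that z permutes_not_in[OF g, of x] by auto
  have f_id: "f x = x" if "x \<in> B" "x \<noteq> z" for x
    using that z permutes_not_in[OF f, of x] by auto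
  have pM: "p x = f x" if "x \<in> M" for x
  proof -
    have "f x \<in> M" using fM that by auto
    then show ?thesis using zM g_id[of "f x"] by (auto simp: p_def M_def)
  qed
  have pN: "p x = g x" if "x \<in> N" for x
  proof -
    have "x \<in> B" "x \<noteq> z" using that zN by (auto simp: N_def)
    then show ?thesis using f_id by (simp add: p_def)
  qed
  have zC: "z \<in> C" unfolding C_def by (rule self[OF perm(3)])
  have fC: "f y \<in> C" if "y \<in> A" "y \<in> C" for y
  proof (cases "f y = z")
    case False
    then have "p y = f y" using g_id[of "f y"] that(1) f by (simp add: p_def permutes_in_image)
    then show ?thesis using orbit.step[of y p z] that(2) by (simp add: C_def)
  qed (simp add: zC)
  have orbA: "orbit f z \<subseteq> A" and orbB: "orbit g z \<subseteq> B"
    using orbit_subset_invariant[of f A z] orbit_subset_invariant[of g B z] zA zB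
      permutes_image[OF f] permutes_image[OF g] by simp_all
  have fz: "orbit f z \<subseteq> C"
  proof
    fix y assume "y \<in> orbit f z"
    then show "y \<in> C"
    proof induction
      case (step y)
      then show ?case using fC[of y] orbA by auto
    qed (rule fC[OF zA zC])
  qed
  \<comment> \<open>The letter that \<open>f\<close> sends to \<open>z\<close> is where the cycle of \<open>p\<close> passes from \<open>A\<close> to \<open>B\<close>.\<close>
  have gz: "g z \<in> C"
  proof -
    obtain w where w: "f w = z" using permutes_surj[OF f] by (metis surjD)
    have "w \<in> orbit f z"
      using permutation_orbit_step[OF perm(1), of w] self[OF perm(1), of w] w by simp
    then have "w \<in> C" using fz by auto
    then have "p w \<in> C" unfolding C_def by (rule orbit.step)
    then show ?thesis by (simp add: p_def w)
  qed
  have gC: "g y \<in> C" if "y \<in> B" "y \<in> C" for y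
  proof (cases "y = z")
    case False
    then have "p y = g y" using f_id that(1) by (simp add: p_def)
    then show ?thesis using orbit.step[of y p z] that(2) by (simp add: C_def)
  qed (simp add: gz)
  have gz': "orbit g z \<subseteq> C"
  proof
    fix y assume "y \<in> orbit g z"
    then show "y \<in> C"
    proof induction
      case (step y)
      then show ?case using gC[of y] orbB by auto
    qed (rule gz)
  qed
  have pMM: "p ` M \<subseteq> M" and pNN: "p ` N \<subseteq> N"
    using pM pN fM gN by auto
  have pC: "p ` C \<subseteq> C" by (auto simp: C_def intro: orbit.step)
  have swap: "z \<in> orbit p x" if "x \<in> C" for x
    using that permutes_orbit_eq[OF finU pU, of x z] self[OF perm(3), of z] by (simp add: C_def)
  have CM: "C \<inter> M = {}" and CN: "C \<inter> N = {}"
    using swap orbit_subset_invariant[OF pMM] orbit_subset_invariant[OF pNN] zM zN by blast+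
  have MN: "(C \<union> M) \<inter> N = {}" using CN z zM by (auto simp: M_def N_def)
  have CU: "C \<subseteq> A \<union> B"
    unfolding C_def using permutes_image[OF pU] zA by (intro orbit_subset_invariant) auto
  have "A \<union> B = (C \<union> M) \<union> N"
    using CU fz gz' by (auto simp: M_def N_def)
  moreover have finCMN: "finite C" "finite M" "finite N"
    using finite_subset[OF CU finU] fin by (auto simp: M_def N_def)
  moreover have "cyc ((C \<union> M) \<union> N) p = cyc (C \<union> M) p + cyc N p"
    using finCMN pC pMM pNN by (intro cyc_disjoint_Un MN) auto
  moreover have "cyc (C \<union> M) p = cyc C p + cyc M p"
    using finCMN by (intro cyc_disjoint_Un CM pC pMM)
  moreover have "cyc C p = 1" unfolding C_def by (rule cyc_orbit[OF finU pU])
  moreover have "cyc M p = cyc M f" by (rule cyc_cong[OF fin(1) f fM pM])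
  moreover have "cyc N p = cyc N g" by (rule cyc_cong[OF fin(2) g gN pN])
  ultimately show ?thesis using cA cB by (simp add: p_def)
qed

section \<open>Decorations\<close>

lemma up_eq: "up m = (m + 1) div 2" and dn_eq: "dn m = m div 2"
  unfolding up_def dn_def by linarith+

lemma up_add: "\<not> (odd a \<and> odd b) \<Longrightarrow> up (a + b) = up a + up b"
  and dn_add: "\<not> (odd a \<and> odd b) \<Longrightarrow> dn (a + b) = dn a + dn b"
  unfolding up_eq dn_eq by presburger+

lemma atLeast1_Un_shift: "{1..a + b} = {1..a} \<union> (+) a ` {1..b}" for a b :: nat
proof
  show "{1..a + b} \<subseteq> {1..a} \<union> (+) a ` {1..b}"
  proof
    fix x assume "x \<in> {1..a + b}"
    moreover have "x = a + (x - a)" if "a < x" using that by simp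
    ultimately show "x \<in> {1..a} \<union> (+) a ` {1..b}" by (cases "x \<le> a") auto
  qed
qed auto

lemma oplus_permutes:
  assumes "\<sigma> permutes {1..a}" "\<sigma>' permutes {1..b}"
  shows "oplus a \<sigma> \<sigma>' permutes {1..a + b}"
proof -
  let ?h = "(+) a" and ?B = "{1..b}"
  have "bij_betw ?h ?B (?h ` ?B)" by (simp add: inj_on_imp_bij_betw)
  from permutes_bij_inv_into[OF assms(2) this]
  have "(\<lambda>x. if x \<in> ?h ` ?B then ?h (\<sigma>' (inv_into ?B ?h x)) else x) permutes ?h ` ?B" .
  then have "\<sigma> \<circ> (\<lambda>x. if x \<in> ?h ` ?B then ?h (\<sigma>' (inv_into ?B ?h x)) else x) permutes {1..a + b}"
    unfolding atLeast1_Un_shift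
    by (intro permutes_compose) (auto intro: permutes_subset[OF assms(1)] permutes_subset)
  also have "\<sigma> \<circ> (\<lambda>x. if x \<in> ?h ` ?B then ?h (\<sigma>' (inv_into ?B ?h x)) else x) = oplus a \<sigma> \<sigma>'"
  proof
    fix x
    consider "x \<le> a" | y where "x = a + y" "y \<in> ?B" | "x > a + b"
    proof -
      have "x = a + (x - a) \<and> x - a \<in> ?B" if "a < x" "x \<le> a + b" using that by auto
      then show ?thesis using that by (meson not_le)
    qed
    then show "(\<sigma> \<circ> (\<lambda>x. if x \<in> ?h ` ?B then ?h (\<sigma>' (inv_into ?B ?h x)) else x)) x = oplus a \<sigma> \<sigma>' x"
    proof cases
      case 1
      then show ?thesis by (auto simp: oplus_def)
    next
      case 2
      moreover have "\<sigma>' y \<in> ?B" using permutes_in_image[OF assms(2)] 2(2) by blast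
      ultimately show ?thesis
        using inv_into_f_f[of ?h ?B y] permutes_not_in[OF assms(1), of "a + \<sigma>' y"]
        by (auto simp: oplus_def)
    next
      case 3
      then have "\<not> (Suc 0 \<le> x - a \<and> x - a \<le> b)" by linarith
      with 3 show ?thesis
        using permutes_not_in[OF assms(1), of x] permutes_not_in[OF assms(2), of "x - a"]
        by (auto simp: oplus_def)
    qed
  qed
  finally show ?thesis .
qed

lemma cyc_oplus:
  assumes "\<sigma> permutes {1..a}" "\<sigma>' permutes {1..b}"
  shows "cyc {1..a + b} (oplus a \<sigma> \<sigma>') = cyc {1..a} \<sigma> + cyc {1..b} \<sigma>'"
proof -
  let ?p = "oplus a \<sigma> \<sigma>'"
  have im: "\<sigma> ` {1..a} \<subseteq> {1..a}" "\<sigma>' ` {1..b} \<subseteq> {1..b}"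
    using permutes_image assms by blast+
  have shift: "?p (a + y) = a + \<sigma>' y" if "y \<in> {1..b}" for y
    using that by (simp add: oplus_def)
  have low: "?p y = \<sigma> y" if "y \<in> {1..a}" for y
    using that by (simp add: oplus_def)
  have "cyc {1..a + b} ?p = cyc {1..a} ?p + cyc ((+) a ` {1..b}) ?p"
    unfolding atLeast1_Un_shift
  proof (rule cyc_disjoint_Un)
    show "?p ` {1..a} \<subseteq> {1..a}" using im(1) low by auto
    show "?p ` (+) a ` {1..b} \<subseteq> (+) a ` {1..b}" using im(2) shift by (auto simp: image_subset_iff simp del: image_add_atLeastAtMost)
  qed auto
  also have "cyc {1..a} ?p = cyc {1..a} \<sigma>"
    using cyc_cong[OF _ assms(1) im(1) low] by simp
  also have "cyc ((+) a ` {1..b}) ?p = cyc {1..b} \<sigma>'"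
    using cyc_semiconj[of "{1..b}" \<sigma>' "{1..b}" "(+) a" ?p] assms(2) im(2) shift
    by simp
  finally show ?thesis .
qed

lemma oplus_assoc: "oplus (a + b) (oplus a \<sigma> \<sigma>') \<sigma>'' = oplus a \<sigma> (oplus b \<sigma>' \<sigma>'')"
  by (rule ext) (auto simp: oplus_def)

text \<open>The embedding of \<open>{\<ast>, 1, \<dots>, b}\<close> into \<open>{\<ast>, 1, \<dots>, a + b}\<close> that shifts the letters by \<open>a\<close> and fixes the
  root, which is the letter \<open>0\<close>.\<close>

definition shift0 :: "nat \<Rightarrow> nat \<Rightarrow> nat" where
  "shift0 a y = (if y = 0 then 0 else a + y)"

lemma cycle_of_list_nth:
  assumes "distinct cs" "i < length cs"
  shows "cycle_of_list cs (cs ! i) = cs ! (Suc i mod length cs)"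
proof -
  have "map (cycle_of_list cs) cs = rotate1 cs"
    using cyclic_rotation[OF assms(1), of 1] by simp
  then have "map (cycle_of_list cs) cs ! i = rotate1 cs ! i" by simp
  then show ?thesis using assms(2) by (simp add: nth_rotate1)
qed

lemma root_cycle_props:
  assumes "permutation \<tau>"
  shows "distinct (root_cycle \<tau>)" "root_cycle \<tau> \<noteq> []" "root_cycle \<tau> ! 0 = 0"
    and "i < length (root_cycle \<tau>) \<Longrightarrow>
      \<tau> (root_cycle \<tau> ! i) = (if Suc i = length (root_cycle \<tau>) then 0 else root_cycle \<tau> ! Suc i)"
    and "\<tau> x \<in> set (root_cycle \<tau>) \<longleftrightarrow> x \<in> set (root_cycle \<tau>)"
proof -
  let ?n = "least_power \<tau> 0"
  have n: "(\<tau> ^^ ?n) 0 = 0" "?n > 0" using least_power_of_permutation[OF assms] by auto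
  show "distinct (root_cycle \<tau>)"
    unfolding root_cycle_def by (rule cycle_of_permutation[OF assms])
  show "root_cycle \<tau> \<noteq> []" "root_cycle \<tau> ! 0 = 0"
    using n by (simp_all add: root_cycle_def)
  show "\<tau> (root_cycle \<tau> ! i) = (if Suc i = length (root_cycle \<tau>) then 0 else root_cycle \<tau> ! Suc i)"
    if "i < length (root_cycle \<tau>)"
    using that n by (auto simp: root_cycle_def simp flip: funpow.simps(2) comp_apply[of \<tau>])
  have orb: "set (root_cycle \<tau>) = orbit \<tau> 0"
    unfolding root_cycle_def support_set[OF assms] orbit_altdef_permutation[OF assms] by auto
  show "\<tau> x \<in> set (root_cycle \<tau>) \<longleftrightarrow> x \<in> set (root_cycle \<tau>)"
    unfolding orb using permutation_orbit_step[OF assms, of x] permutation_self_in_orbit[OF assms, of x]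
    by (metis assms orbit.step orbit_swap orbit_trans permutation_self_in_orbit)
qed

text \<open>In the concatenated root cycle every letter keeps the successor that it has in its own factor, except that the last
  letter of the root cycle of \<open>\<tau>\<close> leads on to the first shifted letter of the root cycle of \<open>\<upsilon>\<close>, if there is one, instead
  of back to the root.  A letter is last in its root cycle if and only if it is mapped to \<open>0\<close>, so the product has a
  description that no longer mentions cycles.  Associativity and the cycle count both rest on it.\<close>

lemma star_eq:
  assumes "\<tau> permutes {0..a}" "\<upsilon> permutes {0..b}"
  shows "star a \<tau> \<upsilon> x = (if x \<le> a then if \<tau> x = 0 then shift0 a (\<upsilon> 0) else \<tau> x else shift0 a (\<upsilon> (x - a)))"
    (is "_ = ?F x")
proof -
  have pt: "permutation \<tau>" and pu: "permutation \<upsilon>"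
    using assms by (auto simp: permutation_permutes)
  define L where "L = root_cycle \<tau>"
  define M where "M = root_cycle \<upsilon>"
  define R where "R = star_root a \<tau> \<upsilon>"
  note Lp = root_cycle_props[OF pt, folded L_def] and Mp = root_cycle_props[OF pu, folded M_def]
  have R: "R = L @ map ((+) a) (tl M)" by (simp add: R_def star_root_def L_def M_def)
  have Lne: "length L > 0" and Mne: "length M > 0" using Lp(2) Mp(2) by auto
  have L0: "L ! i = 0 \<longleftrightarrow> i = 0" if "i < length L" for i
    using that Lp(1,3) Lne by (metis nth_eq_iff_index_eq)
  have M0: "M ! i = 0 \<longleftrightarrow> i = 0" if "i < length M" for i
    using that Mp(1,3) Mne by (metis nth_eq_iff_index_eq)
  have inL: "0 \<in> set L" and inM: "0 \<in> set M"
    using Lne Mne Lp(3) Mp(3) by (metis nth_mem)+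
  have Lle: "L ! i \<le> a" if "i < length L" for i
    using that
  proof (induction i)
    case 0
    then show ?case by (simp add: Lp(3))
  next
    case (Suc i)
    then show ?case using Lp(4)[of i] permutes_in_image[OF assms(1), of "L ! i"] by simp
  qed
  have lenR: "length R = length L + (length M - 1)" by (simp add: R)
  have Rlow: "R ! i = L ! i" if "i < length L" for i using that by (simp add: R nth_append)
  have Rhigh: "R ! i = a + M ! Suc (i - length L)" if "length L \<le> i" "i < length R" for i
    using that by (simp add: R nth_append nth_tl)
  have high: "y > a" if y: "y \<in> set (map ((+) a) (tl M))" for y
  proof -
    obtain w where "w \<in> set (tl M)" "y = a + w" using y by auto
    then obtain k where "k < length (tl M)" "y = a + tl M ! k"
      unfolding in_set_conv_nth by blast
    then show ?thesis using M0[of "Suc k"] by (simp add: nth_tl)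
  qed
  have low: "y \<le> a" if "y \<in> set L" for y
    using that Lle by (auto simp: in_set_conv_nth)
  have distR: "distinct R"
    using Lp(1) Mp(1) low high by (force simp: R distinct_map distinct_tl)
  show ?thesis
  proof (cases "x \<in> set R")
    case True
    then obtain i where i: "i < length R" "x = R ! i" by (auto simp: in_set_conv_nth)
    have "star a \<tau> \<upsilon> x = R ! (Suc i mod length R)"
      using True cycle_of_list_nth[OF distR i(1)] by (simp add: star_def i(2) flip: R_def)
    also have "\<dots> = ?F x"
    proof (cases "Suc i < length L")
      case True
      then show ?thesis
        using Lp(4)[of i] L0[of "Suc i"] Lle[of i] lenR by (simp add: i(2) Rlow)
    next
      case False
      show ?thesis
      proof (cases "Suc i = length L")
        case True
        then have x: "x \<le> a" "\<tau> x = 0" using Lp(4)[of i] Lle[of i] by (simp_all add: i(2) Rlow)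
        show ?thesis
        proof (cases "length M = 1")
          case len1: True
          then show ?thesis using x True lenR Mp(3) Mp(4)[of 0] Lne
            by (simp add: shift0_def Rlow Lp(3))
        next
          case False
          then have "length M > 1" using False Mne by linarith
          then show ?thesis using x True lenR Mp(2,3) Mp(4)[of 0] M0[of 1] Rhigh[of "Suc i"]
            by (simp add: shift0_def)
        qed
      next
        case F2: False
        \<comment> \<open>\<open>j\<close> is the position of the letter in the root cycle of \<open>\<upsilon>\<close>, whose entry \<open>0\<close> is not repeated in \<open>R\<close>.\<close>
        define j where "j = Suc (i - length L)"
        have j: "j < length M" "x = a + M ! j" "j > 0" "i = length L + j - 1"
          using False F2 i lenR by (auto simp: j_def Rhigh)
        have "M ! j \<noteq> 0" using M0[of j] j by simp
        show ?thesis
        proof (cases "Suc j = length M")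
          case True
          then have "Suc i = length R" using j lenR by linarith
          then have "Suc i mod length R = 0" by simp
          then show ?thesis using Mp(4)[of j] True j \<open>M ! j \<noteq> 0\<close> Lne
            by (simp add: shift0_def Rlow Lp(3))
        next
          case False
          then have "Suc i < length R" using j lenR by linarith
          then have "Suc i mod length R = Suc i" by simp
          then show ?thesis using Mp(4)[of j] M0[of "Suc j"] False j \<open>M ! j \<noteq> 0\<close> Rhigh[of "Suc i"] lenR
            by (simp add: shift0_def)
        qed
      qed
    qed
    finally show ?thesis .
  next
    case False
    have tL: "\<tau> x \<noteq> 0" using Lp(5)[of x] inL False by (auto simp: R)
    have tM: "\<upsilon> (x - a) \<noteq> 0" if "x > a"
    proof
      assume "\<upsilon> (x - a) = 0"
      then have "x - a \<in> set M" using Mp(5)[of "x - a"] inM by simp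
      then obtain j where j: "j < length M" "M ! j = x - a" by (auto simp: in_set_conv_nth)
      then have "j > 0" using that M0[of j] by simp
      then have "tl M ! (j - 1) = x - a" "j - 1 < length (tl M)" using j by (simp_all add: nth_tl)
      then have "x - a \<in> set (tl M)" by (metis nth_mem)
      then have "x \<in> set R" using that by (auto simp: R image_iff intro!: disjI2 bexI[of _ "x - a"])
      then show False using False by simp
    qed
    show ?thesis using False tL tM by (cases "x \<le> a") (auto simp: star_def shift0_def simp flip: R_def)
  qed
qed

lemma atLeast0_Un_shift0: "{0..a + b} = {0..a} \<union> shift0 a ` {0..b}"
proof
  show "{0..a + b} \<subseteq> {0..a} \<union> shift0 a ` {0..b}"
  proof
    fix x assume "x \<in> {0..a + b}"
    moreover have "x = shift0 a (x - a)" if "x > a" using that by (simp add: shift0_def)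
    ultimately show "x \<in> {0..a} \<union> shift0 a ` {0..b}" by (cases "x \<le> a") auto
  qed
qed (auto simp: shift0_def)

lemma shift0_inj: "inj_on (shift0 a) B"
  by (auto simp: inj_on_def shift0_def split: if_splits)

text \<open>By \<open>star_eq\<close>, the product applies \<open>\<tau>\<close> and then, at the root and at the letters beyond \<open>a\<close>, the shifted copy of \<open>\<upsilon>\<close>.
  This turns the cycle count into an instance of \<open>cyc_comp_meeting_in_point\<close>, because the supports of the two factors have
  only the root in common.\<close>

lemma star_eq_comp:
  assumes "\<tau> permutes {0..a}" "\<upsilon> permutes {0..b}"
  obtains \<upsilon>' where "\<upsilon>' permutes shift0 a ` {0..b}" "\<And>y. y \<in> {0..b} \<Longrightarrow> \<upsilon>' (shift0 a y) = shift0 a (\<upsilon> y)"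
    "star a \<tau> \<upsilon> = \<upsilon>' \<circ> \<tau>"
proof
  let ?B = "{0..b}"
  let ?u = "\<lambda>x. if x \<in> shift0 a ` ?B then shift0 a (\<upsilon> (inv_into ?B (shift0 a) x)) else x"
  show u: "?u permutes shift0 a ` ?B"
    by (rule permutes_bij_inv_into[OF assms(2)]) (simp add: inj_on_imp_bij_betw shift0_inj)
  show *: "?u (shift0 a y) = shift0 a (\<upsilon> y)" if "y \<in> ?B" for y
    using that by (simp add: inv_into_f_f shift0_inj)
  show "star a \<tau> \<upsilon> = ?u \<circ> \<tau>"
  proof
    fix x
    consider "x \<le> a" "\<tau> x = 0" | "x \<le> a" "\<tau> x \<noteq> 0" | y where "x = shift0 a y" "y \<in> ?B" "y \<noteq> 0"
      | "x > a + b"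
    proof -
      have "x = shift0 a (x - a)" if "x > a" using that by (simp add: shift0_def)
      then show ?thesis using that by (cases "x \<le> a"; cases "x \<le> a + b") fastforce+
    qed
    then show "star a \<tau> \<upsilon> x = (?u \<circ> \<tau>) x"
    proof cases
      case 1
      then show ?thesis using *[of 0] by (simp add: star_eq[OF assms] shift0_def)
    next
      case 2
      then have "\<tau> x \<le> a" using permutes_in_image[OF assms(1), of x] by simp
      then have "\<tau> x \<notin> shift0 a ` ?B" using 2 by (auto simp: shift0_def)
      then show ?thesis using 2 by (simp add: star_eq[OF assms])
    next
      case 3
      then show ?thesis using *[of y] permutes_not_in[OF assms(1), of x]
        by (simp add: star_eq[OF assms]) (simp add: shift0_def)
    next
      case 4
      then show ?thesis
        using permutes_not_in[OF assms(1), of x] permutes_not_in[OF assms(2), of "x - a"]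
        by (auto simp: star_eq[OF assms] shift0_def)
    qed
  qed
qed

lemma star_permutes:
  assumes "\<tau> permutes {0..a}" "\<upsilon> permutes {0..b}"
  shows "star a \<tau> \<upsilon> permutes {0..a + b}"
proof -
  obtain \<upsilon>' where u: "\<upsilon>' permutes shift0 a ` {0..b}" "star a \<tau> \<upsilon> = \<upsilon>' \<circ> \<tau>"
    using star_eq_comp[OF assms] by metis
  then show ?thesis
    unfolding u(2) atLeast0_Un_shift0
    by (intro permutes_compose) (auto intro: permutes_subset[OF assms(1)] permutes_subset)
qed

lemma cyc_star:
  assumes "\<tau> permutes {0..a}" "\<upsilon> permutes {0..b}"
  shows "cyc {0..a + b} (star a \<tau> \<upsilon>) + 1 = cyc {0..a} \<tau> + cyc {0..b} \<upsilon>"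
proof -
  obtain \<upsilon>' where u: "\<upsilon>' permutes shift0 a ` {0..b}" "star a \<tau> \<upsilon> = \<upsilon>' \<circ> \<tau>"
    "\<And>y. y \<in> {0..b} \<Longrightarrow> \<upsilon>' (shift0 a y) = shift0 a (\<upsilon> y)"
    using star_eq_comp[OF assms] by metis
  have "{0..a} \<inter> shift0 a ` {0..b} = {0}" by (auto simp: shift0_def split: if_splits)
  then have "cyc {0..a + b} (star a \<tau> \<upsilon>) + 1 = cyc {0..a} \<tau> + cyc (shift0 a ` {0..b}) \<upsilon>'"
    unfolding u(2) atLeast0_Un_shift0 by (intro cyc_comp_meeting_in_point assms(1) u(1)) auto
  also have "cyc (shift0 a ` {0..b}) \<upsilon>' = cyc {0..b} \<upsilon>"
    using permutes_image[OF assms(2)] by (intro cyc_semiconj[of "{0..b}"] assms(2) shift0_inj u(3)) auto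
  finally show ?thesis .
qed

lemma star_assoc:
  assumes "\<tau> permutes {0..a}" "\<upsilon> permutes {0..b}" "\<omega> permutes {0..c}"
  shows "star (a + b) (star a \<tau> \<upsilon>) \<omega> = star a \<tau> (star b \<upsilon> \<omega>)"
proof
  fix x
  have t: "x \<le> a \<Longrightarrow> \<tau> x \<le> a" for x using permutes_in_image[OF assms(1), of x] by simp
  have u: "x \<le> b \<Longrightarrow> \<upsilon> x \<le> b" for x using permutes_in_image[OF assms(2), of x] by simp
  have "x - (a + b) = x - a - b" by simp
  then show "star (a + b) (star a \<tau> \<upsilon>) \<omega> x = star a \<tau> (star b \<upsilon> \<omega>) x"
    unfolding star_eq[OF star_permutes[OF assms(1,2)] assms(3)]
      star_eq[OF assms(1) star_permutes[OF assms(2,3)]]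
    by (auto simp: star_eq[OF assms(1,2)] star_eq[OF assms(2,3)] shift0_def le_diff_conv)
qed

text \<open>If \<open>a\<close> and \<open>b\<close> are not both odd then the upper and lower halves of \<open>a + b\<close> are the sums of those of \<open>a\<close> and \<open>b\<close>,
  so the product has the right ground sets.  The first components have disjoint supports and their cycles add
  up; the second components lose one cycle because the root cycles merge.  The weight \<open>t\<close> is nevertheless additive,
  because it does not count the root cycle.\<close>

lemma dia_props:
  assumes "\<xi> \<in> dec a" "\<xi>' \<in> dec b" "\<not> (odd a \<and> odd b)"
  shows "dia a \<xi> \<xi>' \<in> dec (a + b)"
    and "tdeg_dec (a + b) (dia a \<xi> \<xi>') = tdeg_dec a \<xi> + tdeg_dec b \<xi>'"
    and "qdeg_dec (a + b) (dia a \<xi> \<xi>') = qdeg_dec a \<xi> + qdeg_dec b \<xi>'"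
proof -
  obtain \<sigma> \<tau> \<sigma>' \<tau>' where x: "\<xi> = (\<sigma>, \<tau>)" "\<xi>' = (\<sigma>', \<tau>')" by (metis surj_pair)
  have p: "\<sigma> permutes {1..up a}" "\<tau> permutes {0..dn a}" "\<sigma>' permutes {1..up b}" "\<tau>' permutes {0..dn b}"
    using assms(1,2) by (simp_all add: x dec_def)
  note [simp] = up_add[OF assms(3)] dn_add[OF assms(3)] x dia_def
  show "dia a \<xi> \<xi>' \<in> dec (a + b)"
    using oplus_permutes[OF p(1,3)] star_permutes[OF p(2,4)] by (simp add: dec_def)
  show "qdeg_dec (a + b) (dia a \<xi> \<xi>') = qdeg_dec a \<xi> + qdeg_dec b \<xi>'"
    using cyc_oplus[OF p(1,3)] by (simp add: qdeg_dec_def)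
  show "tdeg_dec (a + b) (dia a \<xi> \<xi>') = tdeg_dec a \<xi> + tdeg_dec b \<xi>'"
    using cyc_oplus[OF p(1,3)] cyc_star[OF p(2,4)] by (simp add: tdeg_dec_def)
qed

lemma dia_assoc:
  assumes "\<xi> \<in> dec a" "\<xi>' \<in> dec b" "\<xi>'' \<in> dec c" "\<not> (odd a \<and> odd b)"
  shows "dia (a + b) (dia a \<xi> \<xi>') \<xi>'' = dia a \<xi> (dia b \<xi>' \<xi>'')"
  using assms by (auto simp: dia_def dec_def up_add dn_add oplus_assoc star_assoc split: prod.splits)

section \<open>Partial sums of compositions\<close>

text \<open>The cut set together with the end points \<open>0\<close> and \<open>n\<close>.  With the end points included, the partial sums of a
  concatenation are those of the first part and the shifted ones of the second, even if a part is empty, and refinement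
  of compositions of the same number is inclusion of these sets.\<close>

definition psums :: "nat list \<Rightarrow> nat set" where
  "psums \<alpha> = {sum_list (take i \<alpha>) | i. i \<le> length \<alpha>}"

lemma zero_in_psums [simp]: "0 \<in> psums \<alpha>"
  by (auto simp: psums_def intro!: exI[of _ 0])

lemma sum_in_psums [simp]: "sum_list \<alpha> \<in> psums \<alpha>"
  by (auto simp: psums_def intro!: exI[of _ "length \<alpha>"])

lemma psums_Nil [simp]: "psums [] = {0}"
  by (auto simp: psums_def)

lemma psums_Cons [simp]: "psums (a # \<alpha>) = insert 0 ((+) a ` psums \<alpha>)"
proof (intro set_eqI iffI)
  fix x assume "x \<in> psums (a # \<alpha>)"
  then obtain i where "i \<le> Suc (length \<alpha>)" "x = sum_list (take i (a # \<alpha>))" by (auto simp: psums_def)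
  then show "x \<in> insert 0 ((+) a ` psums \<alpha>)" by (cases i) (auto simp: psums_def)
next
  fix x assume x: "x \<in> insert 0 ((+) a ` psums \<alpha>)"
  show "x \<in> psums (a # \<alpha>)"
  proof (cases "x = 0")
    case False
    then obtain i where "i \<le> length \<alpha>" "x = a + sum_list (take i \<alpha>)" using x by (auto simp: psums_def)
    then show ?thesis unfolding psums_def by (intro CollectI exI[of _ "Suc i"]) simp
  qed simp
qed

lemma psums_append: "psums (xs @ ys) = psums xs \<union> (+) (sum_list xs) ` psums ys"
proof (induction xs)
  case Nil
  show ?case by (auto simp: image_iff)
next
  case (Cons x xs)
  then show ?case by (auto simp: image_Un image_image add.assoc)
qed

lemma psums_le: "x \<in> psums \<alpha> \<Longrightarrow> x \<le> sum_list \<alpha>"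
  unfolding psums_def by (clarsimp, metis append_take_drop_id le_add1 sum_list_append)

abbreviation positive :: "nat list \<Rightarrow> bool" where
  "positive \<alpha> \<equiv> \<forall>a \<in> set \<alpha>. 0 < a"

lemma sum_list_positive: "positive \<alpha> \<Longrightarrow> \<alpha> \<noteq> [] \<Longrightarrow> 0 < sum_list \<alpha>"
  by (cases \<alpha>) auto

lemma sum_list_take_less:
  assumes "positive \<alpha>" "i < j" "j \<le> length \<alpha>"
  shows "sum_list (take i \<alpha>) < sum_list (take j \<alpha>)"
proof -
  have "take j \<alpha> = take i \<alpha> @ drop i (take j \<alpha>)"
    using assms(2) by (metis append_take_drop_id less_imp_le_nat min.absorb1 take_take)
  moreover have "0 < sum_list (drop i (take j \<alpha>))"
    using assms by (intro sum_list_positive) (auto dest: in_set_dropD in_set_takeD)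
  ultimately show ?thesis by (metis less_add_same_cancel1 sum_list_append)
qed

lemma sum_list_take_inj:
  assumes "positive \<alpha>" "i \<le> length \<alpha>" "j \<le> length \<alpha>" "sum_list (take i \<alpha>) = sum_list (take j \<alpha>)"
  shows "i = j"
  using sum_list_take_less[OF assms(1)] assms(2-4) by (metis less_irrefl linorder_neqE_nat)

lemma psums_cut_set:
  assumes "positive \<alpha>"
  shows "psums \<alpha> = insert 0 (insert (sum_list \<alpha>) (cut_set \<alpha>))" "cut_set \<alpha> \<subseteq> {0<..<sum_list \<alpha>}"
proof -
  show "psums \<alpha> = insert 0 (insert (sum_list \<alpha>) (cut_set \<alpha>))"
  proof
    show "psums \<alpha> \<subseteq> insert 0 (insert (sum_list \<alpha>) (cut_set \<alpha>))"
    proof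
      fix x assume "x \<in> psums \<alpha>"
      then obtain i where i: "i \<le> length \<alpha>" "x = sum_list (take i \<alpha>)" by (auto simp: psums_def)
      then consider "i = 0" | "i = length \<alpha>" | "1 \<le> i \<and> i < length \<alpha>" by linarith
      then show "x \<in> insert 0 (insert (sum_list \<alpha>) (cut_set \<alpha>))"
        using i by cases (auto simp: cut_set_def)
    qed
    have "cut_set \<alpha> \<subseteq> psums \<alpha>" by (force simp: cut_set_def psums_def)
    then show "insert 0 (insert (sum_list \<alpha>) (cut_set \<alpha>)) \<subseteq> psums \<alpha>" by simp
  qed
  show "cut_set \<alpha> \<subseteq> {0<..<sum_list \<alpha>}"
    using sum_list_take_less[OF assms, of 0] sum_list_take_less[OF assms, of _ "length \<alpha>"]
    by (auto simp: cut_set_def)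
qed

lemma coarser_iff_psums:
  assumes "composition \<alpha> n" "composition \<beta> n"
  shows "coarser \<beta> \<alpha> \<longleftrightarrow> psums \<beta> \<subseteq> psums \<alpha>"
proof -
  have a: "positive \<alpha>" "sum_list \<alpha> = n" and b: "positive \<beta>" "sum_list \<beta> = n"
    using assms by (auto simp: composition_def)
  have *: "0 \<notin> cut_set \<beta>" "n \<notin> cut_set \<beta>"
    using psums_cut_set(2)[OF b(1)] b(2) by auto
  show ?thesis
    using psums_cut_set(1)[OF a(1)] psums_cut_set(1)[OF b(1)] *
    unfolding coarser_def a(2) b(2) by auto
qed

section \<open>Bars\<close>

text \<open>The conditions on the blocks and decorations of a bar that do not involve the composition.  Disjointness of the
  blocks is expressed by \<open>sorted_wrt\<close>, which is compatible with concatenation.\<close>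

definition decorated :: "'a set list \<Rightarrow> decoration list \<Rightarrow> bool" where
  "decorated Bs \<xi>s \<longleftrightarrow> sorted_wrt (\<lambda>A B. A \<inter> B = {}) Bs \<and> (\<forall>B \<in> set Bs. 0 < card B) \<and>
    list_all2 (\<lambda>B \<xi>. \<xi> \<in> dec (card B)) Bs \<xi>s"

lemma decorated_length: "decorated Bs \<xi>s \<Longrightarrow> length \<xi>s = length Bs"
  by (auto simp: decorated_def dest: list_all2_lengthD)

lemma decorated_Nil [simp]: "decorated [] \<xi>s \<longleftrightarrow> \<xi>s = []"
  by (auto simp: decorated_def)

lemma decorated_Cons:
  "decorated (B # Bs) \<xi>s \<longleftrightarrow> (\<exists>\<xi> \<xi>s'. \<xi>s = \<xi> # \<xi>s' \<and> B \<inter> \<Union> (set Bs) = {} \<and> 0 < card B \<and>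
    \<xi> \<in> dec (card B) \<and> decorated Bs \<xi>s')"
  unfolding decorated_def list_all2_Cons1 sorted_wrt.simps list.set Union_disjoint Int_commute[of B]
  by (auto simp: Int_commute)

lemma decorated_append:
  "length xs = length us \<Longrightarrow> decorated (xs @ ys) (us @ vs) \<longleftrightarrow>
    decorated xs us \<and> decorated ys vs \<and> \<Union> (set xs) \<inter> \<Union> (set ys) = {}"
  by (auto simp: decorated_def sorted_wrt_append list_all2_append)

lemma card_Union_decorated: "decorated Bs \<xi>s \<Longrightarrow> card (\<Union> (set Bs)) = sum_list (map card Bs)"
proof (induction Bs arbitrary: \<xi>s)
  case (Cons B Bs)
  then obtain \<xi>s' where *: "B \<inter> \<Union> (set Bs) = {}" "0 < card B" "decorated Bs \<xi>s'"
    by (auto simp: decorated_Cons)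
  then have "finite (\<Union> (set Bs))"
    by (intro finite_Union) (auto simp: decorated_def intro: card_ge_0_finite)
  then show ?case using * Cons.IH[OF *(3)] by (simp add: card_Un_disjoint card_ge_0_finite)
qed simp

lemma in_bars_iff:
  assumes "composition \<alpha> (card I)"
  shows "Bar \<alpha>' Bs \<xi>s \<in> bars \<alpha> I \<longleftrightarrow>
    \<alpha>' = \<alpha> \<and> decorated Bs \<xi>s \<and> \<Union> (set Bs) = I \<and> psums (map card Bs) \<subseteq> psums \<alpha>"
proof
  assume "Bar \<alpha>' Bs \<xi>s \<in> bars \<alpha> I"
  then have *: "\<alpha>' = \<alpha>" "composition (map card Bs) (card I)" "coarser (map card Bs) \<alpha>"
    "\<Union> (set Bs) = I" "\<forall>i j. i < j \<and> j < length Bs \<longrightarrow> Bs ! i \<inter> Bs ! j = {}"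
    "list_all2 (\<lambda>b \<xi>. \<xi> \<in> dec b) (map card Bs) \<xi>s"
    by (auto simp: bars_def OSP_def)
  then show "\<alpha>' = \<alpha> \<and> decorated Bs \<xi>s \<and> \<Union> (set Bs) = I \<and> psums (map card Bs) \<subseteq> psums \<alpha>"
    using coarser_iff_psums[OF assms *(2)]
    by (auto simp: decorated_def sorted_wrt_iff_nth_less composition_def list_all2_map1)
next
  assume *: "\<alpha>' = \<alpha> \<and> decorated Bs \<xi>s \<and> \<Union> (set Bs) = I \<and> psums (map card Bs) \<subseteq> psums \<alpha>"
  then have "composition (map card Bs) (card I)"
    using card_Union_decorated[of Bs \<xi>s] by (auto simp: composition_def decorated_def)
  with * show "Bar \<alpha>' Bs \<xi>s \<in> bars \<alpha> I"
    using coarser_iff_psums[OF assms, of "map card Bs"]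
    by (auto simp: bars_def OSP_def decorated_def sorted_wrt_iff_nth_less list_all2_map1
        intro!: exI[of _ "map card Bs"])
qed

lemma bar_complex_simps [simp]:
  "basis_of (bar_complex X) = X" "hdeg (bar_complex X) w = int (length (blocks w))"
  "bd (bar_complex X) = bar_diff"
  "tdeg (bar_complex X) w = (\<Sum>(B, \<xi>) \<leftarrow> zip (blocks w) (decs w). tdeg_dec (card B) \<xi>)"
  "qdeg (bar_complex X) w = (\<Sum>(B, \<xi>) \<leftarrow> zip (blocks w) (decs w). qdeg_dec (card B) \<xi>)"
  by (simp_all add: bar_complex_def)

lemma basis_Cpx [simp]: "basis_of (Cpx \<alpha> I) = bars \<alpha> I"
  by (simp add: Cpx_def)

lemma bd_Cpx [simp]: "bd (Cpx \<alpha> I) = bar_diff" and bd_Ctot [simp]: "bd (Ctot I) = bar_diff"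
  by (simp_all add: Cpx_def Ctot_def)

lemma basis_Ctot: "w \<in> basis_of (Ctot I) \<longleftrightarrow> (\<exists>\<alpha>. composition \<alpha> (card I) \<and> w \<in> bars \<alpha> I)"
  by (auto simp: Ctot_def)

lemma degs_Cpx_Ctot:
  fixes I :: "'a set"
  shows "hdeg (Cpx \<alpha> I :: ('a bar, 'k::field) bicomplex) = hdeg (Ctot I :: ('a bar, 'k) bicomplex)"
    "tdeg (Cpx \<alpha> I :: ('a bar, 'k) bicomplex) = tdeg (Ctot I :: ('a bar, 'k) bicomplex)"
    "qdeg (Cpx \<alpha> I :: ('a bar, 'k) bicomplex) = qdeg (Ctot I :: ('a bar, 'k) bicomplex)"
  by (simp_all add: Cpx_def Ctot_def bar_complex_def)

section \<open>The differential\<close>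

lemma lmap_bar_diff [simp, intro]: "lmap bar_diff"
  by (simp add: bar_diff_def)

lemma bar_diff_single1:
  "bar_diff (single1 w) = (\<Sum>i\<in>{1..<length (blocks w)}. scl ((-1) ^ (i - 1)) (face i w))"
  by (simp add: bar_diff_def)

lemma face_append:
  assumes "length xs = length us"
  shows "face (Suc (length xs)) (Bar \<alpha> (xs @ A # B # ys) (us @ x # y # vs)) =
    (if odd (card A) \<and> odd (card B) then 0
     else single1 (Bar \<alpha> (xs @ (A \<union> B) # ys) (us @ dia (card A) x y # vs)))"
  using assms by (simp add: face_def nth_append)

lemma split_at_pair:
  assumes "i \<in> {1..<length Bs}"
  shows "Bs = take (i - 1) Bs @ Bs ! (i - 1) # Bs ! i # drop (Suc i) Bs"
proof -
  have "Bs = take (i - 1) Bs @ Bs ! (i - 1) # drop (Suc (i - 1)) Bs"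
    by (rule id_take_nth_drop) (use assms in auto)
  also have "drop (Suc (i - 1)) Bs = Bs ! i # drop (Suc i) Bs"
    using assms Cons_nth_drop_Suc[of i Bs] by simp
  finally show ?thesis .
qed

lemma face_cases:
  assumes "decorated Bs \<xi>s" "i \<in> {1..<length Bs}"
  obtains xs A B ys us x y vs where
    "Bs = xs @ A # B # ys" "\<xi>s = us @ x # y # vs" "length xs = length us" "i = Suc (length xs)"
proof
  note len = decorated_length[OF assms(1)]
  show "Bs = take (i - 1) Bs @ Bs ! (i - 1) # Bs ! i # drop (Suc i) Bs"
    by (rule split_at_pair[OF assms(2)])
  show "\<xi>s = take (i - 1) \<xi>s @ \<xi>s ! (i - 1) # \<xi>s ! i # drop (Suc i) \<xi>s"
    by (rule split_at_pair) (use assms(2) len in simp)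
qed (use assms decorated_length[OF assms(1)] in auto)

lemma decorated_merge:
  assumes "decorated (xs @ A # B # ys) (us @ x # y # vs)" "length xs = length us"
    "\<not> (odd (card A) \<and> odd (card B))"
  shows "card (A \<union> B) = card A + card B" "x \<in> dec (card A)" "y \<in> dec (card B)"
    "decorated (xs @ (A \<union> B) # ys) (us @ dia (card A) x y # vs)"
proof -
  have AB: "A \<inter> B = {}" "finite A" "finite B" "x \<in> dec (card A)" "y \<in> dec (card B)"
    using assms(1,2) by (auto simp: decorated_append decorated_Cons intro: card_ge_0_finite)
  then show card: "card (A \<union> B) = card A + card B" and "x \<in> dec (card A)" "y \<in> dec (card B)"
    by (simp_all add: card_Un_disjoint)
  show "decorated (xs @ (A \<union> B) # ys) (us @ dia (card A) x y # vs)"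
    using assms(1,2) dia_props(1)[OF AB(4,5) assms(3)]
    by (auto simp: decorated_append decorated_Cons card)
qed

text \<open>Merging adjacent blocks only removes a cut, so the bar stays in the same complex, and the product of the decorations
  has the sum of their weights.\<close>

lemma keys_face:
  assumes "composition \<alpha> (card I)" "w \<in> bars \<alpha> I" "i \<in> {1..<length (blocks w)}"
    "w' \<in> Poly_Mapping.keys (face i w)"
  shows "w' \<in> bars \<alpha> I \<and> hdeg (Ctot I) w' = hdeg (Ctot I) w - 1 \<and>
    tdeg (Ctot I) w' = tdeg (Ctot I) w \<and> qdeg (Ctot I) w' = qdeg (Ctot I) w"
proof -
  obtain \<alpha>' Bs \<xi>s where w: "w = Bar \<alpha>' Bs \<xi>s" by (cases w)
  note wb = assms(2)[unfolded w in_bars_iff[OF assms(1)]]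
  then have "decorated Bs \<xi>s" "i \<in> {1..<length Bs}" using assms(3) w by auto
  then obtain xs A B ys us x y vs where *: "Bs = xs @ A # B # ys" "\<xi>s = us @ x # y # vs"
    "length xs = length us" "i = Suc (length xs)"
    by (rule face_cases)
  have odd: "\<not> (odd (card A) \<and> odd (card B))" and
    w': "w' = Bar \<alpha> (xs @ (A \<union> B) # ys) (us @ dia (card A) x y # vs)"
    using assms(4) conjunct1[OF wb] unfolding w *(1,2,4)
    by (auto simp: face_append[OF *(3)] split: if_splits)
  have d: "decorated (xs @ A # B # ys) (us @ x # y # vs)" using wb * by simp
  note merge = decorated_merge[OF d *(3) odd]
  note card = merge(1) and dia = dia_props[OF merge(2,3) odd]
  note merge(4)
  moreover have "psums (map card (xs @ (A \<union> B) # ys)) \<subseteq> psums (map card Bs)"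
    unfolding * by (auto simp: psums_append card image_image add.assoc)
  ultimately have "w' \<in> bars \<alpha> I"
    using wb unfolding w' in_bars_iff[OF assms(1)] by (auto simp: *(1))
  then show ?thesis
    using *(3) by (simp add: w' w *(1,2) Ctot_def card dia(2,3))
qed

text \<open>Prepending a decorated block is extended linearly so that the differential can be treated by recursion on
  the first blocks, without double sums over pairs of faces.\<close>

definition prepend :: "'a set \<Rightarrow> decoration \<Rightarrow> ('a bar \<Rightarrow>\<^sub>0 'k::field) \<Rightarrow> ('a bar \<Rightarrow>\<^sub>0 'k)" where
  "prepend A x = lin (\<lambda>w. single1 (Bar (bcomp w) (A # blocks w) (x # decs w)))"

text \<open>The first face of a bar that begins with the blocks \<open>A\<close> and \<open>B\<close>; its tail is an arbitrary vector.\<close>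

definition prepend_merged :: "'a set \<Rightarrow> decoration \<Rightarrow> 'a set \<Rightarrow> decoration \<Rightarrow> ('a bar \<Rightarrow>\<^sub>0 'k::field) \<Rightarrow> ('a bar \<Rightarrow>\<^sub>0 'k)" where
  "prepend_merged A x B y v = (if odd (card A) \<and> odd (card B) then 0 else prepend (A \<union> B) (dia (card A) x y) v)"

lemma lmap_prepend [simp, intro]: "lmap (prepend A x)"
  by (simp add: prepend_def)

lemma lmap_prepend_merged [simp, intro]: "lmap (prepend_merged A x B y)" (is "lmap ?m")
proof -
  have "?m = (if odd (card A) \<and> odd (card B) then (\<lambda>v. 0) else prepend (A \<union> B) (dia (card A) x y))"
    by (auto simp: prepend_merged_def fun_eq_iff)
  then show ?thesis by simp
qed

lemma prepend_single1: "prepend A x (single1 (Bar \<alpha> Bs \<xi>s)) = single1 (Bar \<alpha> (A # Bs) (x # \<xi>s))"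
  by (simp add: prepend_def)

lemma face_prepend: "1 \<le> i \<Longrightarrow> face (Suc i) (Bar \<alpha> (A # Bs) (x # \<xi>s)) = prepend A x (face i (Bar \<alpha> Bs \<xi>s))"
  by (cases i) (simp_all add: face_def prepend_single1 lmap_0[OF lmap_prepend])

text \<open>The first face merges the two blocks in front.  All other faces leave the first block alone, and their signs are
  opposite to those they have in the bar without that block.\<close>

lemma bar_diff_prepend_prepend:
  "bar_diff (prepend A x (prepend B y v)) = prepend_merged A x B y v - prepend A x (bar_diff (prepend B y v))"
proof (rule lmap_eqI_all[of "\<lambda>v. bar_diff (prepend A x (prepend B y v))"])
  show "lmap (\<lambda>v. bar_diff (prepend A x (prepend B y v)))"
    "lmap (\<lambda>v. prepend_merged A x B y v - prepend A x (bar_diff (prepend B y v)))"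
    by (intro lmap_subtract lmap_prepend_merged lmap_comp[OF lmap_bar_diff] lmap_comp[OF lmap_prepend] lmap_id)+
next
  fix w :: "'a bar"
  obtain \<alpha> Bs \<xi>s where w: "w = Bar \<alpha> Bs \<xi>s" by (cases w)
  let ?W = "Bar \<alpha> (A # B # Bs) (x # y # \<xi>s)" and ?V = "Bar \<alpha> (B # Bs) (y # \<xi>s)"
  have "bar_diff (single1 ?W) = (\<Sum>i\<in>{1..<Suc (Suc (length Bs))}. scl ((-1) ^ (i - 1)) (face i ?W))"
    by (simp add: bar_diff_single1)
  also have "\<dots> = face 1 ?W + (\<Sum>i\<in>{1..<Suc (length Bs)}. scl ((-1) ^ i) (face (Suc i) ?W))"
    by (subst sum.atLeast_Suc_lessThan) (simp_all only: sum.shift_bounds_Suc_ivl, simp_all)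
  also have "(\<Sum>i\<in>{1..<Suc (length Bs)}. scl ((-1) ^ i) (face (Suc i) ?W)) =
      (\<Sum>i\<in>{1..<Suc (length Bs)}. - prepend A x (scl ((-1) ^ (i - 1)) (face i ?V)))"
  proof (rule sum.cong)
    fix i assume "i \<in> {1..<Suc (length Bs)}"
    then obtain j where "i = Suc j" by (cases i) auto
    then show "scl ((-1) ^ i) (face (Suc i) ?W) = - prepend A x (scl ((-1) ^ (i - 1)) (face i ?V))"
      by (simp add: face_prepend lmap_scl[OF lmap_prepend])
  qed simp
  also have "\<dots> = - prepend A x (bar_diff (single1 ?V))"
    by (simp add: bar_diff_single1 lmap_sum[OF lmap_prepend] sum_negf del: sum.op_ivl_Suc)
  also have "face 1 ?W = prepend_merged A x B y (single1 w)"
    by (simp add: face_def prepend_merged_def prepend_single1 w)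
  finally show "bar_diff (prepend A x (prepend B y (single1 w))) =
    prepend_merged A x B y (single1 w) - prepend A x (bar_diff (prepend B y (single1 w)))"
    by (simp add: w prepend_single1)
qed

text \<open>If at most one of three blocks is odd, both ways of merging them are defined and agree by associativity of the
  product of decorations.  If at least two are odd, both ways meet a pair of odd blocks at one of their two steps and
  give \<open>0\<close>.\<close>

lemma prepend_merged_assoc:
  assumes "decorated (A # B # C # Bs) (x # y # z # \<xi>s)"
  shows "(if odd (card A) \<and> odd (card B) then 0 else prepend_merged (A \<union> B) (dia (card A) x y) C z v) =
    (if odd (card B) \<and> odd (card C) then 0 else prepend_merged A x (B \<union> C) (dia (card B) y z) v)"
proof -
  have d: "A \<inter> B = {}" "B \<inter> C = {}" "finite A" "finite B" "finite C"
    "x \<in> dec (card A)" "y \<in> dec (card B)" "z \<in> dec (card C)"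
    using assms by (auto simp: decorated_Cons intro: card_ge_0_finite)
  then have "card (A \<union> B) = card A + card B" "card (B \<union> C) = card B + card C"
    by (simp_all add: card_Un_disjoint)
  then show ?thesis
    using dia_assoc[OF d(6-8)] by (auto simp: prepend_merged_def Un_assoc)
qed

lemma bar_diff_prepend_prepend_merged:
  "bar_diff (prepend A x (prepend_merged B y C z v)) =
    (if odd (card B) \<and> odd (card C) then 0 else prepend_merged A x (B \<union> C) (dia (card B) y z) v) -
    prepend A x (bar_diff (prepend_merged B y C z v))"
  by (simp add: prepend_merged_def[of B] bar_diff_prepend_prepend lmap_0[OF lmap_prepend] lmap_0[OF lmap_bar_diff])

lemma bar_diff_prepend_merged_prepend:
  "bar_diff (prepend_merged A x B y (prepend C z v)) =
    (if odd (card A) \<and> odd (card B) then 0 else prepend_merged (A \<union> B) (dia (card A) x y) C z v) -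
    prepend_merged A x B y (bar_diff (prepend C z v))"
  by (simp add: prepend_merged_def[of A] bar_diff_prepend_prepend lmap_0[OF lmap_bar_diff])

lemma bar_diff_short: "length Bs \<le> 1 \<Longrightarrow> bar_diff (single1 (Bar \<alpha> Bs \<xi>s)) = 0"
  by (simp add: bar_diff_single1)

text \<open>For a bar with at least three blocks, unfolding the recursion twice leaves the two ways of merging the first three
  blocks, which cancel by \<open>prepend_merged_assoc\<close>, the terms where the first pair is merged and the tail is
  differentiated, which occur with both signs, and the square of the differential on the bar without its first block.\<close>

lemma bar_diff_bar_diff:
  "decorated Bs \<xi>s \<Longrightarrow> bar_diff (bar_diff (single1 (Bar \<alpha> Bs \<xi>s) :: 'a bar \<Rightarrow>\<^sub>0 'k::field)) = 0"
proof (induction Bs arbitrary: \<xi>s)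
  case Nil
  then show ?case by (simp add: bar_diff_short lmap_0[OF lmap_bar_diff])
next
  case (Cons A Bs)
  note d = Cons.prems
  consider "Bs = []" | B where "Bs = [B]" | B C Bs' where "Bs = B # C # Bs'"
    by (metis neq_Nil_conv)
  then show ?case
  proof cases
    case 1
    then show ?thesis by (simp add: bar_diff_short lmap_0[OF lmap_bar_diff])
  next
    case 2
    then obtain x y where \<xi>s: "\<xi>s = [x, y]" using d by (auto simp: decorated_Cons)
    have "bar_diff (single1 (Bar \<alpha> [A, B] [x, y]) :: 'a bar \<Rightarrow>\<^sub>0 'k) = prepend_merged A x B y (single1 (Bar \<alpha> [] []))"
      using bar_diff_prepend_prepend[of A x B y "single1 (Bar \<alpha> [] []) :: 'a bar \<Rightarrow>\<^sub>0 'k"]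
      by (simp add: prepend_single1 bar_diff_short lmap_0[OF lmap_prepend])
    then show ?thesis
      by (simp add: 2 \<xi>s prepend_merged_def prepend_single1 bar_diff_short lmap_0[OF lmap_bar_diff])
  next
    case 3
    then obtain x y z \<xi>s' where \<xi>s: "\<xi>s = x # y # z # \<xi>s'" using d by (auto simp: decorated_Cons)
    define u where "u = (single1 (Bar \<alpha> Bs' \<xi>s') :: 'a bar \<Rightarrow>\<^sub>0 'k)"
    note L = lmap_simps[OF lmap_bar_diff] lmap_simps[OF lmap_prepend]
    have IH: "bar_diff (bar_diff (prepend B y (prepend C z u))) = 0"
      using Cons.IH[of "y # z # \<xi>s'"] d by (auto simp: u_def prepend_single1 3 \<xi>s decorated_Cons)
    have assoc: "(if odd (card A) \<and> odd (card B) then 0 else prepend_merged (A \<union> B) (dia (card A) x y) C z u) =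
        (if odd (card B) \<and> odd (card C) then 0 else prepend_merged A x (B \<union> C) (dia (card B) y z) u)"
      by (rule prepend_merged_assoc) (use d 3 \<xi>s in simp)
    have "bar_diff (bar_diff (prepend A x (prepend B y (prepend C z u)))) =
        prepend A x (bar_diff (bar_diff (prepend B y (prepend C z u))))"
      unfolding bar_diff_prepend_prepend[of A x B y] bar_diff_prepend_prepend[of B y C z] L
        bar_diff_prepend_merged_prepend bar_diff_prepend_prepend_merged assoc
      by (simp add: algebra_simps)
    then show ?thesis
      using IH by (simp add: u_def prepend_single1 3 \<xi>s L)
  qed
qed

lemma keys_bar_diff:
  assumes "w \<in> basis_of (Ctot I)" "w' \<in> Poly_Mapping.keys (bar_diff (single1 w) :: 'a bar \<Rightarrow>\<^sub>0 'b::field)"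
  shows "w' \<in> basis_of (Ctot I) \<and> hdeg (Ctot I) w' = hdeg (Ctot I) w - 1 \<and>
    tdeg (Ctot I) w' = tdeg (Ctot I) w \<and> qdeg (Ctot I) w' = qdeg (Ctot I) w"
proof -
  obtain \<alpha> where a: "composition \<alpha> (card I)" "w \<in> bars \<alpha> I" using assms(1) by (auto simp: basis_Ctot)
  have "\<exists>i\<in>{1..<length (blocks w)}. w' \<in> Poly_Mapping.keys (scl ((-1) ^ (i - 1)) (face i w :: _ \<Rightarrow>\<^sub>0 'b))"
    using subsetD[OF keys_sum assms(2)[unfolded bar_diff_single1]] unfolding UN_iff .
  then obtain i where i: "i \<in> {1..<length (blocks w)}" "w' \<in> Poly_Mapping.keys (scl ((-1) ^ (i - 1)) (face i w :: _ \<Rightarrow>\<^sub>0 'b))" ..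
  have "w' \<in> bars \<alpha> I \<and> hdeg (Ctot I) w' = hdeg (Ctot I) w - 1 \<and>
      tdeg (Ctot I) w' = tdeg (Ctot I) w \<and> qdeg (Ctot I) w' = qdeg (Ctot I) w"
    by (rule keys_face[OF a i(1) subsetD[OF keys_scl i(2)]])
  then show ?thesis using a(1) by (auto simp: basis_Ctot)
qed

lemma chain_complex_Ctot: "chain_complex (Ctot I :: ('a bar, 'k::field) bicomplex)" (is "chain_complex ?C")
  unfolding chain_complex_def
proof (intro conjI allI ballI)
  show "lmap (bd ?C)" by simp
next
  fix k t q
  show "bd ?C ` homog ?C k t q \<subseteq> homog ?C (k - 1) t q"
  proof (rule image_subsetI)
    fix v assume v: "v \<in> homog ?C k t q"
    have "Poly_Mapping.keys (bar_diff v) \<subseteq> {x \<in> basis_of ?C. hdeg ?C x = k - 1 \<and>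
        tdeg ?C x = t \<and> qdeg ?C x = q}"
    proof (rule keys_lmap[OF lmap_bar_diff])
      fix x assume "x \<in> Poly_Mapping.keys v"
      then have "x \<in> basis_of ?C" "hdeg ?C x = k" "tdeg ?C x = t" "qdeg ?C x = q"
        using v by (auto simp: homog_def)
      then show "Poly_Mapping.keys (bar_diff (single1 x)) \<subseteq> {x \<in> basis_of ?C.
          hdeg ?C x = k - 1 \<and> tdeg ?C x = t \<and> qdeg ?C x = q}"
        using keys_bar_diff by fastforce
    qed
    then show "bd ?C v \<in> homog ?C (k - 1) t q" by (simp add: homog_def)
  qed
next
  fix v assume "v \<in> chain_space ?C"
  then have "bar_diff (bar_diff v) = (\<lambda>_. 0) v"
  proof (rule lmap_eqI_space)
    fix w assume "w \<in> basis_of ?C"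
    then show "bar_diff (bar_diff (single1 w)) = 0"
      by (cases w) (auto simp: basis_Ctot in_bars_iff bar_diff_bar_diff)
  qed (rule lmap_comp[OF lmap_bar_diff lmap_bar_diff], rule lmap_zero)
  then show "bd ?C (bd ?C v) = 0" by simp
qed

section \<open>Relabeling\<close>

lemma lmap_relabel [simp, intro]: "lmap (relabel f)"
  by (simp add: relabel_def)

lemma relabel_single1:
  "relabel f (single1 (Bar \<alpha> Bs \<xi>s)) = single1 (Bar \<alpha> (map (image f) Bs) \<xi>s)"
  by (simp add: relabel_def)

lemma map_card_image: "inj_on f (\<Union> (set Bs)) \<Longrightarrow> map card (map (image f) Bs) = map card Bs"
  by (auto simp: card_image inj_on_def intro!: card_image)

lemma decorated_image:
  assumes "inj_on f (\<Union> (set Bs))" "decorated Bs \<xi>s"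
  shows "decorated (map (image f) Bs) \<xi>s"
  using assms
proof (induction Bs arbitrary: \<xi>s)
  case (Cons B Bs)
  then obtain \<xi> \<xi>s' where *: "\<xi>s = \<xi> # \<xi>s'" "B \<inter> \<Union> (set Bs) = {}" "0 < card B"
    "\<xi> \<in> dec (card B)" "decorated Bs \<xi>s'"
    by (auto simp: decorated_Cons)
  have inj: "inj_on f B" "inj_on f (\<Union> (set Bs))" using Cons.prems(1) by (auto simp: inj_on_def)
  have "f ` B \<inter> f ` \<Union> (set Bs) = {}"
    using inj_on_image_Int[of f "B \<union> \<Union> (set Bs)" B "\<Union> (set Bs)"] Cons.prems(1) *(2) by simp
  then show ?case using Cons.IH[OF inj(2) *(5)] * by (auto simp: decorated_Cons card_image[OF inj(1)])
qed simp

lemma relabel_in_bars: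
  assumes "composition \<alpha> (card I)" "inj_on f I" "Bar \<alpha> Bs \<xi>s \<in> bars \<alpha> I"
  shows "Bar \<alpha> (map (image f) Bs) \<xi>s \<in> bars \<alpha> (f ` I)"
proof -
  have c: "composition \<alpha> (card (f ` I))" using assms(1,2) by (simp add: card_image)
  have *: "decorated Bs \<xi>s" "\<Union> (set Bs) = I" "psums (map card Bs) \<subseteq> psums \<alpha>"
    using assms(3) by (auto simp: in_bars_iff[OF assms(1)])
  have inj: "inj_on f (\<Union> (set Bs))" using assms(2) * by simp
  show ?thesis
    unfolding in_bars_iff[OF c] map_card_image[OF inj]
    using decorated_image[OF inj *(1)] *(2,3) by auto
qed

lemma relabel_bar_diff:
  assumes "decorated Bs \<xi>s" "inj_on f (\<Union> (set Bs))"
  shows "relabel f (bar_diff (single1 (Bar \<alpha> Bs \<xi>s) :: 'a bar \<Rightarrow>\<^sub>0 'k::field)) =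
    bar_diff (relabel f (single1 (Bar \<alpha> Bs \<xi>s)))"
proof -
  have "relabel f (face i (Bar \<alpha> Bs \<xi>s) :: 'a bar \<Rightarrow>\<^sub>0 'k) = face i (Bar \<alpha> (map (image f) Bs) \<xi>s)"
    if i: "i \<in> {1..<length Bs}" for i
  proof -
    obtain xs A B ys us x y vs where *: "Bs = xs @ A # B # ys" "\<xi>s = us @ x # y # vs"
      "length xs = length us" "i = Suc (length xs)"
      using assms(1) i by (rule face_cases)
    have "inj_on f A" "inj_on f B" using assms(2) by (auto simp: *(1) inj_on_def)
    then have c: "card (f ` A) = card A" "card (f ` B) = card B" by (auto intro: card_image)
    have "length (map (image f) xs) = length us" using *(3) by simp
    note fa = face_append[OF this, unfolded length_map]
    show ?thesis
      unfolding *(1,2,4) face_append[OF *(3)]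
      by (simp add: fa c relabel_single1 image_Un lmap_0[OF lmap_relabel])
  qed
  then show ?thesis
    by (simp add: bar_diff_single1 relabel_single1 lmap_sum[OF lmap_relabel] lmap_scl[OF lmap_relabel])
qed

lemma chain_map_relabel:
  assumes "inj_on f I"
  shows "chain_map (Ctot I) (Ctot (f ` I)) (relabel f)"
proof (rule chain_mapI)
  fix w w' assume w: "w \<in> basis_of (Ctot I)"
  obtain \<alpha> Bs \<xi>s where eq: "w = Bar \<alpha> Bs \<xi>s" by (cases w)
  have a: "composition \<alpha> (card I)" "Bar \<alpha> Bs \<xi>s \<in> bars \<alpha> I"
    using w by (auto simp: basis_Ctot eq bars_def)
  have *: "decorated Bs \<xi>s" "inj_on f (\<Union> (set Bs))"
    using a assms by (auto simp: in_bars_iff[OF a(1)])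
  show "relabel f (bd (Ctot I) (single1 w)) = bd (Ctot (f ` I)) (relabel f (single1 w))"
    using relabel_bar_diff[OF *] by (simp add: eq)
  assume "w' \<in> Poly_Mapping.keys (relabel f (single1 w))"
  then have w': "w' = Bar \<alpha> (map (image f) Bs) \<xi>s" by (simp add: eq relabel_single1)
  have "zip (map (image f) Bs) \<xi>s = map (\<lambda>(B, \<xi>). (f ` B, \<xi>)) (zip Bs \<xi>s)"
    by (simp add: zip_map1)
  moreover have "card (f ` B) = card B" if "(B, \<xi>) \<in> set (zip Bs \<xi>s)" for B \<xi>
  proof -
    have "B \<in> set Bs" using that by (rule set_zip_leftD)
    then show ?thesis using *(2) by (intro card_image) (auto simp: inj_on_def)
  qed
  moreover have "composition \<alpha> (card (f ` I))" using a(1) assms by (simp add: card_image)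
  ultimately show "w' \<in> basis_of (Ctot (f ` I)) \<and> hdeg (Ctot (f ` I)) w' = hdeg (Ctot I) w \<and>
    tdeg (Ctot (f ` I)) w' = tdeg (Ctot I) w \<and> qdeg (Ctot (f ` I)) w' = qdeg (Ctot I) w"
    using relabel_in_bars[OF a(1) assms a(2)]
    by (auto simp: w' eq basis_Ctot Ctot_def o_def split_def intro!: arg_cong[of _ _ sum_list] map_cong)
qed simp_all

lemma dg_species_Cspecies: "dg_species Cspecies"
  unfolding dg_species_def
proof (intro allI impI conjI ballI)
  fix I :: "'a set" and f g :: "'a \<Rightarrow> 'a" and v :: "'a bar \<Rightarrow>\<^sub>0 'b"
  let ?F = "Cspecies :: ('a, 'a bar, 'b) species"
  assume v: "v \<in> chain_space (obj ?F I)"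
  have blk: "B \<subseteq> I" if "w \<in> basis_of (Ctot I)" "B \<in> set (blocks w)" for w B
    using that by (cases w) (auto simp: basis_Ctot in_bars_iff)
  show "relab ?F I id v = v"
    by (rule lmap_eqI_all[of "relab ?F I id"]) (auto simp: Cspecies_def relabel_def)
  show "relab ?F I (g \<circ> f) v = relab ?F (f ` I) g (relab ?F I f v)"
    by (rule lmap_eqI_all[of "relab ?F I (g \<circ> f)"])
      (simp_all add: Cspecies_def relabel_def image_comp o_def lmap_comp[OF lmap_lin lmap_lin])
  assume "inj_on f I \<and> (\<forall>i\<in>I. f i = g i)"
  then have fg: "f i = g i" if "i \<in> I" for i using that by simp
  show "relab ?F I f v = relab ?F I g v"
  proof (rule lmap_eqI_space[OF v])
    fix w assume "w \<in> basis_of (obj ?F I)"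
    then have "f ` B = g ` B" if "B \<in> set (blocks w)" for B
      using blk[of w B] that fg by (auto simp: Cspecies_def intro!: image_cong)
    then show "relab ?F I f (single1 w) = relab ?F I g (single1 w)"
      by (simp add: Cspecies_def relabel_def cong: map_cong)
  qed (simp_all add: Cspecies_def)
qed (simp_all add: Cspecies_def chain_complex_Ctot chain_map_relabel)

section \<open>Cutting bars\<close>

text \<open>The condition under which the cut coproduct is nonzero, stated by a factorization of the list of blocks instead of
  an index.\<close>

definition splits :: "'a set \<Rightarrow> 'a set list \<Rightarrow> bool" where
  "splits S Bs \<longleftrightarrow> (\<exists>P Q. Bs = P @ Q \<and> S = \<Union> (set P))"

lemma splits_iff_take: "splits S Bs \<longleftrightarrow> (\<exists>j \<le> length Bs. S = \<Union> (set (take j Bs)))"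
proof
  assume "splits S Bs"
  then obtain P Q where "Bs = P @ Q" "S = \<Union> (set P)" by (auto simp: splits_def)
  then show "\<exists>j \<le> length Bs. S = \<Union> (set (take j Bs))" by (intro exI[of _ "length P"]) simp
qed (metis append_take_drop_id splits_def)

lemma splits_append_Cons:
  "splits S (xs @ C # ys) \<longleftrightarrow>
    splits S xs \<or> (\<exists>P Q. ys = P @ Q \<and> S = \<Union> (set xs) \<union> C \<union> \<Union> (set P))" (is "?L \<longleftrightarrow> ?R")
proof
  assume ?L
  then obtain P Q where PQ: "xs @ C # ys = P @ Q" "S = \<Union> (set P)" by (auto simp: splits_def)
  then consider us where "xs = P @ us" | us where "P = xs @ us" "C # ys = us @ Q"
    by (auto simp: append_eq_append_conv2)
  then show ?R
  proof cases
    case 1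
    then show ?thesis using PQ by (auto simp: splits_def)
  next
    case 2
    then consider "us = []" | us' where "us = C # us'" "ys = us' @ Q" by (auto simp: Cons_eq_append_conv)
    then show ?thesis
    proof cases
      case 1
      then show ?thesis using 2 PQ by (auto simp: splits_def)
    next
      case 3: 2
      then show ?thesis using 2 PQ(2) by (intro disjI2 exI[of _ us'] exI[of _ Q]) auto
    qed
  qed
next
  assume ?R
  then show ?L
  proof
    assume "splits S xs"
    then show ?L unfolding splits_def by (metis append.assoc)
  next
    assume "\<exists>P Q. ys = P @ Q \<and> S = \<Union> (set xs) \<union> C \<union> \<Union> (set P)"
    then obtain P Q where "ys = P @ Q" "S = \<Union> (set xs) \<union> C \<union> \<Union> (set P)" by auto
    then show ?L unfolding splits_def by (intro exI[of _ "xs @ C # P"] exI[of _ Q]) auto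
  qed
qed

text \<open>Merging blocks cannot create a place to cut, so faces of a bar that is killed by the cut are killed as well.\<close>

lemma splits_merge: "splits S (xs @ (A \<union> B) # ys) \<Longrightarrow> splits S (xs @ A # B # ys)"
  unfolding splits_append_Cons[of S xs "A \<union> B"]
proof (elim disjE exE conjE)
  fix P Q assume "ys = P @ Q" "S = \<Union> (set xs) \<union> (A \<union> B) \<union> \<Union> (set P)"
  then show ?thesis
    unfolding splits_def by (intro exI[of _ "xs @ A # B # P"] exI[of _ Q]) auto
qed (simp add: splits_append_Cons)

text \<open>A merge across the cut destroys it, so the face that joins the two sides contributes nothing.\<close>

lemma not_splits_inside:
  assumes "decorated (xs @ A # B # ys) (us @ x # y # vs)" "length xs = length us"
  shows "\<not> splits (\<Union> (set (xs @ [A]))) (xs @ (A \<union> B) # ys)"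
proof -
  have d: "A \<inter> \<Union> (set xs) = {}" "B \<inter> \<Union> (set xs) = {}" "A \<inter> B = {}" "A \<noteq> {}" "B \<noteq> {}"
    using assms by (auto simp: decorated_append decorated_Cons)
  have "\<not> splits (\<Union> (set (xs @ [A]))) xs"
  proof
    assume "splits (\<Union> (set (xs @ [A]))) xs"
    then obtain P Q where "xs = P @ Q" "\<Union> (set (xs @ [A])) = \<Union> (set P)" by (auto simp: splits_def)
    moreover from this(2) have "A \<subseteq> \<Union> (set P)" by auto
    ultimately have "A \<subseteq> \<Union> (set xs)" by auto
    then show False using d by auto
  qed
  moreover have "\<Union> (set (xs @ [A])) \<noteq> \<Union> (set xs) \<union> (A \<union> B) \<union> X" for X
  proof
    assume eq: "\<Union> (set (xs @ [A])) = \<Union> (set xs) \<union> (A \<union> B) \<union> X"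
    have "B \<subseteq> \<Union> (set (xs @ [A]))" unfolding eq by blast
    then have "B \<subseteq> A \<union> \<Union> (set xs)" by simp
    then show False using d by blast
  qed
  ultimately show ?thesis unfolding splits_append_Cons by blast
qed

lemma decorated_prefix_unique:
  assumes "decorated Bs \<xi>s" "i \<le> length Bs" "j \<le> length Bs" "\<Union> (set (take i Bs)) = \<Union> (set (take j Bs))"
  shows "i = j"
proof -
  have "card (\<Union> (set (take k Bs))) = sum_list (take k (map card Bs))" for k
  proof -
    have "decorated (take k Bs @ drop k Bs) (take k \<xi>s @ drop k \<xi>s)" using assms(1) by simp
    then have "decorated (take k Bs) (take k \<xi>s)"
      by (subst (asm) decorated_append) (use decorated_length[OF assms(1)] in auto)
    from card_Union_decorated[OF this] show ?thesis by (simp add: take_map)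
  qed
  from this[of i] this[of j]
  have "sum_list (take i (map card Bs)) = sum_list (take j (map card Bs))"
    unfolding assms(4) by (rule trans[OF sym])
  moreover have "positive (map card Bs)" using assms(1) by (auto simp: decorated_def)
  ultimately show ?thesis using sum_list_take_inj[of "map card Bs" i j] assms(2,3) by simp
qed

lemma cut_bar_split:
  assumes "decorated (P @ Q) (\<xi>s @ \<zeta>s)" "length P = length \<xi>s"
  shows "cut_bar p (\<Union> (set P)) T (Bar \<alpha> (P @ Q) (\<xi>s @ \<zeta>s)) =
    single1 (Bar (take p \<alpha>) P \<xi>s, Bar (drop p \<alpha>) Q \<zeta>s)"
proof -
  have "(THE j. j \<le> length (P @ Q) \<and> \<Union> (set P) = \<Union> (set (take j (P @ Q)))) = length P"
  proof (rule the_equality)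
    fix j assume "j \<le> length (P @ Q) \<and> \<Union> (set P) = \<Union> (set (take j (P @ Q)))"
    then show "j = length P"
      using decorated_prefix_unique[OF assms(1), of "length P" j] by simp
  qed simp
  moreover have "\<exists>j \<le> length (P @ Q). \<Union> (set P) = \<Union> (set (take j (P @ Q)))"
    by (intro exI[of _ "length P"]) simp
  ultimately show ?thesis
    unfolding cut_bar_def bar.case Let_def using assms(2) by simp
qed

lemma cut_bar_not_split: "\<not> splits S Bs \<Longrightarrow> cut_bar p S T (Bar \<alpha> Bs \<xi>s) = 0"
  unfolding splits_iff_take cut_bar_def bar.case by (rule if_not_P)

lemma lmap_cut_delta [simp, intro]: "lmap (cut_delta p S T)"
  by (simp add: cut_delta_def)

lemma cut_delta_single1 [simp]: "cut_delta p S T (single1 w) = cut_bar p S T w"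
  by (simp add: cut_delta_def)

lemma splitsE:
  assumes "splits S Bs" "decorated Bs \<xi>s"
  obtains P Q \<xi> \<zeta> where "Bs = P @ Q" "\<xi>s = \<xi> @ \<zeta>" "S = \<Union> (set P)" "length P = length \<xi>"
proof -
  obtain P Q where *: "Bs = P @ Q" "S = \<Union> (set P)" using assms(1) by (auto simp: splits_def)
  show ?thesis
    by (rule that[of P Q "take (length P) \<xi>s" "drop (length P) \<xi>s"])
      (use * decorated_length[OF assms(2)] in auto)
qed

lemma bd_tensor_single1:
  assumes "bd C = bar_diff" "bd D = bar_diff" "hdeg C w = int (length (blocks w))"
  shows "bd (tensor C D) (single1 (w, w')) =
    tens (bar_diff (single1 w)) (single1 w') +
    scl ((-1) ^ length (blocks w)) (tens (single1 w) (bar_diff (single1 w')))"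
  using assms by (simp add: tensor_def)

text \<open>The faces fall into three groups.  Those left of the cut are faces of the prefix; the one at the cut is killed; those
  right of it are faces of the suffix, and their signs differ from the signs in the suffix by one factor \<open>-1\<close> for every
  block of the prefix, which is the Koszul sign of the tensor product.\<close>

lemma cut_delta_bar_diff_split:
  fixes P Q :: "'a set list" and \<xi>s \<zeta>s :: "decoration list" and \<alpha> :: "nat list" and p :: nat
  assumes d: "decorated (P @ Q) (\<xi>s @ \<zeta>s)" and len: "length P = length \<xi>s"
  defines "w \<equiv> Bar \<alpha> (P @ Q) (\<xi>s @ \<zeta>s)"
    and "w1 \<equiv> Bar (take p \<alpha>) P \<xi>s" and "w2 \<equiv> Bar (drop p \<alpha>) Q \<zeta>s"
  shows "(cut_delta p (\<Union> (set P)) T (bar_diff (single1 w)) :: _ \<Rightarrow>\<^sub>0 'k::field) =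
    tens (bar_diff (single1 w1)) (single1 w2) +
    scl ((-1) ^ length P) (tens (single1 w1) (bar_diff (single1 w2)))"
proof -
  let ?cut = "cut_delta p (\<Union> (set P)) T :: _ \<Rightarrow> _ \<Rightarrow>\<^sub>0 'k"
  let ?m = "length P" and ?n = "length Q"
  have dP: "decorated P \<xi>s" and dQ: "decorated Q \<zeta>s"
    using d len by (auto simp: decorated_append)
  have low: "?cut (face i w) = tens (face i w1) (single1 w2)" if i: "i \<in> {1..<?m}" for i
  proof -
    obtain xs A B ys us x y vs where *: "P = xs @ A # B # ys" "\<xi>s = us @ x # y # vs"
      "length xs = length us" "i = Suc (length xs)"
      using dP i by (rule face_cases)
    show ?thesis
    proof (cases "odd (card A) \<and> odd (card B)")
      case True
      then show ?thesis
        unfolding w_def w1_def *(1,2,4) append.assoc append_Cons face_append[OF *(3)]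
        by (simp add: lmap_0[OF lmap_cut_delta])
    next
      case False
      have "decorated (xs @ A # B # (ys @ Q)) (us @ x # y # (vs @ \<zeta>s))" using d * by simp
      note merged = decorated_merge(4)[OF this *(3) False]
      have "cut_bar p (\<Union> (set (xs @ (A \<union> B) # ys))) T
          (Bar \<alpha> ((xs @ (A \<union> B) # ys) @ Q) ((us @ dia (card A) x y # vs) @ \<zeta>s)) =
        (single1 (Bar (take p \<alpha>) (xs @ (A \<union> B) # ys) (us @ dia (card A) x y # vs), w2) :: _ \<Rightarrow>\<^sub>0 'k)"
        unfolding w2_def by (rule cut_bar_split) (use merged * len in auto)
      moreover have "\<Union> (set P) = \<Union> (set (xs @ (A \<union> B) # ys))" by (auto simp: *(1))
      ultimately show ?thesis
        unfolding w_def w1_def *(1,2,4) append.assoc append_Cons face_append[OF *(3)] if_not_P[OF False]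
        by simp
    qed
  qed
  have mid: "?cut (face ?m w) = 0" if m: "1 \<le> ?m" "1 \<le> ?n"
  proof -
    obtain xs A where P: "P = xs @ [A]" using m(1) by (cases P rule: rev_cases) auto
    obtain B ys where Q: "Q = B # ys" using m(2) by (cases Q) auto
    obtain us x where xi: "\<xi>s = us @ [x]" "length xs = length us"
      using len P by (cases \<xi>s rule: rev_cases) auto
    obtain y vs where zeta: "\<zeta>s = y # vs" using dQ Q by (auto simp: decorated_Cons)
    have "decorated (xs @ A # B # ys) (us @ x # y # vs)" using d by (simp add: P Q xi(1) zeta)
    from not_splits_inside[OF this xi(2)]
    have "cut_bar p (\<Union> (set P)) T (Bar \<alpha> (xs @ (A \<union> B) # ys) \<theta>s) = (0 :: _ \<Rightarrow>\<^sub>0 'k)" for \<theta>s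
      unfolding P by (rule cut_bar_not_split)
    moreover have "?m = Suc (length xs)" by (simp add: P)
    moreover have "w = Bar \<alpha> (xs @ A # B # ys) (us @ x # y # vs)"
      by (simp add: w_def P Q xi(1) zeta)
    ultimately show ?thesis
      by (simp only: face_append[OF xi(2)]) (simp add: lmap_0[OF lmap_cut_delta])
  qed
  have high: "?cut (face (?m + i) w) = tens (single1 w1) (face i w2)" if i: "i \<in> {1..<?n}" for i
  proof -
    obtain xs A B ys us x y vs where *: "Q = xs @ A # B # ys" "\<zeta>s = us @ x # y # vs"
      "length xs = length us" "i = Suc (length xs)"
      using dQ i by (rule face_cases)
    have len': "length (P @ xs) = length (\<xi>s @ us)" using *(3) len by simp
    have w: "w = Bar \<alpha> ((P @ xs) @ A # B # ys) ((\<xi>s @ us) @ x # y # vs)"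
      by (simp add: w_def *(1,2))
    have i': "?m + i = Suc (length (P @ xs))" by (simp add: *(4))
    show ?thesis
    proof (cases "odd (card A) \<and> odd (card B)")
      case True
      then show ?thesis
        unfolding i' w face_append[OF len'] unfolding w2_def *(1,2,4) face_append[OF *(3)]
        by (simp add: lmap_0[OF lmap_cut_delta])
    next
      case False
      have "decorated ((P @ xs) @ A # B # ys) ((\<xi>s @ us) @ x # y # vs)" using d * by simp
      note merged = decorated_merge(4)[OF this len' False]
      have "cut_bar p (\<Union> (set P)) T
          (Bar \<alpha> (P @ (xs @ (A \<union> B) # ys)) (\<xi>s @ (us @ dia (card A) x y # vs))) =
        (single1 (w1, Bar (drop p \<alpha>) (xs @ (A \<union> B) # ys) (us @ dia (card A) x y # vs)) :: _ \<Rightarrow>\<^sub>0 'k)"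
        unfolding w1_def by (rule cut_bar_split) (use merged len in auto)
      then show ?thesis
        unfolding i' w face_append[OF len'] unfolding w2_def *(1,2,4) face_append[OF *(3)] if_not_P[OF False]
        by simp
    qed
  qed
  define g where "g i = scl ((-1) ^ (i - 1)) (?cut (face i w))" for i
  have "?cut (bar_diff (single1 w)) = (\<Sum>i\<in>{1..<?m + ?n}. g i)"
    by (simp add: bar_diff_single1 lmap_sum[OF lmap_cut_delta] lmap_scl[OF lmap_cut_delta] g_def w_def)
  also have "\<dots> = (\<Sum>i\<in>{1..<?m} \<union> (+) ?m ` {1..<?n}. g i)"
  proof (rule sum.mono_neutral_right)
    show "\<forall>i\<in>{1..<?m + ?n} - ({1..<?m} \<union> (+) ?m ` {1..<?n}). g i = 0"
    proof
      fix i assume i: "i \<in> {1..<?m + ?n} - ({1..<?m} \<union> (+) ?m ` {1..<?n})"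
      moreover have "i = ?m + (i - ?m) \<and> i - ?m \<in> {1..<?n}" if "i > ?m" using that i by auto
      ultimately have "i = ?m" by (metis DiffE UnCI atLeastLessThan_iff imageI linorder_neqE_nat)
      moreover from this have "1 \<le> ?m" "1 \<le> ?n" using i by (auto simp: Suc_le_eq)
      ultimately show "g i = 0" using mid by (simp add: g_def)
    qed
  qed auto
  also have "\<dots> = (\<Sum>i\<in>{1..<?m}. g i) + (\<Sum>i\<in>(+) ?m ` {1..<?n}. g i)"
    by (rule sum.union_disjoint) auto
  also have "(\<Sum>i\<in>(+) ?m ` {1..<?n}. g i) = (\<Sum>i\<in>{1..<?n}. g (?m + i))"
    by (subst sum.reindex) (simp_all add: o_def)
  also have "(\<Sum>i\<in>{1..<?m}. g i) = tens (bar_diff (single1 w1)) (single1 w2)"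
    using low by (simp add: g_def w1_def bar_diff_single1 lmap_sum[OF lmap_tens_left]
        lmap_scl[OF lmap_tens_left])
  also have "(\<Sum>i\<in>{1..<?n}. g (?m + i)) = scl ((-1) ^ ?m) (tens (single1 w1) (bar_diff (single1 w2)))"
  proof -
    have "g (?m + i) = scl ((-1) ^ ?m) (tens (single1 w1) (scl ((-1) ^ (i - 1)) (face i w2)))"
      if i: "i \<in> {1..<?n}" for i
    proof -
      have "(-1 :: 'k) ^ (?m + i - 1) = (-1) ^ ?m * (-1) ^ (i - 1)"
        using i by (simp flip: power_add)
      then show ?thesis using high[OF i] by (simp add: g_def lmap_scl[OF lmap_tens_right])
    qed
    then show ?thesis
      by (simp add: w2_def bar_diff_single1 lmap_sum[OF lmap_tens_right] scl_sum)
  qed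
  finally show ?thesis .
qed

lemma cut_delta_bar_diff_not_split:
  assumes d: "decorated Bs \<xi>s" and "\<not> splits S Bs"
  shows "cut_delta p S T (bar_diff (single1 (Bar \<alpha> Bs \<xi>s))) = (0 :: _ \<Rightarrow>\<^sub>0 'k::field)"
proof -
  have "cut_delta p S T (face i (Bar \<alpha> Bs \<xi>s)) = (0 :: _ \<Rightarrow>\<^sub>0 'k)" if i: "i \<in> {1..<length Bs}" for i
  proof -
    obtain xs A B ys us x y vs where *: "Bs = xs @ A # B # ys" "\<xi>s = us @ x # y # vs"
      "length xs = length us" "i = Suc (length xs)"
      using d i by (rule face_cases)
    have "\<not> splits S (xs @ (A \<union> B) # ys)" using assms(2) splits_merge *(1) by metis
    then show ?thesis
      unfolding *(1,2,4) face_append[OF *(3)]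
      by (simp add: lmap_0[OF lmap_cut_delta] cut_bar_not_split)
  qed
  then show ?thesis
    by (simp add: bar_diff_single1 lmap_sum[OF lmap_cut_delta] lmap_scl[OF lmap_cut_delta])
qed

text \<open>Membership in the basis, without reference to the ground set; the ground set is the union of the blocks.  In this
  form the condition passes to prefixes and suffixes.\<close>

definition wf_bar :: "nat list \<Rightarrow> 'a set list \<Rightarrow> decoration list \<Rightarrow> bool" where
  "wf_bar \<alpha> Bs \<xi>s \<longleftrightarrow> positive \<alpha> \<and> decorated Bs \<xi>s \<and> sum_list \<alpha> = sum_list (map card Bs) \<and>
    psums (map card Bs) \<subseteq> psums \<alpha>"

lemma bars_composition_wf:
  "composition \<alpha> (card I) \<and> Bar \<alpha>' Bs \<xi>s \<in> bars \<alpha> I \<longleftrightarrow> \<alpha>' = \<alpha> \<and> wf_bar \<alpha> Bs \<xi>s \<and> \<Union> (set Bs) = I"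
proof
  assume *: "composition \<alpha> (card I) \<and> Bar \<alpha>' Bs \<xi>s \<in> bars \<alpha> I"
  then show "\<alpha>' = \<alpha> \<and> wf_bar \<alpha> Bs \<xi>s \<and> \<Union> (set Bs) = I"
    using card_Union_decorated[of Bs \<xi>s]
    by (auto simp: in_bars_iff wf_bar_def composition_def)
next
  assume *: "\<alpha>' = \<alpha> \<and> wf_bar \<alpha> Bs \<xi>s \<and> \<Union> (set Bs) = I"
  then have "composition \<alpha> (card I)"
    using card_Union_decorated[of Bs \<xi>s] by (auto simp: wf_bar_def composition_def)
  with * show "composition \<alpha> (card I) \<and> Bar \<alpha>' Bs \<xi>s \<in> bars \<alpha> I"
    by (auto simp: in_bars_iff wf_bar_def)
qed

lemma basis_Ctot_wf: "Bar \<alpha> Bs \<xi>s \<in> basis_of (Ctot I) \<longleftrightarrow> wf_bar \<alpha> Bs \<xi>s \<and> \<Union> (set Bs) = I"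
  using bars_composition_wf[of _ I \<alpha> Bs \<xi>s] by (auto simp: basis_Ctot)

text \<open>Partial sums of the blocks of the prefix are at most the size of the cut, and those of the suffix are at least
  that size; so a refinement of the whole composition restricts to a refinement on either side.\<close>

lemma wf_bar_append:
  assumes "wf_bar (\<alpha> @ \<beta>) (P @ Q) (\<xi>s @ \<zeta>s)" "length P = length \<xi>s" "sum_list \<alpha> = sum_list (map card P)"
  shows "wf_bar \<alpha> P \<xi>s" "wf_bar \<beta> Q \<zeta>s"
proof -
  have d: "positive \<alpha>" "positive \<beta>" "decorated P \<xi>s" "decorated Q \<zeta>s"
    "sum_list \<beta> = sum_list (map card Q)"
    "psums (map card P) \<union> (+) (sum_list \<alpha>) ` psums (map card Q) \<subseteq> psums \<alpha> \<union> (+) (sum_list \<alpha>) ` psums \<beta>"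
    using assms by (auto simp: wf_bar_def decorated_append psums_append)
  have "psums (map card P) \<subseteq> psums \<alpha>"
  proof
    fix x assume x: "x \<in> psums (map card P)"
    then have "x \<le> sum_list \<alpha>" using psums_le assms(3) by metis
    then show "x \<in> psums \<alpha>" using x d(6) sum_in_psums[of \<alpha>] by (auto simp: subset_iff)
  qed
  then show "wf_bar \<alpha> P \<xi>s" using d assms(3) by (auto simp: wf_bar_def)
  have "psums (map card Q) \<subseteq> psums \<beta>"
  proof
    fix x assume x: "x \<in> psums (map card Q)"
    then have "sum_list \<alpha> + x \<in> psums \<alpha> \<union> (+) (sum_list \<alpha>) ` psums \<beta>" using d(6) by auto
    then show "x \<in> psums \<beta>" using psums_le[of "sum_list \<alpha> + x" \<alpha>] by auto
  qed
  then show "wf_bar \<beta> Q \<zeta>s" using d by (auto simp: wf_bar_def)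
qed

text \<open>The size of a prefix of the blocks is a partial sum of the composition, so every place to cut the blocks is a place to
  cut the composition.\<close>

lemma wf_bar_split:
  assumes "wf_bar \<gamma> (P @ Q) \<xi>s"
  obtains \<alpha> \<beta> where "\<gamma> = \<alpha> @ \<beta>" "sum_list \<alpha> = sum_list (map card P)"
proof -
  have "sum_list (map card P) \<in> psums (map card (P @ Q))" by (simp add: psums_append)
  then have "sum_list (map card P) \<in> psums \<gamma>" using assms by (auto simp: wf_bar_def)
  then obtain i where "sum_list (map card P) = sum_list (take i \<gamma>)" by (auto simp: psums_def)
  then show ?thesis using that[of "take i \<gamma>" "drop i \<gamma>"] by simp
qed

lemma card_Union_wf_bar: "wf_bar \<alpha> P \<xi>s \<Longrightarrow> card (\<Union> (set P)) = sum_list \<alpha>"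
  using card_Union_decorated[of P \<xi>s] by (simp add: wf_bar_def)

lemma lmap_Delta [simp, intro]: "lmap (Delta S T)"
  by (simp add: Delta_def)

lemma Delta_single1:
  assumes "positive \<alpha>" "p \<le> length \<alpha>" "card S = sum_list (take p \<alpha>)"
  shows "Delta S T (single1 (Bar \<alpha> Bs \<xi>s)) = cut_delta p S T (single1 (Bar \<alpha> Bs \<xi>s))"
proof -
  have "(THE p. p \<le> length \<alpha> \<and> card S = sum_list (take p \<alpha>)) = p"
    using sum_list_take_inj[OF assms(1) _ assms(2)] assms(2,3) by (intro the_equality) auto
  then show ?thesis using assms by (auto simp: Delta_def)
qed

lemma Delta_eq_0:
  assumes "\<not> (\<exists>p \<le> length \<alpha>. card S = sum_list (take p \<alpha>))"
  shows "Delta S T (single1 (Bar \<alpha> Bs \<xi>s)) = 0"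
  using assms unfolding Delta_def lin_single1 bar.sel by (rule if_not_P)

lemma Delta_not_split:
  assumes "positive \<alpha>" "\<not> splits S Bs"
  shows "Delta S T (single1 (Bar \<alpha> Bs \<xi>s)) = 0"
proof (cases "\<exists>p \<le> length \<alpha>. card S = sum_list (take p \<alpha>)")
  case True
  then obtain p where p: "p \<le> length \<alpha>" "card S = sum_list (take p \<alpha>)" by auto
  show ?thesis
    by (simp add: Delta_single1[OF assms(1) p] cut_bar_not_split[OF assms(2)])
qed (rule Delta_eq_0)

text \<open>The component of the coproduct is governed by the blocks alone: the index \<open>p\<close> is determined by the cut.  Writing the
  composition as a concatenation avoids computing with \<open>p\<close>.\<close>

lemma Delta_split:
  assumes "wf_bar (\<alpha> @ \<beta>) (P @ Q) (\<xi>s @ \<zeta>s)" "length P = length \<xi>s" "sum_list \<alpha> = sum_list (map card P)"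
    and "S = \<Union> (set P)"
  shows "Delta S T (single1 (Bar (\<alpha> @ \<beta>) (P @ Q) (\<xi>s @ \<zeta>s))) = single1 (Bar \<alpha> P \<xi>s, Bar \<beta> Q \<zeta>s)"
proof -
  have "card S = sum_list (take (length \<alpha>) (\<alpha> @ \<beta>))"
    using card_Union_wf_bar[OF wf_bar_append(1)[OF assms(1-3)]] assms(4) by simp
  then show ?thesis
    using assms cut_bar_split[of P Q \<xi>s \<zeta>s "length \<alpha>" T "\<alpha> @ \<beta>"]
    by (subst Delta_single1[of _ "length \<alpha>"]) (auto simp: wf_bar_def)
qed

lemma wf_bar_cut:
  assumes "wf_bar \<alpha> Bs \<xi>s" "splits S Bs"
  obtains \<alpha>1 \<alpha>2 P Q \<xi> \<zeta> where "\<alpha> = \<alpha>1 @ \<alpha>2" "Bs = P @ Q" "\<xi>s = \<xi> @ \<zeta>" "length P = length \<xi>"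
    "sum_list \<alpha>1 = sum_list (map card P)" "S = \<Union> (set P)" "wf_bar \<alpha>1 P \<xi>" "wf_bar \<alpha>2 Q \<zeta>"
proof -
  have "decorated Bs \<xi>s" using assms(1) by (simp add: wf_bar_def)
  with assms(2) obtain P Q \<xi> \<zeta> where *: "Bs = P @ Q" "\<xi>s = \<xi> @ \<zeta>" "S = \<Union> (set P)" "length P = length \<xi>"
    by (rule splitsE)
  obtain \<alpha>1 \<alpha>2 where a: "\<alpha> = \<alpha>1 @ \<alpha>2" "sum_list \<alpha>1 = sum_list (map card P)"
    using wf_bar_split[of \<alpha> P Q \<xi>s] assms(1) *(1) by metis
  have "wf_bar (\<alpha>1 @ \<alpha>2) (P @ Q) (\<xi> @ \<zeta>)" using assms(1) * a by simp
  from wf_bar_append[OF this *(4) a(2)] show ?thesis using that a * by blast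
qed

lemma decomp_complement:
  assumes "(S, T) \<in> decomp I" "decorated (P @ Q) (\<xi>s @ \<zeta>s)" "length P = length \<xi>s"
    "\<Union> (set (P @ Q)) = I" "S = \<Union> (set P)"
  shows "T = \<Union> (set Q)"
proof -
  have "\<Union> (set P) \<inter> \<Union> (set Q) = {}" using assms(2,3) by (simp add: decorated_append)
  moreover have "T = I - S" using assms(1) by (auto simp: decomp_def)
  ultimately show ?thesis using assms(5) by (auto simp flip: assms(4))
qed

lemma degs_tensor:
  "hdeg (tensor C D) (x, y) = hdeg C x + hdeg D y"
  "tdeg (tensor C D) (x, y) = tdeg C x + tdeg D y"
  "qdeg (tensor C D) (x, y) = qdeg C x + qdeg D y"
  by (simp_all add: tensor_def)

lemma bd_tensor_0 [simp]: "bd (tensor C D) 0 = 0"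
  by (rule lmap_0) simp

text \<open>On a bar that can be cut at \<open>S\<close> this is \<open>cut_delta_bar_diff_split\<close>; on any other bar both sides vanish, because no face
  of it can be cut at \<open>S\<close> either.\<close>

lemma chain_map_cut_delta:
  fixes I :: "'a set"
  assumes \<alpha>: "composition \<alpha> (card I)" and p: "p \<le> length \<alpha>" "card S = sum_list (take p \<alpha>)"
    and ST: "(S, T) \<in> decomp I"
  shows "chain_map (Cpx \<alpha> I) (tensor (Cpx (take p \<alpha>) S) (Cpx (drop p \<alpha>) T))
    (cut_delta p S T :: ('a bar \<Rightarrow>\<^sub>0 'k::field) \<Rightarrow> _)" (is "chain_map ?C ?D ?cut")
proof (rule chain_mapI)
  fix w assume "w \<in> basis_of ?C"
  moreover obtain \<alpha>' Bs \<xi>s where "w = Bar \<alpha>' Bs \<xi>s" by (cases w)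
  ultimately have w: "w = Bar \<alpha> Bs \<xi>s" "wf_bar \<alpha> Bs \<xi>s" "\<Union> (set Bs) = I"
    using \<alpha> bars_composition_wf[of \<alpha> I \<alpha>' Bs \<xi>s] by auto
  have d: "decorated Bs \<xi>s" using w(2) by (simp add: wf_bar_def)
  show "?cut (bd ?C (single1 w)) = bd ?D (?cut (single1 w))"
  proof (cases "splits S Bs")
    case True
    from this d obtain P Q \<xi> \<zeta> where *: "Bs = P @ Q" "\<xi>s = \<xi> @ \<zeta>" "S = \<Union> (set P)" "length P = length \<xi>"
      by (rule splitsE)
    have d': "decorated (P @ Q) (\<xi> @ \<zeta>)" using d * by simp
    show ?thesis
      unfolding w(1) *(1-3) bd_Cpx cut_delta_single1 cut_bar_split[OF d' *(4)]
        cut_delta_bar_diff_split[OF d' *(4)]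
      by (subst bd_tensor_single1) (simp_all add: Cpx_def)
  next
    case False
    then show ?thesis
      unfolding w(1) bd_Cpx cut_delta_single1 cut_bar_not_split[OF False]
        cut_delta_bar_diff_not_split[OF d False] by simp
  qed
  fix w' assume w': "w' \<in> Poly_Mapping.keys (?cut (single1 w))"
  have "splits S Bs"
    by (rule ccontr) (use w' in \<open>simp add: w(1) cut_bar_not_split\<close>)
  from this d obtain P Q \<xi> \<zeta> where *: "Bs = P @ Q" "\<xi>s = \<xi> @ \<zeta>" "S = \<Union> (set P)" "length P = length \<xi>"
    by (rule splitsE)
  have d': "decorated (P @ Q) (\<xi> @ \<zeta>)" using d * by simp
  have T: "T = \<Union> (set Q)" using decomp_complement[OF ST d' *(4) _ *(3)] w(3) *(1) by simp
  have eq: "w' = (Bar (take p \<alpha>) P \<xi>, Bar (drop p \<alpha>) Q \<zeta>)"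
    using w' by (simp add: w(1) *(1-3) cut_bar_split[OF d' *(4)])
  have "wf_bar (take p \<alpha> @ drop p \<alpha>) (P @ Q) (\<xi> @ \<zeta>)" using w(2) * by simp
  moreover have "sum_list (take p \<alpha>) = sum_list (map card P)"
    using p(2) card_Union_decorated[of P \<xi>] d' *(3,4) by (simp add: decorated_append)
  ultimately have "wf_bar (take p \<alpha>) P \<xi>" "wf_bar (drop p \<alpha>) Q \<zeta>"
    using wf_bar_append *(4) by blast+
  then have "Bar (take p \<alpha>) P \<xi> \<in> bars (take p \<alpha>) S" "Bar (drop p \<alpha>) Q \<zeta> \<in> bars (drop p \<alpha>) T"
    using bars_composition_wf *(3) T by blast+
  then show "w' \<in> basis_of ?D \<and> hdeg ?D w' = hdeg ?C w \<and> tdeg ?D w' = tdeg ?C w \<and> qdeg ?D w' = qdeg ?C w"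
    unfolding eq w(1) *(1,2) degs_tensor using *(4) by (simp add: Cpx_def)
qed simp_all

lemma cut_delta_relabel:
  assumes \<alpha>: "composition \<alpha> (card I)" and f: "inj_on f I" and ST: "(S, T) \<in> decomp I"
    and v: "v \<in> chain_space (Cpx \<alpha> I)"
  shows "cut_delta p (f ` S) (f ` T) (relabel f v) = tmap (relabel f) (relabel f) (cut_delta p S T v)"
proof (rule lmap_eqI_space[OF v])
  fix w assume "w \<in> basis_of (Cpx \<alpha> I)"
  moreover obtain \<alpha>' Bs \<xi>s where "w = Bar \<alpha>' Bs \<xi>s" by (cases w)
  ultimately have w: "w = Bar \<alpha> Bs \<xi>s" "wf_bar \<alpha> Bs \<xi>s" "\<Union> (set Bs) = I"
    using \<alpha> bars_composition_wf[of \<alpha> I \<alpha>' Bs \<xi>s] by auto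
  have d: "decorated Bs \<xi>s" using w(2) by (simp add: wf_bar_def)
  show "cut_delta p (f ` S) (f ` T) (relabel f (single1 w)) =
      tmap (relabel f) (relabel f) (cut_delta p S T (single1 w))"
  proof (cases "splits S Bs")
    case True
    from this d obtain P Q \<xi> \<zeta> where *: "Bs = P @ Q" "\<xi>s = \<xi> @ \<zeta>" "S = \<Union> (set P)" "length P = length \<xi>"
      by (rule splitsE)
    have d': "decorated (P @ Q) (\<xi> @ \<zeta>)" using d * by simp
    have "decorated (map (image f) Bs) \<xi>s"
      using f w(3) d by (intro decorated_image) auto
    then have df: "decorated (map (image f) P @ map (image f) Q) (\<xi> @ \<zeta>)" by (simp add: *)
    have len: "length (map (image f) P) = length \<xi>" using *(4) by simp
    have fS: "f ` \<Union> (set P) = \<Union> (set (map (image f) P))" by auto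
    show ?thesis
      unfolding w(1) *(1-3) relabel_single1 cut_delta_single1 cut_bar_split[OF d' *(4)] map_append
        fS cut_bar_split[OF df len] tmap_single1 tens_single1 by simp
  next
    case False
    have "\<not> splits (f ` S) (map (image f) Bs)"
    proof
      assume "splits (f ` S) (map (image f) Bs)"
      then obtain P Q where *: "Bs = P @ Q" "f ` S = \<Union> (image f ` set P)"
        by (auto simp: splits_def map_eq_append_conv)
      then have "f ` S = f ` \<Union> (set P)" by auto
      moreover have "S \<subseteq> I" "\<Union> (set P) \<subseteq> I" using ST w(3) *(1) by (auto simp: decomp_def)
      ultimately have "S = \<Union> (set P)" using f by (simp add: inj_on_image_eq_iff)
      then show False using False *(1) by (auto simp: splits_def)
    qed
    then show ?thesis
      by (simp add: w(1) relabel_single1 cut_bar_not_split False lmap_0[OF lmap_tmap])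
  qed
qed (rule lmap_comp[OF lmap_cut_delta lmap_relabel], rule lmap_comp[OF lmap_tmap lmap_cut_delta])

section \<open>The components of the coproduct\<close>

lemma basis_Ctot_cases:
  assumes "w \<in> basis_of (Ctot I)"
  obtains \<alpha> Bs \<xi>s where "w = Bar \<alpha> Bs \<xi>s" "wf_bar \<alpha> Bs \<xi>s" "\<Union> (set Bs) = I"
    "composition \<alpha> (card I)" "w \<in> bars \<alpha> I"
  using assms by (cases w) (use bars_composition_wf basis_Ctot_wf in metis)

lemma bd_tensor_Cpx: "bd (tensor (Cpx \<alpha> S) (Cpx \<beta> T)) = bd (tensor (Ctot S) (Ctot T))"
  by (simp add: tensor_def degs_Cpx_Ctot)

text \<open>The differential does not change the composition carried by a bar, so the claim can be checked on the summand of
  one composition, where the map is either the cut at a fixed \<open>p\<close> or zero.\<close>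

lemma chain_map_Delta:
  fixes I :: "'a set"
  assumes ST: "(S, T) \<in> decomp I"
  shows "chain_map (Ctot I) (tensor (Ctot S) (Ctot T)) (Delta S T :: ('a bar \<Rightarrow>\<^sub>0 'k::field) \<Rightarrow> _)"
    (is "chain_map ?C ?D ?\<Delta>")
proof -
  have *: "?\<Delta> (bd ?C (single1 w)) = bd ?D (?\<Delta> (single1 w)) \<and>
      (\<forall>w'\<in>Poly_Mapping.keys (?\<Delta> (single1 w)). w' \<in> basis_of ?D \<and> hdeg ?D w' = hdeg ?C w \<and>
        tdeg ?D w' = tdeg ?C w \<and> qdeg ?D w' = qdeg ?C w)"
    if "w \<in> basis_of ?C" for w
  proof -
    from that obtain \<alpha> Bs \<xi>s where w: "w = Bar \<alpha> Bs \<xi>s" "wf_bar \<alpha> Bs \<xi>s" "\<Union> (set Bs) = I"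
      "composition \<alpha> (card I)" "w \<in> bars \<alpha> I" by (rule basis_Ctot_cases)
    have bdw: "(bar_diff (single1 w) :: 'a bar \<Rightarrow>\<^sub>0 'k) \<in> chain_space (Cpx \<alpha> I)"
    proof -
      have "Poly_Mapping.keys (bar_diff (single1 w) :: 'a bar \<Rightarrow>\<^sub>0 'k) \<subseteq>
          (\<Union>i\<in>{1..<length (blocks w)}. Poly_Mapping.keys (scl ((-1) ^ (i - 1)) (face i w :: 'a bar \<Rightarrow>\<^sub>0 'k)))"
        unfolding bar_diff_single1 by (rule keys_sum)
      also have "\<dots> \<subseteq> bars \<alpha> I"
      proof (intro UN_least subsetI)
        fix i w' assume i: "i \<in> {1..<length (blocks w)}"
          and w': "w' \<in> Poly_Mapping.keys (scl ((-1) ^ (i - 1)) (face i w :: 'a bar \<Rightarrow>\<^sub>0 'k))"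
        show "w' \<in> bars \<alpha> I"
          using keys_face[OF w(4,5) i subsetD[OF keys_scl w']] by (rule conjunct1)
      qed
      finally show ?thesis by (simp add: chain_space_def)
    qed
    show ?thesis
    proof (cases "\<exists>p \<le> length \<alpha>. card S = sum_list (take p \<alpha>)")
      case True
      then obtain p where p: "p \<le> length \<alpha>" "card S = sum_list (take p \<alpha>)" by auto
      have pos: "positive \<alpha>" using w(2) by (simp add: wf_bar_def)
      have eq: "?\<Delta> v = cut_delta p S T v" if "v \<in> chain_space (Cpx \<alpha> I)" for v
      proof (rule lmap_eqI_space[OF that])
        fix x assume "x \<in> basis_of (Cpx \<alpha> I)"
        then obtain Cs \<theta>s where "x = Bar \<alpha> Cs \<theta>s" by (auto simp: bars_def)
        then show "?\<Delta> (single1 x) = cut_delta p S T (single1 x)"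
          using Delta_single1[OF pos p] by simp
      qed simp_all
      have wC: "(single1 w :: 'a bar \<Rightarrow>\<^sub>0 'k) \<in> chain_space (Cpx \<alpha> I)" using w(5) by simp
      note cm = chain_map_cut_delta[OF w(4) p ST, where ?'k = 'k]
      have "?\<Delta> (bd ?C (single1 w)) = bd ?D (?\<Delta> (single1 w))"
        using chain_mapD(3)[OF cm wC] eq[OF bdw] eq[OF wC] by (simp add: bd_tensor_Cpx)
      moreover have "w' \<in> basis_of ?D \<and> hdeg ?D w' = hdeg ?C w \<and>
          tdeg ?D w' = tdeg ?C w \<and> qdeg ?D w' = qdeg ?C w"
        if w': "w' \<in> Poly_Mapping.keys (?\<Delta> (single1 w))" for w'
      proof -
        have "w' \<in> Poly_Mapping.keys (cut_delta p S T (single1 w) :: _ \<Rightarrow>\<^sub>0 'k)"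
          using w' eq[OF wC] by simp
        from chain_mapD(2)[OF cm _ this] w(5)
        have *: "w' \<in> bars (take p \<alpha>) S \<times> bars (drop p \<alpha>) T" and
          deg: "hdeg ?D w' = hdeg ?C w" "tdeg ?D w' = tdeg ?C w" "qdeg ?D w' = qdeg ?C w"
          by (simp_all add: tensor_def split_def degs_Cpx_Ctot)
        have fin: "finite S" "finite T"
        proof -
          have "finite I"
            using w(2,3) by (auto simp: wf_bar_def decorated_def intro: card_ge_0_finite)
          then show "finite S" "finite T" using ST by (auto simp: decomp_def)
        qed
        have "card S + card T = card I"
          using ST fin by (auto simp: decomp_def card_Un_disjoint)
        then have "sum_list (drop p \<alpha>) = card T"
          using p(2) w(4) sum_list_append[of "take p \<alpha>" "drop p \<alpha>"] by (simp add: composition_def)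
        then have "composition (take p \<alpha>) (card S)" "composition (drop p \<alpha>) (card T)"
          using p(2) pos by (auto simp: composition_def dest: in_set_takeD in_set_dropD)
        then have "w' \<in> basis_of ?D" using * by (auto simp: basis_Ctot)
        then show ?thesis using deg by simp
      qed
      ultimately show ?thesis by blast
    next
      case False
      have eq: "?\<Delta> v = (\<lambda>_. 0) v" if "v \<in> chain_space (Cpx \<alpha> I)" for v
      proof (rule lmap_eqI_space[OF that])
        fix x assume "x \<in> basis_of (Cpx \<alpha> I)"
        then obtain Cs \<theta>s where "x = Bar \<alpha> Cs \<theta>s" by (auto simp: bars_def)
        then show "?\<Delta> (single1 x) = 0"
          using Delta_eq_0[OF False] by simp
      qed simp_all
      have wC: "(single1 w :: 'a bar \<Rightarrow>\<^sub>0 'k) \<in> chain_space (Cpx \<alpha> I)" using w(5) by simp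
      show ?thesis using eq[OF wC] eq[OF bdw] by simp
    qed
  qed
  show ?thesis
    by (rule chain_mapI) (use * in \<open>simp_all\<close>)
qed

lemma Delta_relabel:
  fixes v :: "'a bar \<Rightarrow>\<^sub>0 'k::field"
  assumes f: "inj_on f I" and ST: "(S, T) \<in> decomp I" and v: "v \<in> chain_space (Ctot I)"
  shows "Delta (f ` S) (f ` T) (relabel f v) = tmap (relabel f) (relabel f) (Delta S T v)"
proof (rule lmap_eqI_space[OF v])
  fix w assume "w \<in> basis_of (Ctot I)"
  then obtain \<alpha> Bs \<xi>s where w: "w = Bar \<alpha> Bs \<xi>s" "wf_bar \<alpha> Bs \<xi>s" "\<Union> (set Bs) = I"
    "composition \<alpha> (card I)" "w \<in> bars \<alpha> I" by (rule basis_Ctot_cases)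
  let ?e = "single1 w :: 'a bar \<Rightarrow>\<^sub>0 'k"
  have "S \<subseteq> I" using ST by (auto simp: decomp_def)
  then have card: "card (f ` S) = card S" using f by (intro card_image) (rule inj_on_subset)
  show "Delta (f ` S) (f ` T) (relabel f ?e) = tmap (relabel f) (relabel f) (Delta S T ?e)"
  proof (cases "\<exists>p \<le> length \<alpha>. card S = sum_list (take p \<alpha>)")
    case True
    then obtain p where p: "p \<le> length \<alpha>" "card S = sum_list (take p \<alpha>)" by auto
    have pos: "positive \<alpha>" using w(2) by (simp add: wf_bar_def)
    have p': "card (f ` S) = sum_list (take p \<alpha>)" using p(2) card by simp
    have "?e \<in> chain_space (Cpx \<alpha> I)" using w(5) by simp
    from cut_delta_relabel[OF w(4) f ST this, of p] show ?thesis
      unfolding w(1) relabel_single1 Delta_single1[OF pos p(1) p(2)] Delta_single1[OF pos p(1) p'] .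
  next
    case False
    then have "\<not> (\<exists>p \<le> length \<alpha>. card (f ` S) = sum_list (take p \<alpha>))" using card by simp
    then show ?thesis
      using False by (simp add: w(1) relabel_single1 lmap_0[OF lmap_tmap] Delta_eq_0 del: bex_simps not_ex)
  qed
qed (rule lmap_comp[OF lmap_Delta lmap_relabel], rule lmap_comp[OF lmap_tmap lmap_Delta])

text \<open>Both sides send a bar to the triple of its parts if its blocks factor as \<open>X @ Y @ Z\<close> with unions \<open>R\<close>, \<open>S\<close> and \<open>T\<close>, and to
  \<open>0\<close> otherwise.\<close>

lemma Delta_coassoc:
  fixes v :: "'a bar \<Rightarrow>\<^sub>0 'k::field"
  assumes disj: "R \<inter> S = {}" "R \<inter> T = {}" "S \<inter> T = {}" and v: "v \<in> chain_space (Ctot (R \<union> S \<union> T))"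
  shows "reassoc (tmap (Delta R S) id (Delta (R \<union> S) T v)) = tmap id (Delta S T) (Delta R (S \<union> T) v)"
proof (rule lmap_eqI_space[OF v])
  show "lmap (\<lambda>v. reassoc (tmap (Delta R S) id (Delta (R \<union> S) T v)))"
    by (rule lmap_comp[OF lmap_reassoc lmap_comp[OF lmap_tmap lmap_Delta]])
  show "lmap (\<lambda>v. tmap id (Delta S T) (Delta R (S \<union> T) v))"
    by (rule lmap_comp[OF lmap_tmap lmap_Delta])
  fix w assume "w \<in> basis_of (Ctot (R \<union> S \<union> T))"
  then obtain \<alpha> Bs \<xi>s where w: "w = Bar \<alpha> Bs \<xi>s" "wf_bar \<alpha> Bs \<xi>s" by (rule basis_Ctot_cases)
  let ?e = "single1 w :: 'a bar \<Rightarrow>\<^sub>0 'k"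
  have pos: "positive \<alpha>" if "wf_bar \<alpha> Bs \<xi>s" for \<alpha> and Bs :: "'a set list" and \<xi>s
    using that by (simp add: wf_bar_def)
  show "reassoc (tmap (Delta R S) id (Delta (R \<union> S) T ?e)) =
      tmap id (Delta S T) (Delta R (S \<union> T) ?e)"
  proof (cases "\<exists>X Y Z. Bs = X @ Y @ Z \<and> R = \<Union> (set X) \<and> S = \<Union> (set Y)")
    case True
    then obtain X Y Z where B: "Bs = X @ Y @ Z" "R = \<Union> (set X)" "S = \<Union> (set Y)" by auto
    have "splits R Bs" unfolding splits_def B by blast
    obtain \<xi> \<rho> where xi: "\<xi>s = \<xi> @ \<rho>" "length X = length \<xi>"
      by (rule that[of "take (length X) \<xi>s" "drop (length X) \<xi>s"])
        (use w(2) B(1) in \<open>auto simp: wf_bar_def dest!: decorated_length\<close>)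
    obtain \<zeta> \<theta> where zeta: "\<rho> = \<zeta> @ \<theta>" "length Y = length \<zeta>"
      by (rule that[of "take (length Y) \<rho>" "drop (length Y) \<rho>"])
        (use w(2) B(1) xi in \<open>auto simp: wf_bar_def dest!: decorated_length\<close>)
    have "wf_bar \<alpha> (X @ (Y @ Z)) (\<xi> @ \<rho>)" using w(2) B(1) xi by simp
    then obtain \<alpha>1 \<beta> where a1: "\<alpha> = \<alpha>1 @ \<beta>" "sum_list \<alpha>1 = sum_list (map card X)"
      by (rule wf_bar_split)
    have w1: "wf_bar (\<alpha>1 @ \<beta>) (X @ (Y @ Z)) (\<xi> @ \<rho>)" using w(2) B(1) xi a1 by simp
    note X = wf_bar_append[OF w1 xi(2) a1(2)]
    obtain \<alpha>2 \<alpha>3 where a2: "\<beta> = \<alpha>2 @ \<alpha>3" "sum_list \<alpha>2 = sum_list (map card Y)"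
      using X(2) by (rule wf_bar_split)
    have w2: "wf_bar (\<alpha>2 @ \<alpha>3) (Y @ Z) (\<zeta> @ \<theta>)" using X(2) a2 zeta by simp
    have w3: "wf_bar ((\<alpha>1 @ \<alpha>2) @ \<alpha>3) ((X @ Y) @ Z) ((\<xi> @ \<zeta>) @ \<theta>)" using w1 a2 zeta by simp
    have l3: "length (X @ Y) = length (\<xi> @ \<zeta>)" "sum_list (\<alpha>1 @ \<alpha>2) = sum_list (map card (X @ Y))"
      using xi zeta a1 a2 by simp_all
    note w4 = wf_bar_append(1)[OF w3 l3]
    have RS: "R \<union> S = \<Union> (set (X @ Y))" using B by simp
    have e1: "?e = single1 (Bar ((\<alpha>1 @ \<alpha>2) @ \<alpha>3) ((X @ Y) @ Z) ((\<xi> @ \<zeta>) @ \<theta>))"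
      and e2: "?e = single1 (Bar (\<alpha>1 @ \<beta>) (X @ (Y @ Z)) (\<xi> @ \<rho>))"
      using w(1) B xi zeta a1 a2 by simp_all
    have "reassoc (tmap (Delta R S) id (Delta (R \<union> S) T ?e)) =
        single1 (Bar \<alpha>1 X \<xi>, Bar \<alpha>2 Y \<zeta>, Bar \<alpha>3 Z \<theta>)"
      unfolding e1 Delta_split[OF w3 l3 RS] tmap_single1 Delta_split[OF w4 xi(2) a1(2) B(2)]
      by (simp add: reassoc_def)
    moreover have "tmap id (Delta S T) (Delta R (S \<union> T) ?e) =
        single1 (Bar \<alpha>1 X \<xi>, Bar \<alpha>2 Y \<zeta>, Bar \<alpha>3 Z \<theta>)"
      unfolding e2 Delta_split[OF w1 xi(2) a1(2) B(2)] tmap_single1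
      unfolding a2(1) zeta(1) Delta_split[OF w2 zeta(2) a2(2) B(3)] by simp
    ultimately show ?thesis by simp
  next
    case False
    have "reassoc (tmap (Delta R S) id (Delta (R \<union> S) T ?e)) = 0"
    proof (cases "splits (R \<union> S) Bs")
      case True
      with w(2) obtain \<alpha>1 \<alpha>2 P Q \<xi> \<zeta> where *: "\<alpha> = \<alpha>1 @ \<alpha>2" "Bs = P @ Q" "\<xi>s = \<xi> @ \<zeta>" "length P = length \<xi>"
        "sum_list \<alpha>1 = sum_list (map card P)" "R \<union> S = \<Union> (set P)" "wf_bar \<alpha>1 P \<xi>" "wf_bar \<alpha>2 Q \<zeta>"
        by (rule wf_bar_cut)
      have "\<not> splits R P"
      proof
        assume "splits R P"
        with *(7) obtain \<beta>1 \<beta>2 X Y \<xi>1 \<xi>2 where **: "P = X @ Y" "\<xi> = \<xi>1 @ \<xi>2" "length X = length \<xi>1" "R = \<Union> (set X)"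
          by (rule wf_bar_cut)
        have "\<Union> (set X) \<inter> \<Union> (set Y) = {}"
          using *(7) ** by (simp add: wf_bar_def decorated_append)
        then have RY: "R \<inter> \<Union> (set Y) = {}" by (simp only: **(4))
        have "S = (R \<union> S) - R" using disj(1) by blast
        also have "R \<union> S = R \<union> \<Union> (set Y)" using *(6) by (simp add: **(1,4))
        also have "(R \<union> \<Union> (set Y)) - R = \<Union> (set Y)" using RY by blast
        finally have "S = \<Union> (set Y)" .
        then show False using False *(2) **(1,4) by auto
      qed
      moreover have "wf_bar (\<alpha>1 @ \<alpha>2) (P @ Q) (\<xi> @ \<zeta>)" using w(2) * by simp
      ultimately show ?thesis
        unfolding w(1) *(1-3) using *(4-6)
        by (simp add: Delta_split tmap_single1 Delta_not_split[OF pos[OF *(7)]] lmap_0[OF lmap_reassoc])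
    next
      case False
      then show ?thesis
        by (simp add: w(1) Delta_not_split[OF pos[OF w(2)]] lmap_0[OF lmap_reassoc] lmap_0[OF lmap_tmap])
    qed
    moreover have "tmap id (Delta S T) (Delta R (S \<union> T) ?e) = 0"
    proof (cases "splits R Bs")
      case True
      with w(2) obtain \<alpha>1 \<alpha>2 P Q \<xi> \<zeta> where *: "\<alpha> = \<alpha>1 @ \<alpha>2" "Bs = P @ Q" "\<xi>s = \<xi> @ \<zeta>" "length P = length \<xi>"
        "sum_list \<alpha>1 = sum_list (map card P)" "R = \<Union> (set P)" "wf_bar \<alpha>1 P \<xi>" "wf_bar \<alpha>2 Q \<zeta>"
        by (rule wf_bar_cut)
      have "\<not> splits S Q" using False *(2,6) by (auto simp: splits_def)
      moreover have "wf_bar (\<alpha>1 @ \<alpha>2) (P @ Q) (\<xi> @ \<zeta>)" using w(2) * by simp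
      ultimately show ?thesis
        unfolding w(1) *(1-3) using *(4-6)
        by (simp add: Delta_split tmap_single1 Delta_not_split[OF pos[OF *(8)]])
    next
      case False
      then show ?thesis
        by (simp add: w(1) Delta_not_split[OF pos[OF w(2)]] lmap_0[OF lmap_tmap])
    qed
    ultimately show ?thesis by simp
  qed
qed

lemma lmap_counit [simp, intro]: "lmap (counit I)"
  by (cases "I = {}") (simp_all add: counit_def[abs_def])

lemma counit_single1: "counit {} (single1 w) = single1 ()"
  by (simp add: counit_def)

lemma Delta_counit_left:
  fixes v :: "'a bar \<Rightarrow>\<^sub>0 'b::field"
  assumes "v \<in> chain_space (Ctot I)"
  shows "left_unit (tmap (counit {}) id (Delta {} I v)) = v"
proof (rule lmap_eqI_space[OF assms])
  show "lmap (\<lambda>v. left_unit (tmap (counit {}) id (Delta {} I v)))"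
    by (rule lmap_comp[OF lmap_left_unit lmap_comp[OF lmap_tmap lmap_Delta]])
  fix w assume "w \<in> basis_of (Ctot I)"
  then obtain \<alpha> Bs \<xi>s where w: "w = Bar \<alpha> Bs \<xi>s" "wf_bar \<alpha> Bs \<xi>s" by (rule basis_Ctot_cases)
  let ?e = "single1 w :: 'a bar \<Rightarrow>\<^sub>0 'b"
  show "left_unit (tmap (counit {}) id (Delta {} I ?e)) = ?e"
    using w(2) Delta_split[of "[]" \<alpha> "[]" Bs "[]" \<xi>s "{}" I, where ?'b = 'b]
    by (simp add: w(1) tmap_single1 counit_single1 left_unit_def)
qed simp

lemma Delta_counit_right:
  fixes v :: "'a bar \<Rightarrow>\<^sub>0 'b::field"
  assumes "v \<in> chain_space (Ctot I)"
  shows "right_unit (tmap id (counit {}) (Delta I {} v)) = v"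
proof (rule lmap_eqI_space[OF assms])
  show "lmap (\<lambda>v. right_unit (tmap id (counit {}) (Delta I {} v)))"
    by (rule lmap_comp[OF lmap_right_unit lmap_comp[OF lmap_tmap lmap_Delta]])
  fix w assume "w \<in> basis_of (Ctot I)"
  then obtain \<alpha> Bs \<xi>s where w: "w = Bar \<alpha> Bs \<xi>s" "wf_bar \<alpha> Bs \<xi>s" "\<Union> (set Bs) = I" by (rule basis_Ctot_cases)
  let ?e = "single1 w :: 'a bar \<Rightarrow>\<^sub>0 'b"
  show "right_unit (tmap id (counit {}) (Delta I {} ?e)) = ?e"
    using Delta_split[of \<alpha> "[]" Bs "[]" \<xi>s "[]" I "{}", where ?'b = 'b] w(2,3) decorated_length[of Bs \<xi>s]
    by (simp add: w(1) tmap_single1 counit_single1 right_unit_def wf_bar_def)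
qed simp

section \<open>The comonoid\<close>

lemma finite_decomp: "finite I \<Longrightarrow> finite (decomp I)"
  by (rule finite_subset[of _ "Pow I \<times> Pow I"]) (auto simp: decomp_def)

lemma keys_incl: "y \<in> Poly_Mapping.keys (incl s u) \<Longrightarrow> \<exists>z\<in>Poly_Mapping.keys u. y = (s, z)"
  using keys_lin[of "\<lambda>x. single1 (s, x)" u] by (auto simp: incl_def split: if_splits)

lemma coproduct_eq_sum: "coproduct I v = (\<Sum>p\<in>decomp I. incl p (Delta (fst p) (snd p) v))"
  by (simp add: coproduct_def split_def)

lemma lmap_coproduct [simp, intro]: "lmap (coproduct I)"
  unfolding coproduct_eq_sum[abs_def] by (intro lmap_sums lmap_comp[OF lmap_incl lmap_Delta])

lemma Cspecies_simps [simp]: "obj Cspecies = Ctot" "relab Cspecies I f = relabel f"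
  by (simp_all add: Cspecies_def)

lemma lmap_bd_cauchy [simp, intro]: "lmap (bd (obj (cauchy F G) I))"
  and lmap_relab_cauchy [simp, intro]: "lmap (relab (cauchy F G) I f)"
  and lmap_cauchy_map [simp, intro]: "lmap (cauchy_map \<phi> \<psi> I)"
  and lmap_cauchy_assoc [simp, intro]: "lmap cauchy_assoc"
  and lmap_cauchy_left_unit [simp, intro]: "lmap cauchy_left_unit"
  and lmap_cauchy_right_unit [simp, intro]: "lmap cauchy_right_unit"
  by (simp_all add: cauchy_def cauchy_map_def cauchy_assoc_def cauchy_left_unit_def cauchy_right_unit_def)

lemma bd_cauchy_incl:
  "bd (obj (cauchy F G) I) (incl p u) = incl p (bd (tensor (obj F (fst p)) (obj G (snd p))) u)"
  by (rule lmap_eqI_all[OF lmap_comp[OF lmap_bd_cauchy lmap_incl] lmap_comp[OF lmap_incl lmap_bd_tensor]])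
    (simp add: cauchy_def split_def)

lemma relab_cauchy_incl:
  "relab (cauchy F G) I f (incl p u) =
    incl (f ` fst p, f ` snd p) (tmap (relab F (fst p) f) (relab G (snd p) f) u)"
  by (rule lmap_eqI_all[OF lmap_comp[OF lmap_relab_cauchy lmap_incl] lmap_comp[OF lmap_incl lmap_tmap]])
    (simp add: cauchy_def split_def)

lemma cauchy_map_incl:
  "cauchy_map \<phi> \<psi> I (incl p u) = incl p (tmap (\<phi> (fst p)) (\<psi> (snd p)) u)"
  by (rule lmap_eqI_all[OF lmap_comp[OF lmap_cauchy_map lmap_incl] lmap_comp[OF lmap_incl lmap_tmap]])
    (simp add: cauchy_map_def split_def)

text \<open>Relabeling matches the summands of the Cauchy product on \<open>I\<close> with those on \<open>f ` I\<close>; this makes naturality of the coproduct a statement about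
  its components.\<close>

lemma bij_betw_decomp_image:
  assumes "inj_on f I"
  shows "bij_betw (\<lambda>(S, T). (f ` S, f ` T)) (decomp I) (decomp (f ` I))"
proof (rule bij_betwI')
  fix x y assume xy: "x \<in> decomp I" "y \<in> decomp I"
  show "((\<lambda>(S, T). (f ` S, f ` T)) x = (\<lambda>(S, T). (f ` S, f ` T)) y) = (x = y)"
  proof
    assume "(\<lambda>(S, T). (f ` S, f ` T)) x = (\<lambda>(S, T). (f ` S, f ` T)) y"
    then have "f ` fst x = f ` fst y" "f ` snd x = f ` snd y" by (auto simp: split_def)
    moreover have "fst x \<subseteq> I" "snd x \<subseteq> I" "fst y \<subseteq> I" "snd y \<subseteq> I" using xy by (auto simp: decomp_def)
    ultimately show "x = y" using assms by (metis inj_on_image_eq_iff prod_eqI)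
  qed simp
next
  fix x assume "x \<in> decomp I"
  then obtain S T where x: "x = (S, T)" "S \<union> T = I" "S \<inter> T = {}" by (auto simp: decomp_def)
  then have "f ` S \<inter> f ` T = {}" using inj_on_image_Int[OF assms, of S T] by auto
  then show "(\<lambda>(S, T). (f ` S, f ` T)) x \<in> decomp (f ` I)"
    by (simp add: decomp_def x(1) flip: x(2) image_Un)
next
  fix y assume y: "y \<in> decomp (f ` I)"
  define S where "S = I \<inter> f -` fst y"
  define T where "T = I \<inter> f -` snd y"
  have im: "f ` (I \<inter> f -` X) = X" if "X \<subseteq> f ` I" for X
    using that by auto
  have "fst y \<subseteq> f ` I" "snd y \<subseteq> f ` I" using y by (auto simp: decomp_def)
  then have "f ` S = fst y" "f ` T = snd y" unfolding S_def T_def by (simp_all add: im)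
  moreover have "(S, T) \<in> decomp I"
    using y by (auto simp: decomp_def S_def T_def)
  ultimately show "\<exists>x\<in>decomp I. y = (\<lambda>(S, T). (f ` S, f ` T)) x"
    by (intro bexI[of _ "(S, T)"]) auto
qed

lemma species_map_coproduct:
  "species_map (Cspecies :: ('a, 'a bar, 'k::field) species) (cauchy Cspecies Cspecies) coproduct"
  unfolding species_map_def
proof (intro allI impI conjI ballI)
  fix I :: "'a set" assume I: "finite I"
  let ?C = "obj (Cspecies :: ('a, 'a bar, 'k) species) I"
  let ?D = "obj (cauchy Cspecies Cspecies :: ('a, _, 'k) species) I"
  show "chain_map ?C ?D (coproduct I)"
  proof (rule chain_mapI)
    fix w assume w: "w \<in> basis_of ?C"
    let ?e = "single1 w :: 'a bar \<Rightarrow>\<^sub>0 'k"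
    have e: "?e \<in> chain_space (Ctot I)" using w by simp
    have "coproduct I (bd ?C ?e) = (\<Sum>p\<in>decomp I. incl p (Delta (fst p) (snd p) (bd (Ctot I) ?e)))"
      by (simp add: coproduct_eq_sum)
    also have "\<dots> = (\<Sum>p\<in>decomp I. bd ?D (incl p (Delta (fst p) (snd p) ?e)))"
    proof (rule sum.cong)
      fix p assume "p \<in> decomp I"
      then have "(fst p, snd p) \<in> decomp I" by simp
      note cm = chain_mapD(3)[OF chain_map_Delta[OF this] e]
      show "incl p (Delta (fst p) (snd p) (bd (Ctot I) ?e)) = bd ?D (incl p (Delta (fst p) (snd p) ?e))"
        using cm by (simp add: bd_cauchy_incl)
    qed simp
    also have "\<dots> = bd ?D (coproduct I ?e)"
      by (simp add: coproduct_eq_sum lmap_sum[OF lmap_bd_cauchy])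
    finally show "coproduct I (bd ?C ?e) = bd ?D (coproduct I ?e)" .
    fix y assume "y \<in> Poly_Mapping.keys (coproduct I ?e)"
    then obtain p where p: "p \<in> decomp I" "y \<in> Poly_Mapping.keys (incl p (Delta (fst p) (snd p) ?e))"
      unfolding coproduct_eq_sum using keys_sum[of "\<lambda>p. incl p (Delta (fst p) (snd p) ?e)" "decomp I"] by auto
    obtain S T where ST: "p = (S, T)" by (cases p)
    obtain z where z: "y = ((S, T), z)" "z \<in> Poly_Mapping.keys (Delta S T ?e)"
      using keys_incl[OF p(2)] ST by auto
    have "(S, T) \<in> decomp I" using p(1) ST by simp
    from chain_mapD(2)[OF chain_map_Delta[OF this] _ z(2)] w
    show "y \<in> basis_of ?D \<and> hdeg ?D y = hdeg ?C w \<and> tdeg ?D y = tdeg ?C w \<and> qdeg ?D y = qdeg ?C w"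
      using p(1) by (cases z) (simp add: z(1) cauchy_def ST)
  qed simp_all
  fix f :: "'a \<Rightarrow> 'a" and v :: "'a bar \<Rightarrow>\<^sub>0 'k" assume f: "inj_on f I" and v: "v \<in> chain_space ?C"
  have "coproduct (f ` I) (relabel f v) =
      (\<Sum>p\<in>decomp I. incl (f ` fst p, f ` snd p) (Delta (f ` fst p) (f ` snd p) (relabel f v)))"
    unfolding coproduct_eq_sum
    by (subst sum.reindex_bij_betw[OF bij_betw_decomp_image[OF f], symmetric]) (simp add: split_def)
  also have "\<dots> = (\<Sum>p\<in>decomp I. relab (cauchy Cspecies Cspecies) I f (incl p (Delta (fst p) (snd p) v)))"
  proof (rule sum.cong)
    fix p assume "p \<in> decomp I"
    then obtain S T where p: "p = (S, T)" "(S, T) \<in> decomp I" by (cases p) auto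
    from v have "v \<in> chain_space (Ctot I)" by simp
    note Delta_relabel[OF f p(2) this]
    then show "incl (f ` fst p, f ` snd p) (Delta (f ` fst p) (f ` snd p) (relabel f v)) =
        relab (cauchy Cspecies Cspecies) I f (incl p (Delta (fst p) (snd p) v))"
      by (simp add: p(1) relab_cauchy_incl)
  qed simp
  also have "\<dots> = relab (cauchy Cspecies Cspecies) I f (coproduct I v)"
    by (simp add: coproduct_eq_sum lmap_sum[OF lmap_relab_cauchy])
  finally show "coproduct (f ` I) (relab Cspecies I f v) = relab (cauchy Cspecies Cspecies) I f (coproduct I v)"
    by simp
qed

text \<open>Both sides run over the decompositions of \<open>I\<close> into three ordered parts.\<close>

lemma sum_decomp_decomp:
  assumes "finite I"
  shows "(\<Sum>(U, T)\<in>decomp I. \<Sum>(R, S)\<in>decomp U. g R S T) = (\<Sum>(R, V)\<in>decomp I. \<Sum>(S, T)\<in>decomp V. g R S T)"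
proof -
  have fin: "\<forall>p\<in>decomp I. finite (decomp (fst p))" "\<forall>p\<in>decomp I. finite (decomp (snd p))"
    using assms by (auto simp: decomp_def intro!: finite_decomp[unfolded decomp_def])
  have "(\<Sum>(U, T)\<in>decomp I. \<Sum>(R, S)\<in>decomp U. g R S T) =
      (\<Sum>((U, T), (R, S))\<in>Sigma (decomp I) (\<lambda>p. decomp (fst p)). g R S T)"
    using sum.Sigma[OF finite_decomp[OF assms] fin(1), of "\<lambda>p q. g (fst q) (snd q) (snd p)"]
    by (simp add: split_def)
  also have "\<dots> = (\<Sum>((R, V), (S, T))\<in>Sigma (decomp I) (\<lambda>p. decomp (snd p)). g R S T)"
    by (rule sum.reindex_bij_witness[of _ "\<lambda>((R, V), (S, T)). ((R \<union> S, T), (R, S))"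
          "\<lambda>((U, T), (R, S)). ((R, S \<union> T), (S, T))"])
      (auto simp: decomp_def)
  also have "\<dots> = (\<Sum>(R, V)\<in>decomp I. \<Sum>(S, T)\<in>decomp V. g R S T)"
    using sum.Sigma[OF finite_decomp[OF assms] fin(2), of "\<lambda>p q. g (fst p) (fst q) (snd q)"]
    by (simp add: split_def)
  finally show ?thesis .
qed

text \<open>The inclusion of the summand of \<open>F \<cdot> (G \<cdot> H)\<close> at \<open>R, S, T\<close>.\<close>

definition incl3 :: "'a set \<Rightarrow> 'a set \<Rightarrow> 'a set \<Rightarrow> ('x \<times> 'y \<times> 'z \<Rightarrow>\<^sub>0 'k::field)
    \<Rightarrow> (('a set \<times> 'a set) \<times> 'x \<times> ('a set \<times> 'a set) \<times> 'y \<times> 'z \<Rightarrow>\<^sub>0 'k)" where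
  "incl3 R S T = lin (\<lambda>(x, y, z). single1 ((R, S \<union> T), x, (S, T), y, z))"

lemma lmap_incl3 [simp, intro]: "lmap (incl3 R S T)"
  by (simp add: incl3_def)

lemma tmap_sum_left:
  "tmap (\<lambda>u. \<Sum>i\<in>A. f i u) g v = (\<Sum>i\<in>A. tmap (f i) g v)"
  and tmap_sum_right: "tmap g (\<lambda>u. \<Sum>i\<in>A. f i u) v' = (\<Sum>i\<in>A. tmap g (f i) v')"
  by (rule lmap_eqI_all[OF lmap_tmap lmap_sums[OF lmap_tmap]],
      clarsimp simp: tmap_single1 lmap_sum[OF lmap_tens_left] lmap_sum[OF lmap_tens_right])+

lemma cauchy_assoc_left:
  fixes f :: "('w \<Rightarrow>\<^sub>0 'k::field) \<Rightarrow> ('x \<times> 'y \<Rightarrow>\<^sub>0 'k)" and u :: "'w \<times> 'z \<Rightarrow>\<^sub>0 'k"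
  shows "cauchy_assoc (incl q (tmap (\<lambda>v. incl p (f v)) id u)) =
    incl3 (fst p) (snd p) (snd q) (reassoc (tmap f id u))"
proof (rule lmap_eqI_all[OF lmap_comp[OF lmap_cauchy_assoc lmap_comp[OF lmap_incl lmap_tmap]]
      lmap_comp[OF lmap_incl3 lmap_comp[OF lmap_reassoc lmap_tmap]]])
  fix r :: "'w \<times> 'z"
  obtain w z where r: "r = (w, z)" by (cases r)
  have "cauchy_assoc (incl q (tens (incl p a) (single1 z))) =
      incl3 (fst p) (snd p) (snd q) (reassoc (tens a (single1 z)))" for a :: "'x \<times> 'y \<Rightarrow>\<^sub>0 'k"
    by (rule lmap_eqI_all[OF
          lmap_comp[OF lmap_cauchy_assoc lmap_comp[OF lmap_incl lmap_comp[OF lmap_tens_left lmap_incl]]]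
          lmap_comp[OF lmap_incl3 lmap_comp[OF lmap_reassoc lmap_tens_left]]])
      (auto simp: cauchy_assoc_def incl3_def reassoc_def split_def)
  then show "cauchy_assoc (incl q (tmap (\<lambda>v. incl p (f v)) id (single1 r))) =
      incl3 (fst p) (snd p) (snd q) (reassoc (tmap f id (single1 r)))"
    by (simp add: r tmap_single1)
qed

lemma incl_tmap_right:
  fixes f :: "('w \<Rightarrow>\<^sub>0 'k::field) \<Rightarrow> ('y \<times> 'z \<Rightarrow>\<^sub>0 'k)" and u :: "'x \<times> 'w \<Rightarrow>\<^sub>0 'k"
  shows "incl (R, S \<union> T) (tmap id (\<lambda>v. incl (S, T) (f v)) u) = incl3 R S T (tmap id f u)"
proof (rule lmap_eqI_all[OF lmap_comp[OF lmap_incl lmap_tmap] lmap_comp[OF lmap_incl3 lmap_tmap]])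
  fix p :: "'x \<times> 'w"
  obtain x w where p: "p = (x, w)" by (cases p)
  have "incl (R, S \<union> T) (tens (single1 x) (incl (S, T) a)) = incl3 R S T (tens (single1 x) a)"
    for a :: "'y \<times> 'z \<Rightarrow>\<^sub>0 'k"
    by (rule lmap_eqI_all[OF lmap_comp[OF lmap_incl lmap_comp[OF lmap_tens_right lmap_incl]]
          lmap_comp[OF lmap_incl3 lmap_tens_right]])
      (auto simp: incl3_def)
  then show "incl (R, S \<union> T) (tmap id (\<lambda>v. incl (S, T) (f v)) (single1 p)) = incl3 R S T (tmap id f (single1 p))"
    by (simp add: p tmap_single1)
qed

text \<open>After the summands of the two iterated coproducts are indexed by triples \<open>(R, S, T)\<close>, they agree one by one.\<close>

lemma coassociative_coproduct:
  "coassociative (Cspecies :: ('a, 'a bar, 'k::field) species) coproduct"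
  unfolding coassociative_def
proof (intro allI impI ballI)
  fix I :: "'a set" and v :: "'a bar \<Rightarrow>\<^sub>0 'k"
  assume I: "finite I" and "v \<in> chain_space (obj Cspecies I)"
  then have v: "v \<in> chain_space (Ctot I)" by simp
  have "cauchy_assoc (cauchy_map coproduct (\<lambda>_. id) I (coproduct I v)) =
      (\<Sum>(U, T)\<in>decomp I. cauchy_assoc (incl (U, T) (tmap (coproduct U) id (Delta U T v))))"
    by (simp add: coproduct_def[of I] lmap_sum[OF lmap_cauchy_map] lmap_sum[OF lmap_cauchy_assoc]
        cauchy_map_incl split_def)
  also have "\<dots> = (\<Sum>(U, T)\<in>decomp I. \<Sum>(R, S)\<in>decomp U. incl3 R S T (reassoc (tmap (Delta R S) id (Delta U T v))))"
    by (simp add: coproduct_eq_sum[abs_def] tmap_sum_left lmap_sum[OF lmap_incl]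
        lmap_sum[OF lmap_cauchy_assoc] cauchy_assoc_left split_def)
  also have "\<dots> = (\<Sum>(U, T)\<in>decomp I. \<Sum>(R, S)\<in>decomp U. incl3 R S T (reassoc (tmap (Delta R S) id (Delta (R \<union> S) T v))))"
    by (intro sum.cong refl, clarify, intro sum.cong refl) (auto simp: decomp_def)
  also have "\<dots> = (\<Sum>(R, V)\<in>decomp I. \<Sum>(S, T)\<in>decomp V. incl3 R S T (reassoc (tmap (Delta R S) id (Delta (R \<union> S) T v))))"
    by (rule sum_decomp_decomp[OF I])
  also have "\<dots> = (\<Sum>(R, V)\<in>decomp I. \<Sum>(S, T)\<in>decomp V. incl3 R S T (tmap id (Delta S T) (Delta R (S \<union> T) v)))"
  proof (intro sum.cong refl, clarify, intro sum.cong refl, clarify)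
    fix R V S T assume "(R, V) \<in> decomp I" "(S, T) \<in> decomp V"
    then have *: "R \<inter> S = {}" "R \<inter> T = {}" "S \<inter> T = {}" "I = R \<union> S \<union> T" by (auto simp: decomp_def)
    show "incl3 R S T (reassoc (tmap (Delta R S) id (Delta (R \<union> S) T v))) =
        incl3 R S T (tmap id (Delta S T) (Delta R (S \<union> T) v))"
      using Delta_coassoc[OF *(1-3), of v] v *(4) by simp
  qed
  also have "\<dots> = (\<Sum>(R, V)\<in>decomp I. incl (R, V) (tmap id (coproduct V) (Delta R V v)))"
  proof (intro sum.cong refl, clarify)
    fix R V assume "(R, V) \<in> decomp I"
    have "incl (R, V) (tmap id (coproduct V) (Delta R V v)) =
        (\<Sum>p\<in>decomp V. incl (R, V) (tmap id (\<lambda>u. incl p (Delta (fst p) (snd p) u)) (Delta R V v)))"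
      by (simp add: coproduct_eq_sum[abs_def] tmap_sum_right lmap_sum[OF lmap_incl])
    also have "\<dots> = (\<Sum>p\<in>decomp V. incl3 R (fst p) (snd p)
        (tmap id (Delta (fst p) (snd p)) (Delta R (fst p \<union> snd p) v)))"
    proof (rule sum.cong)
      fix p assume "p \<in> decomp V"
      then have "fst p \<union> snd p = V" by (auto simp: decomp_def)
      then show "incl (R, V) (tmap id (\<lambda>u. incl p (Delta (fst p) (snd p) u)) (Delta R V v)) =
          incl3 R (fst p) (snd p) (tmap id (Delta (fst p) (snd p)) (Delta R (fst p \<union> snd p) v))"
        using incl_tmap_right[of R "fst p" "snd p" "Delta (fst p) (snd p)" "Delta R V v"] by simp
    qed simp
    finally show "(\<Sum>(S, T)\<in>decomp V. incl3 R S T (tmap id (Delta S T) (Delta R (S \<union> T) v))) =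
        incl (R, V) (tmap id (coproduct V) (Delta R V v))"
      by (simp add: split_def)
  qed
  also have "\<dots> = cauchy_map (\<lambda>_. id) coproduct I (coproduct I v)"
    by (simp add: coproduct_def[of I] lmap_sum[OF lmap_cauchy_map] cauchy_map_incl split_def)
  finally show "cauchy_assoc (cauchy_map coproduct (\<lambda>_. id) I (coproduct I v)) =
      cauchy_map (\<lambda>_. id) coproduct I (coproduct I v)" .
qed

lemma tmap_zero_fun [simp]: "tmap (\<lambda>_. 0) g u = 0" "tmap g (\<lambda>_. 0) u' = 0"
  by (rule lmap_eqI_all[OF lmap_tmap lmap_zero], clarsimp simp: tmap_single1)+

lemma counit_nonempty: "I \<noteq> {} \<Longrightarrow> counit I = (\<lambda>_. 0)"
  by (simp add: counit_def)

lemma cauchy_left_unit_incl: "cauchy_left_unit (incl p u) = left_unit u"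
  by (rule lmap_eqI_all[OF lmap_comp[OF lmap_cauchy_left_unit lmap_incl] lmap_left_unit])
    (auto simp: cauchy_left_unit_def left_unit_def)

lemma cauchy_right_unit_incl: "cauchy_right_unit (incl p u) = right_unit u"
  by (rule lmap_eqI_all[OF lmap_comp[OF lmap_cauchy_right_unit lmap_incl] lmap_right_unit])
    (auto simp: cauchy_right_unit_def right_unit_def)

text \<open>The counit vanishes on nonempty sets, so only the summand with an empty first or second part survives.\<close>

lemma counital_coproduct:
  "counital (Cspecies :: ('a, 'a bar, 'k::field) species) coproduct counit"
  unfolding counital_def
proof (intro allI impI ballI conjI)
  fix I :: "'a set" and v :: "'a bar \<Rightarrow>\<^sub>0 'k"
  assume I: "finite I" and "v \<in> chain_space (obj Cspecies I)"
  then have v: "v \<in> chain_space (Ctot I)" by simp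
  have zero: "left_unit (tmap (counit S) id (Delta S T v)) = 0"
    "right_unit (tmap id (counit S) (Delta T S v)) = 0" if "S \<noteq> {}" for S T
    by (simp_all add: counit_nonempty[OF that] lmap_0[OF lmap_left_unit] lmap_0[OF lmap_right_unit])
  have "cauchy_left_unit (cauchy_map counit (\<lambda>_. id) I (coproduct I v)) =
      (\<Sum>(S, T)\<in>decomp I. left_unit (tmap (counit S) id (Delta S T v)))"
    by (simp add: coproduct_def lmap_sum[OF lmap_cauchy_map] lmap_sum[OF lmap_cauchy_left_unit]
        cauchy_map_incl cauchy_left_unit_incl split_def)
  also have "\<dots> = (\<Sum>(S, T)\<in>{({}, I)}. left_unit (tmap (counit S) id (Delta S T v)))"
  proof (intro sum.mono_neutral_right finite_decomp[OF I] ballI)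
    fix q assume "q \<in> decomp I - {({}, I)}"
    then have "fst q \<noteq> {}" by (auto simp: decomp_def)
    then show "(case q of (S, T) \<Rightarrow> left_unit (tmap (counit S) id (Delta S T v))) = 0"
      by (simp add: split_def zero)
  qed (auto simp: decomp_def)
  also have "\<dots> = v" using Delta_counit_left[OF v] by simp
  finally show "cauchy_left_unit (cauchy_map counit (\<lambda>_. id) I (coproduct I v)) = v" .
  have "cauchy_right_unit (cauchy_map (\<lambda>_. id) counit I (coproduct I v)) =
      (\<Sum>(S, T)\<in>decomp I. right_unit (tmap id (counit T) (Delta S T v)))"
    by (simp add: coproduct_def lmap_sum[OF lmap_cauchy_map] lmap_sum[OF lmap_cauchy_right_unit]
        cauchy_map_incl cauchy_right_unit_incl split_def)
  also have "\<dots> = (\<Sum>(S, T)\<in>{(I, {})}. right_unit (tmap id (counit T) (Delta S T v)))"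
  proof (intro sum.mono_neutral_right finite_decomp[OF I] ballI)
    fix q assume "q \<in> decomp I - {(I, {})}"
    then have "snd q \<noteq> {}" by (auto simp: decomp_def)
    then show "(case q of (S, T) \<Rightarrow> right_unit (tmap id (counit T) (Delta S T v))) = 0"
      by (simp add: split_def zero)
  qed (auto simp: decomp_def)
  also have "\<dots> = v" using Delta_counit_right[OF v] by simp
  finally show "cauchy_right_unit (cauchy_map (\<lambda>_. id) counit I (coproduct I v)) = v" .
qed

lemma basis_Ctot_empty: "w \<in> basis_of (Ctot {}) \<Longrightarrow> w = Bar [] [] []"
proof -
  assume "w \<in> basis_of (Ctot {})"
  then obtain \<alpha> Bs \<xi>s where w: "w = Bar \<alpha> Bs \<xi>s" "wf_bar \<alpha> Bs \<xi>s" "\<Union> (set Bs) = {}"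
    by (rule basis_Ctot_cases)
  then have "Bs = []" by (cases Bs) (auto simp: wf_bar_def decorated_def)
  then show ?thesis using w(1,2) by (cases \<alpha>) (auto simp: wf_bar_def)
qed

lemma species_map_counit:
  "species_map (Cspecies :: ('a, 'a bar, 'k::field) species) unit_species counit"
  unfolding species_map_def
proof (intro allI impI conjI ballI)
  fix I :: "'a set"
  show "chain_map (obj Cspecies I) (obj unit_species I) (counit I :: ('a bar \<Rightarrow>\<^sub>0 'k) \<Rightarrow> _)"
  proof (rule chain_mapI)
    fix w assume w: "w \<in> basis_of (obj (Cspecies :: ('a, 'a bar, 'k) species) I)"
    let ?e = "single1 w :: 'a bar \<Rightarrow>\<^sub>0 'k"
    have "counit I (bar_diff ?e) = 0"
    proof (cases "I = {}")
      case True
      then have "w = Bar [] [] []" using w basis_Ctot_empty by auto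
      then show ?thesis by (simp add: bar_diff_short lmap_0[OF lmap_counit])
    qed (simp add: counit_nonempty)
    then show "counit I (bd (obj Cspecies I) ?e) = bd (obj unit_species I) (counit I ?e)"
      by (simp add: unit_species_def)
    fix y assume y: "y \<in> Poly_Mapping.keys (counit I ?e)"
    have "I = {}"
      by (rule ccontr) (use y in \<open>simp add: counit_nonempty\<close>)
    moreover from this have "w = Bar [] [] []" using w basis_Ctot_empty by auto
    ultimately show "y \<in> basis_of (obj (unit_species :: (_, _, 'k) species) I) \<and>
        hdeg (obj (unit_species :: (_, _, 'k) species) I) y = hdeg (obj (Cspecies :: (_, _, 'k) species) I) w \<and>
        tdeg (obj (unit_species :: (_, _, 'k) species) I) y = tdeg (obj (Cspecies :: (_, _, 'k) species) I) w \<and>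
        qdeg (obj (unit_species :: (_, _, 'k) species) I) y = qdeg (obj (Cspecies :: (_, _, 'k) species) I) w"
      by (simp add: unit_species_def Ctot_def)
  qed (simp_all add: unit_species_def)
  fix f :: "'a \<Rightarrow> 'a" and v :: "'a bar \<Rightarrow>\<^sub>0 'k"
  show "counit (f ` I) (relab Cspecies I f v) = relab unit_species I f (counit I v)"
  proof (cases "I = {}")
    case True
    have "counit {} (relabel f v) = counit {} v"
      by (rule lmap_eqI_all[OF lmap_comp[OF lmap_counit lmap_relabel] lmap_counit])
        (simp add: relabel_def counit_single1)
    then show ?thesis by (simp add: True unit_species_def)
  qed (simp add: counit_nonempty unit_species_def)
qed

theorem proposition3p13:
  shows
    "(\<forall>(I :: 'a set) S T \<alpha> p.
        finite I \<and> composition \<alpha> (card I) \<and> p \<le> length \<alpha> \<and> (S, T) \<in> decomp I \<and>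
        card S = sum_list (take p \<alpha>) \<longrightarrow>
        (\<forall>(J :: 'b set) f. bij_betw f I J \<longrightarrow>
          (\<forall>v :: 'a bar \<Rightarrow>\<^sub>0 'k::field_char_0. v \<in> chain_space (Cpx \<alpha> I) \<longrightarrow>
            cut_delta p (f ` S) (f ` T) (relabel f v) = tmap (relabel f) (relabel f) (cut_delta p S T v))) \<and>
        chain_map (Cpx \<alpha> I) (tensor (Cpx (take p \<alpha>) S) (Cpx (drop p \<alpha>) T))
          (cut_delta p S T :: ('a bar \<Rightarrow>\<^sub>0 'k) \<Rightarrow> _))
     \<and> species_map (Cspecies :: ('a, 'a bar, 'k) species) (cauchy Cspecies Cspecies) coproduct
     \<and> coassociative (Cspecies :: ('a, 'a bar, 'k) species) coproduct
     \<and> counital (Cspecies :: ('a, 'a bar, 'k) species) coproduct counit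
     \<and> (\<forall>(R :: 'a set) S T. finite (R \<union> S \<union> T) \<and> R \<inter> S = {} \<and> R \<inter> T = {} \<and> S \<inter> T = {} \<longrightarrow>
        (\<forall>v :: 'a bar \<Rightarrow>\<^sub>0 'k. v \<in> chain_space (Ctot (R \<union> S \<union> T)) \<longrightarrow>
          reassoc (tmap (Delta R S) id (Delta (R \<union> S) T v)) = tmap id (Delta S T) (Delta R (S \<union> T) v)))
     \<and> (\<forall>I :: 'a set. finite I \<longrightarrow>
        (\<forall>v :: 'a bar \<Rightarrow>\<^sub>0 'k. v \<in> chain_space (Ctot I) \<longrightarrow>
          left_unit (tmap (counit {}) id (Delta {} I v)) = v \<and>
          right_unit (tmap id (counit {}) (Delta I {} v)) = v))
     \<and> counital_dg_comonoid (Cspecies :: ('a, 'a bar, 'k) species) coproduct counit"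
proof (intro conjI)
  show "counital_dg_comonoid (Cspecies :: ('a, 'a bar, 'k) species) coproduct counit"
    unfolding counital_dg_comonoid_def
    by (intro conjI dg_species_Cspecies species_map_coproduct species_map_counit
        coassociative_coproduct counital_coproduct)
qed (auto intro: cut_delta_relabel chain_map_cut_delta species_map_coproduct coassociative_coproduct
    counital_coproduct Delta_coassoc Delta_counit_left Delta_counit_right simp: bij_betw_def)

end
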